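(* Fix a prime $p$, an integer $k\ge 0$ and a sign $\pm$. For $(a,b)\in\mathbb{Z}^2$ let $R(a,b)=\mathbb{Z}[X]/(X^3-aX^2+bX\mp p^k)$. Fix positive integers $f$, $N$ and a divisor $d\mid N$. Then the value of the finite sum \[ \sum_{\substack{R\supseteq R(a,b)\\ [R:R(a,b)]=f}} a_R(d)\,W_R(N/d) \] depends only on the class of $(a,b)$ modulo $Nf^2$.
   Context: $R(a,b)$ is the cubic ring attached (via the Delone–Faddeev correspondence) to the binary cubic form $X^3-aX^2Y+bXY^2\mp p^kY^3$. The sum runs over overorders of $R(a,b)$: subrings $R$ of $R(a,b)\otimes\mathbb{Q}$ containing $R(a,b)$ with $[R:R(a,b)]=f$. For a cubic ring $R$ (free of rank 3 over $\mathbb{Z}$) and a prime $q$, let $R_q=R\otimes\mathbb{Z}_q$, let $k_1,\dots,k_r$ be the residue fields of the maximal ideals of $R_q$, put $\zeta_{R_q}(s)=\prod_i(1-|k_i|^{-s})^{-1}$, $L_{R_q}(s)=(1-q^{-s})\zeta_{R_q}(s)$, $L_R(s)=\prod_q L_{R_q}(s)=\sum_{n\ge1}W_R(n)n^{-s}$ (this defines $W_R(n)$). For $d\ge1$, $a_R(d)=1$ if $d$ is squarefree and $R_q$ is not Gorenstein for every prime $q\mid d$, and $a_R(d)=0$ otherwise (so $a_R(1)=1$). *)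

theory Defs
  imports
    "HOL-Algebra.IntRing"
    "HOL-Algebra.Subrings"
    "HOL-Computational_Algebra.Polynomial"
    "HOL-Computational_Algebra.Squarefree"
    "HOL-Number_Theory.Cong"
    "HOL-Library.FuncSet"
begin

section \<open>The cubic order and its overorders\<close>

definition rat_poly_ring :: "rat poly ring" where
  "rat_poly_ring = \<lparr>carrier = UNIV, mult = (*), one = 1, zero = 0, add = (+)\<rparr>"

definition cubic_poly :: "int \<Rightarrow> int \<Rightarrow> int \<Rightarrow> int poly" where
  "cubic_poly a b c = [:- c, b, - a, 1:]"

definition cubic_ideal :: "int \<Rightarrow> int \<Rightarrow> int \<Rightarrow> rat poly set" where
  "cubic_ideal a b c = PIdl\<^bsub>rat_poly_ring\<^esub> (map_poly of_int (cubic_poly a b c))"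

definition cubic_algebra :: "int \<Rightarrow> int \<Rightarrow> int \<Rightarrow> rat poly set ring" where
  "cubic_algebra a b c = rat_poly_ring Quot cubic_ideal a b c"

text \<open>Since \<^term>\<open>cubic_poly a b c\<close> is monic, \<open>\<int>[X]/(cubic_poly a b c)\<close> embeds into its
  tensor product with \<open>\<rat>\<close>, which is \<^term>\<open>cubic_algebra a b c\<close>. The order is given as the
  image of this embedding. The cubic may be reducible or have repeated roots.\<close>

definition cubic_order :: "int \<Rightarrow> int \<Rightarrow> int \<Rightarrow> rat poly set set" where
  "cubic_order a b c =
     range (\<lambda>g :: int poly. cubic_ideal a b c +>\<^bsub>rat_poly_ring\<^esub> map_poly of_int g)"

definition ring_index :: "('a, 'm) ring_scheme \<Rightarrow> 'a set \<Rightarrow> nat" where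
  "ring_index R H = card (a_rcosets\<^bsub>R\<^esub> H)"

definition overorders :: "int \<Rightarrow> int \<Rightarrow> int \<Rightarrow> nat \<Rightarrow> rat poly set ring set" where
  "overorders a b c f =
     {R. \<exists>S. R = (cubic_algebra a b c)\<lparr>carrier := S\<rparr> \<and> subring S (cubic_algebra a b c) \<and>
         cubic_order a b c \<subseteq> S \<and> ring_index R (cubic_order a b c) = f}"

section \<open>Completion at a prime\<close>

definition nat_ideal :: "('a, 'm) ring_scheme \<Rightarrow> nat \<Rightarrow> 'a set" where
  "nat_ideal R m = PIdl\<^bsub>R\<^esub> ([m] \<cdot>\<^bsub>R\<^esub> \<one>\<^bsub>R\<^esub>)"

text \<open>The inverse limit of the rings \<open>R/q\<^sup>nR\<close>. Elements of \<open>R/q\<^sup>nR\<close> are cosets, so a sequence is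
  compatible with the transition maps iff it is decreasing. For \<open>R = \<int>\<close> this is \<open>\<int>\<^sub>q\<close>, and for
  \<open>R\<close> finitely generated as an abelian group it is \<open>R \<otimes> \<int>\<^sub>q\<close>.\<close>

definition completion :: "('a, 'm) ring_scheme \<Rightarrow> nat \<Rightarrow> (nat \<Rightarrow> 'a set) ring" where
  "completion R q =
     (let Q = (\<lambda>n. R Quot nat_ideal R (q ^ n)) in
      \<lparr>carrier = {x. \<forall>n. x n \<in> carrier (Q n) \<and> x (Suc n) \<subseteq> x n},
       mult = (\<lambda>x y n. x n \<otimes>\<^bsub>Q n\<^esub> y n),
       one = (\<lambda>n. \<one>\<^bsub>Q n\<^esub>),
       zero = (\<lambda>n. \<zero>\<^bsub>Q n\<^esub>),
       add = (\<lambda>x y n. x n \<oplus>\<^bsub>Q n\<^esub> y n)\<rparr>)"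

definition padic_int :: "nat \<Rightarrow> (nat \<Rightarrow> int set) ring" where
  "padic_int q = completion \<Z> q"

text \<open>The structure map \<open>\<int>\<^sub>q \<rightarrow> R\<^sub>q\<close>: the integers in the coset \<open>z n\<close> all map to the same coset
  of \<open>q\<^sup>nR\<close>, which is the union below.\<close>

definition padic_scalar :: "('a, 'm) ring_scheme \<Rightarrow> nat \<Rightarrow> (nat \<Rightarrow> int set) \<Rightarrow> nat \<Rightarrow> 'a set" where
  "padic_scalar R q z =
     (\<lambda>n. \<Union>k\<in>z n. nat_ideal R (q ^ n) +>\<^bsub>R\<^esub> ([k] \<cdot>\<^bsub>R\<^esub> \<one>\<^bsub>R\<^esub>))"

section \<open>The Gorenstein property\<close>

text \<open>The dualizing module \<open>Hom(R\<^sub>q, \<int>\<^sub>q)\<close> of \<open>\<int>\<^sub>q\<close>-linear maps.\<close>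

definition local_dual ::
    "('a, 'm) ring_scheme \<Rightarrow> nat \<Rightarrow> ((nat \<Rightarrow> 'a set) \<Rightarrow> (nat \<Rightarrow> int set)) set" where
  "local_dual R q =
     (let Rq = completion R q; Zq = padic_int q in
      {\<phi> \<in> carrier Rq \<rightarrow>\<^sub>E carrier Zq.
         (\<forall>x\<in>carrier Rq. \<forall>y\<in>carrier Rq. \<phi> (x \<oplus>\<^bsub>Rq\<^esub> y) = \<phi> x \<oplus>\<^bsub>Zq\<^esub> \<phi> y) \<and>
         (\<forall>z\<in>carrier Zq. \<forall>x\<in>carrier Rq.
            \<phi> (padic_scalar R q z \<otimes>\<^bsub>Rq\<^esub> x) = z \<otimes>\<^bsub>Zq\<^esub> \<phi> x)})"

text \<open>The order \<open>R\<^sub>q\<close> is Gorenstein iff its dualizing module is an invertible \<open>R\<^sub>q\<close>-module. As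
  \<open>R\<^sub>q\<close> is semilocal, this means isomorphic to \<open>R\<^sub>q\<close>; \<open>\<Phi>\<close> is such an isomorphism, for the action
  \<open>(x \<phi>)(z) = \<phi>(x z)\<close> on the dual.\<close>

definition gorenstein_at :: "('a, 'm) ring_scheme \<Rightarrow> nat \<Rightarrow> bool" where
  "gorenstein_at R q \<longleftrightarrow>
     (let Rq = completion R q; Zq = padic_int q in
      \<exists>\<Phi>. bij_betw \<Phi> (carrier Rq) (local_dual R q) \<and>
        (\<forall>x\<in>carrier Rq. \<forall>y\<in>carrier Rq. \<forall>z\<in>carrier Rq.
           \<Phi> (x \<oplus>\<^bsub>Rq\<^esub> y) z = \<Phi> x z \<oplus>\<^bsub>Zq\<^esub> \<Phi> y z \<and>
           \<Phi> (x \<otimes>\<^bsub>Rq\<^esub> y) z = \<Phi> y (x \<otimes>\<^bsub>Rq\<^esub> z)))"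

definition a_coeff :: "('a, 'm) ring_scheme \<Rightarrow> nat \<Rightarrow> int" where
  "a_coeff R d =
     (if squarefree d \<and> (\<forall>q. Factorial_Ring.prime q \<and> q dvd d \<longrightarrow> \<not> gorenstein_at R q)
      then 1 else 0)"

section \<open>The L-series\<close>

text \<open>A function \<open>F\<close> on the positive integers stands for the formal Dirichlet series
  \<open>\<Sum>n\<ge>1. F n * n powr (- s)\<close>; its value at 0 is irrelevant. The product of a finite family of
  such series has as its coefficient at \<open>n\<close> the sum of \<open>\<Prod>i\<in>I. F i (g i)\<close> over all factorizations
  \<open>n = (\<Prod>i\<in>I. g i)\<close>.\<close>

definition dirichlet_mult :: "(nat \<Rightarrow> int) \<Rightarrow> (nat \<Rightarrow> int) \<Rightarrow> nat \<Rightarrow> int" where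
  "dirichlet_mult F G n = (\<Sum>m | m dvd n. F m * G (n div m))"

definition dirichlet_prod :: "'i set \<Rightarrow> ('i \<Rightarrow> nat \<Rightarrow> int) \<Rightarrow> nat \<Rightarrow> int" where
  "dirichlet_prod I F n =
     (\<Sum>g \<in> {g \<in> I \<rightarrow>\<^sub>E {m. m dvd n}. (\<Prod>i\<in>I. g i) = n}. \<Prod>i\<in>I. F i (g i))"

text \<open>For \<open>m \<ge> 2\<close> the series \<open>1 - m powr (- s)\<close> and its inverse, the sum of all
  \<open>(m ^ j) powr (- s)\<close>.\<close>

definition euler_poly :: "nat \<Rightarrow> nat \<Rightarrow> int" where
  "euler_poly m n = (if n = 1 then 1 else if n = m then -1 else 0)"

definition euler_factor :: "nat \<Rightarrow> nat \<Rightarrow> int" where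
  "euler_factor m n = (if \<exists>j. n = m ^ j then 1 else 0)"

definition local_zeta :: "('a, 'm) ring_scheme \<Rightarrow> nat \<Rightarrow> nat \<Rightarrow> int" where
  "local_zeta R q =
     dirichlet_prod {M. maximalideal M (completion R q)}
       (\<lambda>M. euler_factor (card (carrier (completion R q Quot M))))"

definition local_L :: "('a, 'm) ring_scheme \<Rightarrow> nat \<Rightarrow> nat \<Rightarrow> int" where
  "local_L R q = dirichlet_mult (euler_poly q) (local_zeta R q)"

text \<open>The coefficients of the product of \<^term>\<open>local_L R q\<close> over all primes \<open>q\<close>. Each factor
  has constant term 1 and is supported on powers of \<open>q\<close>, so the factors with \<open>q > n\<close> do not
  contribute to the coefficient at \<open>n\<close>.\<close>

definition W_coeff :: "('a, 'm) ring_scheme \<Rightarrow> nat \<Rightarrow> int" where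
  "W_coeff R n = dirichlet_prod {q. Factorial_Ring.prime q \<and> q \<le> n} (local_L R) n"

definition overorder_sum :: "int \<Rightarrow> int \<Rightarrow> int \<Rightarrow> nat \<Rightarrow> nat \<Rightarrow> nat \<Rightarrow> int" where
  "overorder_sum a b c f N d =
     (\<Sum>R\<in>overorders a b c f. a_coeff R d * W_coeff R (N div d))"

end

theory Submission
  imports Defs
begin

text \<open>An overorder \<open>R\<close> of index \<open>f\<close> satisfies \<open>f R \<subseteq> R(a,b)\<close>. In the basis \<open>1, X, X\<^sup>2\<close> it is a
  lattice in \<open>\<rat>\<^sup>3\<close>, and a product of two of its elements is \<open>u v / f\<^sup>2\<close> with \<open>u, v\<close> integral.
  Changing \<open>(a,b)\<close> modulo \<open>N f\<^sup>2\<close> changes this product by an element of \<open>N \<int>\<^sup>3\<close>, so the same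
  lattices are overorders for both cubics, and corresponding overorders are isomorphic as rings
  modulo \<open>N\<close>. It remains to see that both coefficients depend only on \<open>R/qR\<close> for primes
  \<open>q dvd N\<close>. As \<open>q\<close> lies in the Jacobson radical of \<open>R\<^sub>q\<close>, the residue fields of \<open>R\<^sub>q\<close> are those of
  \<open>R/qR\<close>. As \<open>R\<close> is free over \<open>\<int>\<close>, \<open>R\<^sub>q\<close> is Gorenstein iff some functional \<open>\<lambda>\<close> makes the
  pairing \<open>\<lambda>(x y)\<close> nondegenerate modulo \<open>q\<close>. For \<open>q\<close> not dividing \<open>n\<close>, the local factor at \<open>q\<close>
  does not contribute to the coefficient at \<open>n\<close>.\<close>

section \<open>Completions as coherent sequences\<close>

text \<open>An isomorphism modulo \<open>N\<close> does not in general lift to the completions, so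
  nothing can be transported between the rings R_q themselves: each invariant is first pushed down
  to R/qR and compared only there. No matrices or tensor products are used for this. An element of
  R_q is a sequence of representatives in R. A Z_q-linear functional on R_q is, at each level n, the
  reduction modulo q^n of an additive map from R to the integers, because such maps modulo q^n lift
  along a basis. Perfectness of the pairing modulo q^n comes from counting: an injective self-map of
  a finite set is surjective. On the side of the cubics, elements are replaced by their normal forms
  of degree < 3. In these the additive structure, the base order and the index no longer mention
  (a,b), and only the reduction of products does; this makes it meaningful to call one lattice an
  overorder for both cubics.\<close>

definition nat_residue :: "('a, 'm) ring_scheme \<Rightarrow> nat \<Rightarrow> 'a \<Rightarrow> 'a set" where
  "nat_residue R k x = nat_ideal R k +>\<^bsub>R\<^esub> x"

text \<open>Elements of the completion are handled through representatives: a coherent sequence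
  picks one from each coset, and \<open>padic_limit\<close> recovers the element.\<close>

definition coherent :: "('a, 'm) ring_scheme \<Rightarrow> nat \<Rightarrow> (nat \<Rightarrow> 'a) \<Rightarrow> bool" where
  "coherent R q s \<longleftrightarrow> (\<forall>n. s n \<in> carrier R \<and>
     nat_residue R (q ^ n) (s (Suc n)) = nat_residue R (q ^ n) (s n))"

definition padic_limit :: "('a, 'm) ring_scheme \<Rightarrow> nat \<Rightarrow> (nat \<Rightarrow> 'a) \<Rightarrow> nat \<Rightarrow> 'a set" where
  "padic_limit R q s = (\<lambda>n. nat_residue R (q ^ n) (s n))"

section \<open>Residue classes modulo an integer\<close>

context cring begin

lemma nat_ideal_eq: "nat_ideal R k = {[k] \<cdot> z | z. z \<in> carrier R}"
proof -
  have "x \<otimes> [k] \<cdot> \<one> = [k] \<cdot> x" if "x \<in> carrier R" for x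
    using that by (simp add: add_pow_rdistr)
  then show ?thesis by (force simp: nat_ideal_def cgenideal_def)
qed

lemma nat_ideal_ideal: "ideal (nat_ideal R k) R"
  unfolding nat_ideal_def by (simp add: cgenideal_ideal)

lemma nat_residue_zero: "nat_residue R k \<zero> = nat_ideal R k"
  unfolding nat_residue_def
  by (intro a_rcos_zero nat_ideal_ideal additive_subgroup.zero_closed ideal.axioms(1))

lemma nat_residue_eq_iff:
  assumes "x \<in> carrier R" "y \<in> carrier R"
  shows "nat_residue R k x = nat_residue R k y \<longleftrightarrow> (\<exists>z\<in>carrier R. x = y \<oplus> [k] \<cdot> z)"
proof -
  have "nat_residue R k x = nat_residue R k y \<longleftrightarrow> x \<ominus> y \<in> nat_ideal R k"
    unfolding nat_residue_def
    using quotient_eq_iff_same_a_r_cos[OF nat_ideal_ideal assms] by auto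
  also have "\<dots> \<longleftrightarrow> (\<exists>z\<in>carrier R. x \<ominus> y = [k] \<cdot> z)"
    by (auto simp: nat_ideal_eq)
  also have "\<dots> \<longleftrightarrow> (\<exists>z\<in>carrier R. x = y \<oplus> [k] \<cdot> z)"
  proof (intro bex_cong refl)
    fix z assume "z \<in> carrier R"
    then have "[k] \<cdot> z \<in> carrier R" by simp
    with assms show "(x \<ominus> y = [k] \<cdot> z) = (x = y \<oplus> [k] \<cdot> z)"
      by (metis a_comm add.inv_solve_right minus_eq)
  qed
  finally show ?thesis .
qed

lemma nat_residue_self: "x \<in> carrier R \<Longrightarrow> x \<in> nat_residue R k x"
  unfolding nat_residue_def
  by (meson nat_ideal_ideal ideal.axioms(1) abelian_subgroup.a_rcos_self abelian_subgroupI3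
      abelian_group_axioms)

lemma nat_residue_subset: "x \<in> carrier R \<Longrightarrow> nat_residue R k x \<subseteq> carrier R"
  unfolding nat_residue_def
  by (meson nat_ideal_ideal a_r_coset_subset_G additive_subgroup.a_subset ideal.axioms(1))

lemma nat_residue_memD:
  assumes "y \<in> nat_residue R k x" "x \<in> carrier R"
  shows "y \<in> carrier R" "nat_residue R k y = nat_residue R k x"
proof -
  show y: "y \<in> carrier R" using assms nat_residue_subset by blast
  show "nat_residue R k y = nat_residue R k x"
    using assms unfolding nat_residue_def
    by (metis a_repr_independence additive_subgroup.a_subgroup ideal.axioms(1) nat_ideal_ideal)
qed

lemma nat_residue_mem_iff:
  assumes "x \<in> carrier R"
  shows "y \<in> nat_residue R k x \<longleftrightarrow> y \<in> carrier R \<and> nat_residue R k y = nat_residue R k x"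
  using assms nat_residue_memD nat_residue_self by blast

lemma nat_residue_dvd:
  assumes "k dvd l" "x \<in> carrier R" "y \<in> carrier R" "nat_residue R l x = nat_residue R l y"
  shows "nat_residue R k x = nat_residue R k y"
proof -
  obtain m where l: "l = k * m" using assms(1) by blast
  obtain z where z: "z \<in> carrier R" "x = y \<oplus> [l] \<cdot> z"
    using assms nat_residue_eq_iff by blast
  have "[l] \<cdot> z = [k] \<cdot> ([m] \<cdot> z)"
    using z(1) by (simp add: l add.nat_pow_pow mult.commute)
  with z show ?thesis using assms nat_residue_eq_iff by auto
qed

text \<open>The completion expresses compatibility by inclusion of cosets. With
  \<open>k = q ^ n\<close> and \<open>l = q ^ Suc n\<close> this translates it into a congruence
  modulo the coarser ideal.\<close>

lemma nat_residue_subset_iff: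
  assumes "k dvd l" "x \<in> carrier R" "y \<in> carrier R"
  shows "nat_residue R l x \<subseteq> nat_residue R k y \<longleftrightarrow> nat_residue R k x = nat_residue R k y"
proof
  assume "nat_residue R l x \<subseteq> nat_residue R k y"
  then have "x \<in> nat_residue R k y" using assms nat_residue_self by blast
  then show "nat_residue R k x = nat_residue R k y" using nat_residue_memD assms by blast
next
  assume *: "nat_residue R k x = nat_residue R k y"
  show "nat_residue R l x \<subseteq> nat_residue R k y"
  proof
    fix z assume "z \<in> nat_residue R l x"
    then have z: "z \<in> carrier R" "nat_residue R l z = nat_residue R l x"
      using nat_residue_memD assms by blast+
    then have "nat_residue R k z = nat_residue R k y" using * nat_residue_dvd assms by blast
    then show "z \<in> nat_residue R k y" using z(1) nat_residue_self by blast
  qed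
qed

lemma quot_nat_ideal_simps:
  shows "carrier (R Quot nat_ideal R k) = nat_residue R k ` carrier R"
    and "\<one>\<^bsub>R Quot nat_ideal R k\<^esub> = nat_residue R k \<one>"
    and "\<zero>\<^bsub>R Quot nat_ideal R k\<^esub> = nat_residue R k \<zero>"
    and "x \<in> carrier R \<Longrightarrow> y \<in> carrier R \<Longrightarrow>
      nat_residue R k x \<otimes>\<^bsub>R Quot nat_ideal R k\<^esub> nat_residue R k y = nat_residue R k (x \<otimes> y)"
    and "x \<in> carrier R \<Longrightarrow> y \<in> carrier R \<Longrightarrow>
      nat_residue R k x \<oplus>\<^bsub>R Quot nat_ideal R k\<^esub> nat_residue R k y = nat_residue R k (x \<oplus> y)"
proof -
  interpret I: ideal "nat_ideal R k" R by (rule nat_ideal_ideal)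
  show "carrier (R Quot nat_ideal R k) = nat_residue R k ` carrier R"
    by (auto simp: FactRing_def A_RCOSETS_def' nat_residue_def)
  show "\<one>\<^bsub>R Quot nat_ideal R k\<^esub> = nat_residue R k \<one>"
    by (simp add: FactRing_def nat_residue_def)
  show "\<zero>\<^bsub>R Quot nat_ideal R k\<^esub> = nat_residue R k \<zero>"
    by (simp add: FactRing_def nat_residue_def a_rcos_zero[OF I.is_ideal])
  show "x \<in> carrier R \<Longrightarrow> y \<in> carrier R \<Longrightarrow>
      nat_residue R k x \<otimes>\<^bsub>R Quot nat_ideal R k\<^esub> nat_residue R k y = nat_residue R k (x \<otimes> y)"
    by (simp add: FactRing_def nat_residue_def I.rcoset_mult_add)
  show "x \<in> carrier R \<Longrightarrow> y \<in> carrier R \<Longrightarrow>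
      nat_residue R k x \<oplus>\<^bsub>R Quot nat_ideal R k\<^esub> nat_residue R k y = nat_residue R k (x \<oplus> y)"
    by (simp add: FactRing_def nat_residue_def I.a_rcos_sum)
qed

lemma nat_residue_mult_cong:
  assumes "nat_residue R k x = nat_residue R k x'" "nat_residue R k y = nat_residue R k y'"
    "x \<in> carrier R" "x' \<in> carrier R" "y \<in> carrier R" "y' \<in> carrier R"
  shows "nat_residue R k (x \<otimes> y) = nat_residue R k (x' \<otimes> y')"
  using assms quot_nat_ideal_simps(4) by metis

lemma nat_residue_add_cong:
  assumes "nat_residue R k x = nat_residue R k x'" "nat_residue R k y = nat_residue R k y'"
    "x \<in> carrier R" "x' \<in> carrier R" "y \<in> carrier R" "y' \<in> carrier R"
  shows "nat_residue R k (x \<oplus> y) = nat_residue R k (x' \<oplus> y')"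
  using assms quot_nat_ideal_simps(5) by metis

lemma nat_residue_inv_cong:
  assumes "nat_residue R k x = nat_residue R k x'" "x \<in> carrier R" "x' \<in> carrier R"
  shows "nat_residue R k (\<ominus> x) = nat_residue R k (\<ominus> x')"
proof -
  obtain z where z: "z \<in> carrier R" "x = x' \<oplus> [k] \<cdot> z"
    using assms nat_residue_eq_iff by blast
  then have "\<ominus> x = \<ominus> x' \<oplus> [k] \<cdot> (\<ominus> z)"
    using assms(3) by (simp add: minus_add add.nat_pow_inv)
  then show ?thesis using z assms nat_residue_eq_iff by blast
qed

section \<open>Arithmetic of coherent sequences and of the completion\<close>

lemma coherent_closed [simp]: "coherent R q s \<Longrightarrow> s n \<in> carrier R"
  by (simp add: coherent_def)

lemma coherent_Suc:
  "coherent R q s \<Longrightarrow> nat_residue R (q ^ n) (s (Suc n)) = nat_residue R (q ^ n) (s n)"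
  by (simp add: coherent_def)

lemma coherent_le:
  assumes "coherent R q s" "m \<le> n"
  shows "nat_residue R (q ^ m) (s n) = nat_residue R (q ^ m) (s m)"
  using assms(2)
proof (induction n rule: dec_induct)
  case (step n)
  have "nat_residue R (q ^ n) (s (Suc n)) = nat_residue R (q ^ n) (s n)"
    using assms(1) by (rule coherent_Suc)
  then have "nat_residue R (q ^ m) (s (Suc n)) = nat_residue R (q ^ m) (s n)"
    by (rule nat_residue_dvd[rotated -1]) (use step assms(1) in \<open>auto simp: le_imp_power_dvd\<close>)
  with step show ?case by simp
qed simp

lemma coherent_const: "x \<in> carrier R \<Longrightarrow> coherent R q (\<lambda>_. x)"
  by (simp add: coherent_def)

lemma coherent_mult: "coherent R q s \<Longrightarrow> coherent R q t \<Longrightarrow> coherent R q (\<lambda>n. s n \<otimes> t n)"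
  unfolding coherent_def by (metis m_closed nat_residue_mult_cong)

lemma coherent_add: "coherent R q s \<Longrightarrow> coherent R q t \<Longrightarrow> coherent R q (\<lambda>n. s n \<oplus> t n)"
  unfolding coherent_def by (metis a_closed nat_residue_add_cong)

lemma coherent_inv: "coherent R q s \<Longrightarrow> coherent R q (\<lambda>n. \<ominus> s n)"
  unfolding coherent_def by (metis a_inv_closed nat_residue_inv_cong)

lemma padic_limit_eq_iff:
  "padic_limit R q s = padic_limit R q t \<longleftrightarrow>
     (\<forall>n. nat_residue R (q ^ n) (s n) = nat_residue R (q ^ n) (t n))"
  by (auto simp: padic_limit_def fun_eq_iff)

text \<open>Choosing a representative in each coset turns a decreasing sequence of cosets into a
  coherent sequence. All later computations in the completion go through this.\<close>

lemma completion_carrier: "carrier (completion R q) = padic_limit R q ` Collect (coherent R q)"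
proof (intro equalityI subsetI)
  fix x assume "x \<in> carrier (completion R q)"
  then have x: "\<And>n. x n \<in> nat_residue R (q ^ n) ` carrier R" "\<And>n. x (Suc n) \<subseteq> x n"
    by (auto simp: completion_def quot_nat_ideal_simps)
  from x(1) have "\<forall>n. \<exists>y. y \<in> carrier R \<and> x n = nat_residue R (q ^ n) y" by blast
  then obtain s where s: "\<And>n. s n \<in> carrier R" "\<And>n. x n = nat_residue R (q ^ n) (s n)"
    by metis
  have "coherent R q s"
    unfolding coherent_def
    using s x(2) nat_residue_subset_iff[of "q ^ n" "q ^ Suc n" for n] by (metis dvd_triv_right power_Suc)
  moreover have "x = padic_limit R q s" using s by (auto simp: padic_limit_def)
  ultimately show "x \<in> padic_limit R q ` Collect (coherent R q)" by blast
next
  fix x assume "x \<in> padic_limit R q ` Collect (coherent R q)"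
  then obtain s where s: "coherent R q s" "x = padic_limit R q s" by blast
  have "nat_residue R (q ^ Suc n) (s (Suc n)) \<subseteq> nat_residue R (q ^ n) (s n)" for n
    using nat_residue_subset_iff[of "q ^ n" "q ^ Suc n"] s coherent_Suc by simp
  then show "x \<in> carrier (completion R q)"
    using s by (auto simp: completion_def quot_nat_ideal_simps padic_limit_def)
qed

lemma padic_limit_closed: "coherent R q s \<Longrightarrow> padic_limit R q s \<in> carrier (completion R q)"
  by (simp add: completion_carrier)

lemma completionE:
  assumes "x \<in> carrier (completion R q)"
  obtains s where "coherent R q s" "x = padic_limit R q s"
  using assms by (auto simp: completion_carrier)

lemma completion_mult:
  "coherent R q s \<Longrightarrow> coherent R q t \<Longrightarrow>
     padic_limit R q s \<otimes>\<^bsub>completion R q\<^esub> padic_limit R q t = padic_limit R q (\<lambda>n. s n \<otimes> t n)"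
  by (simp add: completion_def padic_limit_def quot_nat_ideal_simps)

lemma completion_add:
  "coherent R q s \<Longrightarrow> coherent R q t \<Longrightarrow>
     padic_limit R q s \<oplus>\<^bsub>completion R q\<^esub> padic_limit R q t = padic_limit R q (\<lambda>n. s n \<oplus> t n)"
  by (simp add: completion_def padic_limit_def quot_nat_ideal_simps)

lemma completion_one: "\<one>\<^bsub>completion R q\<^esub> = padic_limit R q (\<lambda>_. \<one>)"
  by (simp add: completion_def padic_limit_def quot_nat_ideal_simps)

lemma completion_zero: "\<zero>\<^bsub>completion R q\<^esub> = padic_limit R q (\<lambda>_. \<zero>)"
  by (simp add: completion_def padic_limit_def quot_nat_ideal_simps)

lemma completion_cring: "cring (completion R q)"
proof -
  note simps = completion_mult completion_add completion_one completion_zero coherent_mult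
    coherent_add coherent_inv coherent_const padic_limit_closed
  show ?thesis
  proof (rule cringI)
    show "abelian_group (completion R q)"
    proof (rule abelian_groupI)
      fix x assume "x \<in> carrier (completion R q)"
      then obtain s where s: "coherent R q s" "x = padic_limit R q s" by (rule completionE)
      then show "\<exists>y\<in>carrier (completion R q). y \<oplus>\<^bsub>completion R q\<^esub> x = \<zero>\<^bsub>completion R q\<^esub>"
        by (intro bexI[of _ "padic_limit R q (\<lambda>n. \<ominus> s n)"])
          (simp_all add: simps l_neg)
    qed (auto elim!: completionE simp: simps a_assoc, auto simp: a_comm)
    show "Group.comm_monoid (completion R q)"
      by (rule comm_monoidI) (auto elim!: completionE simp: simps m_assoc, auto simp: m_comm)
  qed (auto elim!: completionE simp: simps l_distr)
qed

end

section \<open>Functionals on the completion\<close>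

lemma int_ring_add_pow_nat: "[k] \<cdot>\<^bsub>\<Z>\<^esub> (x :: int) = int k * x" for k :: nat
  by (induction k) (simp_all add: add_pow_def nat_pow_def distrib_right)

lemma int_ring_residue_eq_iff:
  "nat_residue \<Z> k x = nat_residue \<Z> k y \<longleftrightarrow> [x = y] (mod int k)"
proof -
  have "nat_residue \<Z> k x = nat_residue \<Z> k y \<longleftrightarrow> (\<exists>z. x = y + int k * z)"
    by (subst cring.nat_residue_eq_iff[OF int_is_cring]) (simp_all add: int_ring_add_pow_nat)
  also have "\<dots> \<longleftrightarrow> [x = y] (mod int k)"
    by (metis cong_iff_lin cong_sym)
  finally show ?thesis .
qed

text \<open>For \<open>Q = 0\<close> the congruence is an equality.\<close>

definition additive_mod :: "('a, 'm) ring_scheme \<Rightarrow> int \<Rightarrow> ('a \<Rightarrow> int) \<Rightarrow> bool" where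
  "additive_mod R Q f \<longleftrightarrow>
     (\<forall>x\<in>carrier R. \<forall>y\<in>carrier R. [f (x \<oplus>\<^bsub>R\<^esub> y) = f x + f y] (mod Q))"

context cring begin

lemma additive_mod_zero:
  assumes "additive_mod R Q f"
  shows "[f \<zero> = 0] (mod Q)"
proof -
  have "[f (\<zero> \<oplus> \<zero>) = f \<zero> + f \<zero>] (mod Q)" using assms unfolding additive_mod_def by blast
  then have "[f \<zero> + 0 = f \<zero> + f \<zero>] (mod Q)" by simp
  then show ?thesis by (metis cong_add_lcancel cong_sym)
qed

lemma additive_mod_inv:
  assumes "additive_mod R Q f" "x \<in> carrier R"
  shows "[f (\<ominus> x) = - f x] (mod Q)"
proof -
  have "[f (x \<oplus> \<ominus> x) = f x + f (\<ominus> x)] (mod Q)" using assms unfolding additive_mod_def by blast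
  moreover have "[f (x \<oplus> \<ominus> x) = 0] (mod Q)"
    using additive_mod_zero[OF assms(1)] assms(2) by (simp add: r_neg)
  ultimately have "[f x + f (\<ominus> x) = f x + (- f x)] (mod Q)"
    by (simp add: cong_def)
  then show ?thesis by (simp only: cong_add_lcancel)
qed

lemma additive_mod_nat_mult:
  fixes k :: nat
  assumes "additive_mod R Q f" "x \<in> carrier R"
  shows "[f ([k] \<cdot> x) = int k * f x] (mod Q)"
proof (induction k)
  case 0
  then show ?case using additive_mod_zero[OF assms(1)] by simp
next
  case (Suc k)
  have "[f ([k] \<cdot> x \<oplus> x) = f ([k] \<cdot> x) + f x] (mod Q)"
    using assms unfolding additive_mod_def by simp
  also have "[f ([k] \<cdot> x) + f x = int k * f x + f x] (mod Q)"
    using Suc by (intro cong_add) auto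
  finally show ?case by (simp add: algebra_simps)
qed

lemma additive_mod_int_mult:
  fixes k :: int
  assumes "additive_mod R Q f" "x \<in> carrier R"
  shows "[f ([k] \<cdot> x) = k * f x] (mod Q)"
proof (cases "k \<ge> 0")
  case True
  then show ?thesis
    using additive_mod_nat_mult[OF assms, of "nat k"] by (simp add: add_pow_int_ge)
next
  case False
  have "[f (\<ominus> ([nat (- k)] \<cdot> x)) = - f ([nat (- k)] \<cdot> x)] (mod Q)"
    using assms by (intro additive_mod_inv) auto
  also have "[- f ([nat (- k)] \<cdot> x) = - (int (nat (-k)) * f x)] (mod Q)"
    using additive_mod_nat_mult[OF assms] by (simp only: cong_minus_minus_iff)
  finally show ?thesis using False by (simp add: add_pow_int_lt)
qed

lemma additive_simps:
  fixes k :: nat and l :: int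
  assumes "additive_mod R 0 f" "x \<in> carrier R"
  shows "y \<in> carrier R \<Longrightarrow> f (x \<oplus> y) = f x + f y" "f (\<ominus> x) = - f x"
    "f ([k] \<cdot> x) = int k * f x" "f ([l] \<cdot> x) = l * f x"
  using assms additive_mod_inv[OF assms] additive_mod_nat_mult[OF assms]
    additive_mod_int_mult[OF assms]
  by (auto simp: additive_mod_def)

lemma additive_residue:
  assumes "additive_mod R 0 f" "x \<in> carrier R" "y \<in> carrier R"
    "nat_residue R k x = nat_residue R k y"
  shows "[f x = f y] (mod int k)"
proof -
  obtain z where "z \<in> carrier R" "x = y \<oplus> [k] \<cdot> z" using assms nat_residue_eq_iff by blast
  then have "f x = f y + int k * f z" using assms(3) by (simp add: additive_simps[OF assms(1)])
  then show ?thesis by (simp add: cong_iff_dvd_diff)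
qed

lemma additive_coherent:
  assumes "additive_mod R 0 f" "coherent R q s"
  shows "coherent \<Z> q (\<lambda>n. f (s n))"
  using assms additive_residue
  by (auto simp: coherent_def int_ring_residue_eq_iff simp del: of_nat_power)

text \<open>The continuous extension of an additive \<open>f\<close> to the completion. By
  \<open>additive_residue\<close> all elements of the coset \<open>x n\<close> have the same value
  modulo \<open>q ^ n\<close>, so the choice made by \<open>SOME\<close> is harmless. The
  restriction to the carrier matches the extensional functions in \<open>local_dual\<close>.\<close>

definition completed_map :: "nat \<Rightarrow> ('a \<Rightarrow> int) \<Rightarrow> (nat \<Rightarrow> 'a set) \<Rightarrow> nat \<Rightarrow> int set" where
  "completed_map q f = (\<lambda>x\<in>carrier (completion R q). \<lambda>n. nat_residue \<Z> (q ^ n) (f (SOME r. r \<in> x n)))"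

lemma completed_map_limit:
  assumes "additive_mod R 0 f" "coherent R q s"
  shows "completed_map q f (padic_limit R q s) = padic_limit \<Z> q (\<lambda>n. f (s n))"
proof
  fix n
  define r where "r = (SOME r. r \<in> padic_limit R q s n)"
  have "s n \<in> padic_limit R q s n"
    using assms by (simp add: padic_limit_def nat_residue_self)
  then have "r \<in> nat_residue R (q ^ n) (s n)"
    unfolding r_def by (metis padic_limit_def someI_ex)
  then have "r \<in> carrier R" "nat_residue R (q ^ n) r = nat_residue R (q ^ n) (s n)"
    using nat_residue_memD assms coherent_closed by blast+
  then have "[f r = f (s n)] (mod int (q ^ n))"
    using additive_residue assms by (simp del: of_nat_power)
  then show "completed_map q f (padic_limit R q s) n = padic_limit \<Z> q (\<lambda>n. f (s n)) n"
    using padic_limit_closed[OF assms(2)]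
    by (simp add: completed_map_def r_def padic_limit_def[of \<Z>] int_ring_residue_eq_iff)
qed

lemma nat_residue_scalar_cong:
  assumes "[i = j] (mod int k)"
  shows "nat_residue R k ([i] \<cdot> \<one>) = nat_residue R k ([j] \<cdot> \<one>)"
proof -
  obtain l where "i = j + int k * l" using assms by (metis cong_iff_lin cong_sym)
  moreover have "[k] \<cdot> ([l] \<cdot> \<one>) = [int k] \<cdot> ([l] \<cdot> \<one>)"
    by (simp add: add_pow_int_ge)
  ultimately have "[i] \<cdot> \<one> = [j] \<cdot> \<one> \<oplus> [k] \<cdot> ([l] \<cdot> \<one>)"
    by (simp add: add.int_pow_mult add.int_pow_pow mult.commute)
  then show ?thesis by (subst nat_residue_eq_iff) auto
qed

lemma coherent_scalar:
  assumes "coherent \<Z> q t"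
  shows "coherent R q (\<lambda>n. [t n] \<cdot> \<one>)"
  using assms by (auto simp: coherent_def int_ring_residue_eq_iff intro!: nat_residue_scalar_cong)

text \<open>Integers congruent modulo \<open>q ^ n\<close> have the same image modulo
  \<open>q ^ n\<close>, so the union in \<open>padic_scalar\<close> is a union of equal
  cosets.\<close>

lemma padic_scalar_limit:
  assumes "coherent \<Z> q t"
  shows "padic_scalar R q (padic_limit \<Z> q t) = padic_limit R q (\<lambda>n. [t n] \<cdot> \<one>)"
proof
  fix n
  have "[k = t n] (mod int (q ^ n))" if "k \<in> nat_residue \<Z> (q ^ n) (t n)" for k
    using cring.nat_residue_memD(2)[OF int_is_cring that] by (simp add: int_ring_residue_eq_iff)
  then have "nat_residue R (q ^ n) ([k] \<cdot> \<one>) = nat_residue R (q ^ n) ([t n] \<cdot> \<one>)"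
    if "k \<in> nat_residue \<Z> (q ^ n) (t n)" for k
    using that nat_residue_scalar_cong by blast
  moreover have "t n \<in> nat_residue \<Z> (q ^ n) (t n)"
    by (simp add: cring.nat_residue_self[OF int_is_cring])
  ultimately show "padic_scalar R q (padic_limit \<Z> q t) n = padic_limit R q (\<lambda>n. [t n] \<cdot> \<one>) n"
    unfolding padic_scalar_def padic_limit_def nat_residue_def[of R, symmetric] by blast
qed

lemma padic_scalar_mult:
  assumes "coherent \<Z> q t" "coherent R q s"
  shows "padic_scalar R q (padic_limit \<Z> q t) \<otimes>\<^bsub>completion R q\<^esub> padic_limit R q s =
    padic_limit R q (\<lambda>n. [t n] \<cdot> s n)" "coherent R q (\<lambda>n. [t n] \<cdot> s n)"
proof -
  have "[t n] \<cdot> \<one> \<otimes> s n = [t n] \<cdot> s n" for n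
    using assms by (simp add: add_pow_ldistr_int)
  then show "padic_scalar R q (padic_limit \<Z> q t) \<otimes>\<^bsub>completion R q\<^esub> padic_limit R q s =
    padic_limit R q (\<lambda>n. [t n] \<cdot> s n)" "coherent R q (\<lambda>n. [t n] \<cdot> s n)"
    using coherent_mult[OF coherent_scalar[OF assms(1)] assms(2)]
    by (simp_all add: padic_scalar_limit completion_mult coherent_scalar assms)
qed

lemmas padic_int_closed = cring.padic_limit_closed[OF int_is_cring]
lemmas padic_int_mult = cring.completion_mult[OF int_is_cring, simplified]
lemmas padic_int_add = cring.completion_add[OF int_is_cring, simplified]
lemmas padic_intE = cring.completionE[OF int_is_cring]

lemma completed_map_dual:
  assumes f: "additive_mod R 0 f"
  shows "completed_map q f \<in> local_dual R q"
  unfolding local_dual_def Let_def padic_int_def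
proof (intro CollectI conjI ballI)
  show "completed_map q f \<in> carrier (completion R q) \<rightarrow>\<^sub>E carrier (completion \<Z> q)"
  proof (rule PiE_I)
    fix x assume "x \<in> carrier (completion R q)"
    then show "completed_map q f x \<in> carrier (completion \<Z> q)"
      by (elim completionE) (simp add: completed_map_limit f additive_coherent padic_int_closed)
  qed (simp add: completed_map_def)
next
  fix x y assume "x \<in> carrier (completion R q)" "y \<in> carrier (completion R q)"
  then obtain s t where "coherent R q s" "x = padic_limit R q s" "coherent R q t" "y = padic_limit R q t"
    by (elim completionE)
  then show "completed_map q f (x \<oplus>\<^bsub>completion R q\<^esub> y) =
      completed_map q f x \<oplus>\<^bsub>completion \<Z> q\<^esub> completed_map q f y"
    by (simp add: completed_map_limit f additive_coherent completion_add padic_int_add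
        coherent_add additive_simps)
next
  fix z x assume "z \<in> carrier (completion \<Z> q)" "x \<in> carrier (completion R q)"
  then obtain s t where "coherent R q s" "x = padic_limit R q s" "coherent \<Z> q t" "z = padic_limit \<Z> q t"
    by (elim completionE padic_intE)
  then show "completed_map q f (padic_scalar R q z \<otimes>\<^bsub>completion R q\<^esub> x) =
      z \<otimes>\<^bsub>completion \<Z> q\<^esub> completed_map q f x"
    by (simp add: completed_map_limit f additive_coherent padic_scalar_mult padic_int_mult
        additive_simps)
qed

end

text \<open>Freeness of finite rank: \<open>v\<close> is an additive isomorphism onto Z^m, which is
  encoded as the integer sequences vanishing from index \<open>m\<close> on.\<close>

locale cring_coords = cring R for R (structure) +
  fixes v :: "'a \<Rightarrow> nat \<Rightarrow> int" and m :: nat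
  assumes v_bij: "bij_betw v (carrier R) {c. \<forall>i\<ge>m. c i = 0}"
    and v_add: "x \<in> carrier R \<Longrightarrow> y \<in> carrier R \<Longrightarrow> v (x \<oplus> y) i = v x i + v y i"
begin

definition basis :: "nat \<Rightarrow> 'a" where
  "basis j = inv_into (carrier R) v (\<lambda>i. if i = j then 1 else 0)"

lemma v_additive: "additive_mod R 0 (\<lambda>x. v x i)"
  by (simp add: additive_mod_def v_add)

lemmas v_simps = additive_simps[OF v_additive]

lemma v_zero [simp]: "v \<zero> i = 0"
  using additive_mod_zero[OF v_additive, of i] by simp

lemma v_outside: "x \<in> carrier R \<Longrightarrow> i \<ge> m \<Longrightarrow> v x i = 0"
  using v_bij by (auto simp: bij_betw_def)

lemma v_surj:
  assumes "\<And>i. i \<ge> m \<Longrightarrow> c i = 0"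
  obtains x where "x \<in> carrier R" "v x = c"
proof -
  have "c \<in> v ` carrier R" using assms v_bij by (auto simp: bij_betw_def)
  then show ?thesis using that by blast
qed

lemma v_eqI: "x \<in> carrier R \<Longrightarrow> y \<in> carrier R \<Longrightarrow> (\<And>i. v x i = v y i) \<Longrightarrow> x = y"
  using v_bij by (auto simp: bij_betw_def inj_on_def fun_eq_iff)

lemma basis:
  assumes "j < m"
  shows "basis j \<in> carrier R" "v (basis j) i = (if i = j then 1 else 0)"
proof -
  have *: "(\<lambda>i. if i = j then 1 else 0) \<in> v ` carrier R"
    using assms v_bij by (auto simp: bij_betw_def)
  show "basis j \<in> carrier R" unfolding basis_def using * by (rule inv_into_into)
  show "v (basis j) i = (if i = j then 1 else 0)"
    unfolding basis_def by (subst f_inv_into_f[OF *]) simp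
qed

text \<open>For the converse, the quotients of the coordinate differences by \<open>k\<close> are
  themselves the coordinates of some \<open>z\<close>, by surjectivity of \<open>v\<close>, and then
  \<open>x\<close> is \<open>y\<close> plus \<open>k\<close> times \<open>z\<close>.\<close>

lemma residue_iff_coords:
  assumes "x \<in> carrier R" "y \<in> carrier R"
  shows "nat_residue R k x = nat_residue R k y \<longleftrightarrow> (\<forall>i. [v x i = v y i] (mod int k))"
proof
  assume "nat_residue R k x = nat_residue R k y"
  then show "\<forall>i. [v x i = v y i] (mod int k)"
    using additive_residue[OF v_additive assms] by blast
next
  assume "\<forall>i. [v x i = v y i] (mod int k)"
  then have "\<forall>i. \<exists>c. v x i = v y i + int k * c" by (metis cong_iff_lin cong_sym)
  then obtain c where c: "\<And>i. v x i = v y i + int k * c i" by metis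
  obtain z where z: "z \<in> carrier R" "v z = (\<lambda>i. if i < m then c i else 0)"
    by (rule v_surj[of "\<lambda>i. if i < m then c i else 0"]) auto
  have "x = y \<oplus> [k] \<cdot> z"
  proof (rule v_eqI)
    fix i
    have "i \<ge> m \<Longrightarrow> int k * c i = 0" using c[of i] assms v_outside by simp
    then show "v x i = v (y \<oplus> [k] \<cdot> z) i"
      using assms z c[of i] by (cases "i < m") (auto simp: v_simps)
  qed (use assms z in auto)
  then show "nat_residue R k x = nat_residue R k y" using assms z nat_residue_eq_iff by blast
qed

lemma residue_zero_iff_coords:
  "x \<in> carrier R \<Longrightarrow> nat_residue R k x = nat_residue R k \<zero> \<longleftrightarrow> (\<forall>i. int k dvd v x i)"
  by (simp add: residue_iff_coords cong_0_iff)

lemma additive_mod_expand: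
  assumes f: "additive_mod R Q f" and "x \<in> carrier R"
  shows "[f x = (\<Sum>i<m. v x i * f (basis i))] (mod Q)"
proof -
  \<comment> \<open>The induction is on a bound \<open>j\<close> for the nonzero coordinates; each
    step splits off the multiple of \<open>basis j\<close>.\<close>
  have "[f x = (\<Sum>i<j. v x i * f (basis i))] (mod Q)"
    if "j \<le> m" "x \<in> carrier R" "\<And>i. i \<ge> j \<Longrightarrow> v x i = 0" for j x
    using that
  proof (induction j arbitrary: x)
    case 0
    then have "x = \<zero>" by (intro v_eqI) auto
    then show ?case using additive_mod_zero[OF f] by simp
  next
    case (Suc j)
    obtain y where y: "y \<in> carrier R" "v y = (\<lambda>i. if i = j then 0 else v x i)"
      by (rule v_surj[of "\<lambda>i. if i = j then 0 else v x i"]) (use Suc.prems v_outside in auto)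
    have e: "basis j \<in> carrier R" "\<And>i. v (basis j) i = (if i = j then 1 else 0)"
      using basis Suc.prems by auto
    have x: "x = y \<oplus> [v x j] \<cdot> basis j"
      by (rule v_eqI) (use Suc.prems y e in \<open>auto simp: v_simps\<close>)
    have "[f x = f y + f ([v x j] \<cdot> basis j)] (mod Q)"
      using f y e by (subst x) (auto simp: additive_mod_def)
    also have "[f y + f ([v x j] \<cdot> basis j) =
        (\<Sum>i<j. v y i * f (basis i)) + v x j * f (basis j)] (mod Q)"
      by (intro cong_add Suc.IH additive_mod_int_mult[OF f e(1)])
        (use Suc.prems y in \<open>auto simp: Suc_le_eq\<close>)
    also have "(\<Sum>i<j. v y i * f (basis i)) = (\<Sum>i<j. v x i * f (basis i))"
      using y by (intro sum.cong) auto
    finally show ?case by simp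
  qed
  then show ?thesis using assms v_outside by blast
qed

text \<open>Values on a basis can be prescribed at will, so a map that is additive only modulo
  \<open>Q\<close> lifts to an additive one by keeping its values on the basis.\<close>

lemma additive_mod_lift:
  assumes "additive_mod R Q f"
  obtains g where "additive_mod R 0 g" "\<And>x. x \<in> carrier R \<Longrightarrow> [f x = g x] (mod Q)"
proof
  show "additive_mod R 0 (\<lambda>x. \<Sum>i<m. v x i * f (basis i))"
    by (simp add: additive_mod_def v_add distrib_right sum.distrib)
qed (rule additive_mod_expand[OF assms])

text \<open>Continuity of \<open>\<phi>\<close>: an element that vanishes modulo
  \<open>q ^ n\<close> is \<open>q ^ n\<close> times an element of the completion, and linearity
  pulls this factor out of the value of \<open>\<phi>\<close>.\<close>

lemma dual_of_small:
  assumes q: "q > 0" and \<phi>: "\<phi> \<in> local_dual R q" and s: "coherent R q s"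
    and small: "nat_residue R (q ^ n) (s n) = nat_residue R (q ^ n) \<zero>"
  shows "\<phi> (padic_limit R q s) n = nat_residue \<Z> (q ^ n) 0"
proof -
  \<comment> \<open>Division by \<open>q ^ n\<close> loses \<open>n\<close> levels of precision, so
    the quotient at level \<open>k\<close> is read off from \<open>s (k + n)\<close>.\<close>
  have "\<exists>z\<in>carrier R. s (k + n) = [(q ^ n)] \<cdot> z" for k
  proof -
    have "nat_residue R (q ^ n) (s (k + n)) = nat_residue R (q ^ n) \<zero>"
      using coherent_le[OF s, of n "k + n"] small by simp
    then obtain z where "z \<in> carrier R" "s (k + n) = \<zero> \<oplus> [(q ^ n)] \<cdot> z"
      using s nat_residue_eq_iff by fastforce
    then show ?thesis by auto
  qed
  then obtain t where t: "\<And>k. t k \<in> carrier R" "\<And>k. s (k + n) = [(q ^ n)] \<cdot> t k" by metis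
  have ct: "coherent R q t"
    unfolding coherent_def
  proof (intro allI conjI t(1))
    fix k
    have "nat_residue R (q ^ (k + n)) ([(q ^ n)] \<cdot> t (Suc k)) = nat_residue R (q ^ (k + n)) ([(q ^ n)] \<cdot> t k)"
      using coherent_Suc[OF s, of "k + n"] t(2)[of k] t(2)[of "Suc k"] by simp
    then have "[int (q ^ n) * v (t (Suc k)) i = int (q ^ n) * v (t k) i] (mod int (q ^ n) * int (q ^ k))" for i
      using t(1) by (subst (asm) residue_iff_coords) (auto simp: v_simps power_add mult.commute)
    \<comment> \<open>The factor \<open>q ^ n\<close> can be cancelled because coordinates are
      integers: this is where torsion-freeness enters.\<close>
    then have "[v (t (Suc k)) i = v (t k) i] (mod int (q ^ k))" for i
      using q by (simp add: cong_iff_dvd_diff flip: right_diff_distrib)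
    then show "nat_residue R (q ^ k) (t (Suc k)) = nat_residue R (q ^ k) (t k)"
      using t(1) by (simp add: residue_iff_coords)
  qed
  have c: "coherent \<Z> q (\<lambda>_. int (q ^ n))" by (simp add: coherent_def)
  have "nat_residue R (q ^ k) (s k) = nat_residue R (q ^ k) ([int (q ^ n)] \<cdot> t k)" for k
    using coherent_le[OF s, of k "k + n"] t(2)[of k] by (simp add: add_pow_int_ge nat_power_eq)
  then have "padic_limit R q s = padic_limit R q (\<lambda>k. [int (q ^ n)] \<cdot> t k)"
    by (simp add: padic_limit_eq_iff)
  also have "\<dots> = padic_scalar R q (padic_limit \<Z> q (\<lambda>_. int (q ^ n))) \<otimes>\<^bsub>completion R q\<^esub> padic_limit R q t"
    by (rule padic_scalar_mult(1)[OF c ct, symmetric])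
  finally have eq: "\<phi> (padic_limit R q s) =
      padic_limit \<Z> q (\<lambda>_. int (q ^ n)) \<otimes>\<^bsub>completion \<Z> q\<^esub> \<phi> (padic_limit R q t)"
    using \<phi> padic_limit_closed[OF ct] padic_int_closed[OF c]
    by (simp add: local_dual_def Let_def padic_int_def)
  have "\<phi> (padic_limit R q t) \<in> carrier (completion \<Z> q)"
    using \<phi> padic_limit_closed[OF ct] by (auto simp: local_dual_def Let_def padic_int_def)
  then obtain u where u: "coherent \<Z> q u" "\<phi> (padic_limit R q t) = padic_limit \<Z> q u"
    by (rule padic_intE)
  show ?thesis
    unfolding eq u(2) padic_int_mult[OF c u(1)]
    by (simp add: padic_limit_def int_ring_residue_eq_iff cong_0_iff)
qed

text \<open>On constant sequences \<open>\<phi>\<close> is additive modulo \<open>q ^ n\<close> and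
  therefore lifts to an integral functional. A coherent sequence differs from the constant sequence
  \<open>s n\<close> by one that vanishes at level \<open>n\<close>, where
  \<open>dual_of_small\<close> applies. The functional \<open>g\<close> may change with
  \<open>n\<close>.\<close>

lemma dual_level:
  assumes q: "q > 0" and \<phi>: "\<phi> \<in> local_dual R q"
  obtains g where "additive_mod R 0 g"
    "\<And>s. coherent R q s \<Longrightarrow> \<phi> (padic_limit R q s) n = nat_residue \<Z> (q ^ n) (g (s n))"
proof -
  let ?\<iota> = "\<lambda>r. padic_limit R q (\<lambda>_. r)"
  have mem: "\<phi> x \<in> carrier (completion \<Z> q)" if "x \<in> carrier (completion R q)" for x
    using \<phi> that by (auto simp: local_dual_def Let_def padic_int_def)
  have add: "\<phi> (x \<oplus>\<^bsub>completion R q\<^esub> y) = \<phi> x \<oplus>\<^bsub>completion \<Z> q\<^esub> \<phi> y"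
    if "x \<in> carrier (completion R q)" "y \<in> carrier (completion R q)" for x y
    using \<phi> that by (auto simp: local_dual_def Let_def padic_int_def)
  have ex: "\<exists>u. \<phi> x n = nat_residue \<Z> (q ^ n) u" if "x \<in> carrier (completion R q)" for x
    using mem[OF that] by (elim padic_intE) (auto simp: padic_limit_def)
  have add_n: "\<phi> (x \<oplus>\<^bsub>completion R q\<^esub> y) n = nat_residue \<Z> (q ^ n) (i + j)"
    if xy: "x \<in> carrier (completion R q)" "y \<in> carrier (completion R q)"
      and ij: "\<phi> x n = nat_residue \<Z> (q ^ n) i" "\<phi> y n = nat_residue \<Z> (q ^ n) j" for x y i j
  proof -
    obtain s t where "coherent \<Z> q s" "\<phi> x = padic_limit \<Z> q s" "coherent \<Z> q t" "\<phi> y = padic_limit \<Z> q t"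
      using mem[OF xy(1)] mem[OF xy(2)] by (metis padic_intE)
    with ij show ?thesis
      unfolding add[OF xy]
      by (simp add: padic_int_add) (auto simp: padic_limit_def int_ring_residue_eq_iff intro: cong_add)
  qed
  have "\<forall>r. \<exists>u. r \<in> carrier R \<longrightarrow> \<phi> (?\<iota> r) n = nat_residue \<Z> (q ^ n) u"
    using ex by (simp add: padic_limit_closed coherent_const)
  then obtain f where f: "\<And>r. r \<in> carrier R \<Longrightarrow> \<phi> (?\<iota> r) n = nat_residue \<Z> (q ^ n) (f r)"
    by metis
  have "additive_mod R (int (q ^ n)) f"
    unfolding additive_mod_def
  proof (intro ballI)
    fix x y assume xy: "x \<in> carrier R" "y \<in> carrier R"
    have "\<phi> (?\<iota> x \<oplus>\<^bsub>completion R q\<^esub> ?\<iota> y) n = nat_residue \<Z> (q ^ n) (f x + f y)"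
      using xy by (intro add_n f) (simp_all add: padic_limit_closed coherent_const)
    moreover have "?\<iota> x \<oplus>\<^bsub>completion R q\<^esub> ?\<iota> y = ?\<iota> (x \<oplus> y)"
      using xy by (simp add: completion_add coherent_const)
    ultimately show "[f (x \<oplus> y) = f x + f y] (mod int (q ^ n))"
      using f[of "x \<oplus> y"] xy by (simp add: int_ring_residue_eq_iff)
  qed
  then obtain g where g: "additive_mod R 0 g" "\<And>x. x \<in> carrier R \<Longrightarrow> [f x = g x] (mod int (q ^ n))"
    by (rule additive_mod_lift) blast
  show thesis
  proof (rule that[OF g(1)])
    fix s assume s: "coherent R q s"
    have sn: "s n \<in> carrier R" using s by simp
    let ?d = "\<lambda>k. s k \<oplus> \<ominus> s n"
    have d: "coherent R q ?d"
      using coherent_add[OF s coherent_inv[OF coherent_const[OF sn]]] .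
    have "padic_limit R q s = ?\<iota> (s n) \<oplus>\<^bsub>completion R q\<^esub> padic_limit R q ?d"
    proof -
      have "s n \<oplus> (s k \<oplus> \<ominus> s n) = s k" for k
        using s sn by (metis a_inv_closed a_lcomm coherent_closed r_neg r_zero)
      then show ?thesis by (subst completion_add) (simp_all add: d coherent_const sn)
    qed
    moreover have "\<phi> (?\<iota> (s n) \<oplus>\<^bsub>completion R q\<^esub> padic_limit R q ?d) n = nat_residue \<Z> (q ^ n) (g (s n) + 0)"
    proof (intro add_n)
      show "\<phi> (?\<iota> (s n)) n = nat_residue \<Z> (q ^ n) (g (s n))"
        using f[OF sn] g(2)[OF sn] by (simp add: int_ring_residue_eq_iff)
      show "\<phi> (padic_limit R q ?d) n = nat_residue \<Z> (q ^ n) 0"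
        using sn by (intro dual_of_small q \<phi> d) (simp add: r_neg)
    qed (simp_all add: sn d padic_limit_closed coherent_const)
    ultimately show "\<phi> (padic_limit R q s) n = nat_residue \<Z> (q ^ n) (g (s n))" by simp
  qed
qed

end

section \<open>A criterion for the Gorenstein property modulo a prime\<close>

text \<open>For \<open>R\<close> free of finite rank and \<open>q > 0\<close> the quotient R/qR is
  finite, and this says that \<open>f\<close> generates its dual as a module. The functional is
  integral, so that it extends to the completion.\<close>

definition nondegenerate_mod :: "('a, 'm) ring_scheme \<Rightarrow> nat \<Rightarrow> ('a \<Rightarrow> int) \<Rightarrow> bool" where
  "nondegenerate_mod R q f \<longleftrightarrow> additive_mod R 0 f \<and>
     (\<forall>x\<in>carrier R. (\<forall>y\<in>carrier R. int q dvd f (x \<otimes>\<^bsub>R\<^esub> y)) \<longrightarrow> x \<in> nat_ideal R q)"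

context cring_coords begin

lemma nat_ideal_iff_coords: "x \<in> nat_ideal R k \<longleftrightarrow> x \<in> carrier R \<and> (\<forall>i. int k dvd v x i)"
proof -
  have "x \<in> nat_ideal R k \<longleftrightarrow> x \<in> carrier R \<and> nat_residue R k x = nat_residue R k \<zero>"
    using nat_residue_mem_iff[of \<zero> x k] nat_residue_zero by simp
  then show ?thesis using residue_zero_iff_coords by blast
qed

lemma additive_mult:
  "additive_mod R 0 f \<Longrightarrow> x \<in> carrier R \<Longrightarrow> additive_mod R 0 (\<lambda>y. f (x \<otimes> y))"
  by (simp add: additive_mod_def r_distr)

text \<open>Nondegeneracy modulo \<open>q\<close> shows that \<open>x\<close> is \<open>q\<close>
  times some \<open>z\<close>; dividing the hypothesis by \<open>q\<close> gives the same situation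
  for \<open>z\<close> with one power less.\<close>

lemma nondegenerate_mod_power:
  assumes q: "q > 0" and f: "nondegenerate_mod R q f"
    and "x \<in> carrier R" "\<And>y. y \<in> carrier R \<Longrightarrow> int (q ^ n) dvd f (x \<otimes> y)"
  shows "int (q ^ n) dvd v x i"
  using assms(3,4)
proof (induction n arbitrary: x i)
  case (Suc n)
  have add: "additive_mod R 0 f" using f by (simp add: nondegenerate_mod_def)
  have "int q dvd f (x \<otimes> y)" if "y \<in> carrier R" for y
    using Suc.prems(2)[OF that] by (simp add: dvd_mult_left)
  then have "x \<in> nat_ideal R q"
    using f Suc.prems(1) by (simp add: nondegenerate_mod_def)
  then obtain z where z: "z \<in> carrier R" "x = [q] \<cdot> z" by (auto simp: nat_ideal_eq)
  have "int (q ^ n) dvd f (z \<otimes> y)" if "y \<in> carrier R" for y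
  proof -
    have "f (x \<otimes> y) = int q * f (z \<otimes> y)"
      using z that by (simp add: add_pow_ldistr additive_simps[OF add])
    then show ?thesis using Suc.prems(2)[OF that] q by simp
  qed
  then have "int (q ^ n) dvd v z i" using Suc.IH z by blast
  then show ?case using z by (simp add: v_simps)
qed simp

text \<open>Coordinate vectors with entries in \<open>{0..<Q}\<close> form a finite set
  \<open>T\<close>. Sending the vector of \<open>x\<close> to the values of \<open>f\<close> at the
  products of \<open>x\<close> with the basis, reduced modulo \<open>Q\<close>, maps
  \<open>T\<close> to itself. This is injective by \<open>nondegenerate_mod_power\<close>, hence
  surjective, and the values of \<open>g\<close> on the basis are attained.\<close>

lemma nondegenerate_mod_represents:
  assumes q: "q > 0" and f: "nondegenerate_mod R q f" and g: "additive_mod R 0 g"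
  obtains x where "x \<in> carrier R"
    "\<And>y. y \<in> carrier R \<Longrightarrow> [g y = f (x \<otimes> y)] (mod int (q ^ n))"
proof -
  define Q where "Q = int (q ^ n)"
  have Q: "Q > 0" using q by (simp add: Q_def)
  have add: "additive_mod R 0 f" using f by (simp add: nondegenerate_mod_def)
  define T where "T = ({..<m} \<rightarrow>\<^sub>E {0..<Q})"
  define enc where "enc c = inv_into (carrier R) v (\<lambda>i. if i < m then c i else 0)" for c :: "nat \<Rightarrow> int"
  have enc: "enc c \<in> carrier R" "v (enc c) = (\<lambda>i. if i < m then c i else 0)" for c
  proof -
    have *: "(\<lambda>i. if i < m then c i else 0) \<in> v ` carrier R"
      using v_bij by (auto simp: bij_betw_def)
    show "enc c \<in> carrier R" "v (enc c) = (\<lambda>i. if i < m then c i else 0)"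
      unfolding enc_def using inv_into_into[OF *] f_inv_into_f[OF *] by auto
  qed
  define F where "F c = (\<lambda>i\<in>{..<m}. f (enc c \<otimes> basis i) mod Q)" for c
  have "inj_on F T"
  proof (rule inj_onI)
    fix c c' assume T: "c \<in> T" "c' \<in> T" and eq: "F c = F c'"
    let ?d = "enc c \<oplus> \<ominus> enc c'"
    have d: "?d \<in> carrier R" using enc by simp
    have "Q dvd f (?d \<otimes> y)" if y: "y \<in> carrier R" for y
    proof -
      have "Q dvd f (?d \<otimes> basis i)" if "i < m" for i
      proof -
        have "f (?d \<otimes> basis i) = f (enc c \<otimes> basis i) - f (enc c' \<otimes> basis i)"
          using enc basis[OF that] by (simp add: l_distr l_minus additive_simps[OF add])
        moreover have "f (enc c \<otimes> basis i) mod Q = f (enc c' \<otimes> basis i) mod Q"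
          using fun_cong[OF eq, of i] that by (simp add: F_def)
        ultimately show ?thesis by (simp add: mod_eq_dvd_iff)
      qed
      then have "Q dvd (\<Sum>i<m. v y i * f (?d \<otimes> basis i))"
        by (intro dvd_sum) auto
      moreover have "f (?d \<otimes> y) = (\<Sum>i<m. v y i * f (?d \<otimes> basis i))"
        using additive_mod_expand[OF additive_mult[OF add d] y] by simp
      ultimately show ?thesis by simp
    qed
    then have "Q dvd v ?d i" for i
      unfolding Q_def by (intro nondegenerate_mod_power[OF q f d]) (simp add: Q_def)
    then have "[c i = c' i] (mod Q)" if "i < m" for i
      using enc that v_simps(1)[of "enc c" "\<ominus> enc c'" i] v_simps(2)[of "enc c'" i]
      by (metis a_inv_closed add_uminus_conv_diff cong_iff_dvd_diff)
    then have "c i = c' i" if "i < m" for i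
      using T that unfolding T_def by (intro cong_less_imp_eq_int) (auto simp: PiE_def Pi_def)
    then show "c = c'" using T unfolding T_def by (intro PiE_ext) auto
  qed
  moreover have reduce: "(\<lambda>i\<in>{..<m}. h i mod Q) \<in> T" for h
    using Q unfolding T_def by (intro restrict_PiE_iff[THEN iffD2]) simp
  then have "F ` T \<subseteq> T" unfolding F_def by (intro image_subsetI)
  moreover have "finite T" by (simp add: T_def finite_PiE)
  ultimately have "F ` T = T" by (metis endo_inj_surj)
  then have "(\<lambda>i\<in>{..<m}. g (basis i) mod Q) \<in> F ` T" using reduce by simp
  then obtain c where c: "F c = (\<lambda>i\<in>{..<m}. g (basis i) mod Q)"
    by (metis imageE)
  have "[g y = f (enc c \<otimes> y)] (mod Q)" if y: "y \<in> carrier R" for y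
  proof -
    have "[g (basis i) = f (enc c \<otimes> basis i)] (mod Q)" if "i < m" for i
      using fun_cong[OF c, of i] that by (simp add: F_def cong_def)
    then have "[(\<Sum>i<m. v y i * g (basis i)) = (\<Sum>i<m. v y i * f (enc c \<otimes> basis i))] (mod Q)"
      by (intro cong_sum cong_mult) auto
    moreover have "g y = (\<Sum>i<m. v y i * g (basis i))"
      using additive_mod_expand[OF g y] by simp
    moreover have "f (enc c \<otimes> y) = (\<Sum>i<m. v y i * f (enc c \<otimes> basis i))"
      using additive_mod_expand[OF additive_mult[OF add enc(1)] y] by simp
    ultimately show ?thesis by simp
  qed
  then show thesis using that enc(1) unfolding Q_def by blast
qed

text \<open>The isomorphism sends \<open>x\<close> to the functional \<open>z\<close> ->
  \<open>f\<close> of \<open>x\<close> times \<open>z\<close>, extended to the completion.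
  Nondegeneracy modulo every \<open>q ^ n\<close> gives injectivity. For surjectivity,
  \<open>\<phi>\<close> is represented at each level by an element of \<open>R\<close>, and these
  representatives fit together.\<close>

lemma nondegenerate_imp_gorenstein:
  assumes q: "q > 0" and f: "nondegenerate_mod R q f"
  shows "gorenstein_at R q"
proof -
  have add: "additive_mod R 0 f" using f by (simp add: nondegenerate_mod_def)
  interpret C: cring "completion R q" by (rule completion_cring)
  define \<Phi> where "\<Phi> x = (\<lambda>z\<in>carrier (completion R q). completed_map q f (x \<otimes>\<^bsub>completion R q\<^esub> z))" for x
  have \<Phi>: "\<Phi> (padic_limit R q s) (padic_limit R q t) = padic_limit \<Z> q (\<lambda>n. f (s n \<otimes> t n))"
    if "coherent R q s" "coherent R q t" for s t
    using that by (simp add: \<Phi>_def padic_limit_closed completion_mult coherent_mult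
        completed_map_limit add)
  have \<Phi>_dual: "\<Phi> x \<in> local_dual R q" if x: "x \<in> carrier (completion R q)" for x
  proof -
    have L: "completed_map q f \<in> local_dual R q" using add by (rule completed_map_dual)
    have scal: "padic_scalar R q z \<in> carrier (completion R q)" if "z \<in> carrier (completion \<Z> q)" for z
      using that by (elim padic_intE) (simp add: padic_scalar_limit coherent_scalar padic_limit_closed)
    have "x \<otimes>\<^bsub>completion R q\<^esub> (padic_scalar R q z \<otimes>\<^bsub>completion R q\<^esub> y) =
        padic_scalar R q z \<otimes>\<^bsub>completion R q\<^esub> (x \<otimes>\<^bsub>completion R q\<^esub> y)"
      if "z \<in> carrier (completion \<Z> q)" "y \<in> carrier (completion R q)" for y z
      using that x scal by (intro C.m_lcomm) auto
    then show ?thesis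
      using L x scal
      by (auto simp: \<Phi>_def local_dual_def Let_def padic_int_def C.r_distr PiE_def Pi_def)
  qed
  have inj: "inj_on \<Phi> (carrier (completion R q))"
  proof (rule inj_onI)
    fix x y assume xy: "x \<in> carrier (completion R q)" "y \<in> carrier (completion R q)" "\<Phi> x = \<Phi> y"
    from xy(1,2) obtain s t where st: "coherent R q s" "x = padic_limit R q s"
      "coherent R q t" "y = padic_limit R q t"
      by (elim completionE)
    have "nat_residue R (q ^ n) (s n) = nat_residue R (q ^ n) (t n)" for n
    proof -
      let ?d = "s n \<oplus> \<ominus> t n"
      have d: "?d \<in> carrier R" using st by simp
      have "int (q ^ n) dvd f (?d \<otimes> r)" if r: "r \<in> carrier R" for r
      proof -
        have "padic_limit \<Z> q (\<lambda>n. f (s n \<otimes> r)) = padic_limit \<Z> q (\<lambda>n. f (t n \<otimes> r))"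
          using \<Phi>[OF st(1) coherent_const[OF r]] \<Phi>[OF st(3) coherent_const[OF r]] xy(3) st by simp
        then have "[f (s n \<otimes> r) = f (t n \<otimes> r)] (mod int (q ^ n))"
          by (simp add: padic_limit_def fun_eq_iff int_ring_residue_eq_iff)
        moreover have "f (?d \<otimes> r) = f (s n \<otimes> r) - f (t n \<otimes> r)"
          using st r by (simp add: l_distr l_minus additive_simps[OF add])
        ultimately show ?thesis by (simp add: cong_iff_dvd_diff)
      qed
      then have "int (q ^ n) dvd v ?d i" for i
        by (intro nondegenerate_mod_power[OF q f d])
      then show ?thesis
        using st by (simp add: residue_iff_coords v_simps cong_iff_dvd_diff)
    qed
    then show "x = y" using st by (simp add: padic_limit_eq_iff)
  qed
  have surj: "\<exists>x\<in>carrier (completion R q). \<phi> = \<Phi> x" if \<phi>: "\<phi> \<in> local_dual R q" for \<phi>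
  proof -
    have "\<exists>g. additive_mod R 0 g \<and> (\<forall>s. coherent R q s \<longrightarrow>
        \<phi> (padic_limit R q s) n = nat_residue \<Z> (q ^ n) (g (s n)))" for n
      using dual_level[OF q \<phi>] by metis
    then obtain g where g: "\<And>n. additive_mod R 0 (g n)"
      "\<And>n s. coherent R q s \<Longrightarrow> \<phi> (padic_limit R q s) n = nat_residue \<Z> (q ^ n) (g n (s n))"
      by metis
    have "\<exists>x. x \<in> carrier R \<and> (\<forall>y\<in>carrier R. [g n y = f (x \<otimes> y)] (mod int (q ^ n)))" for n
      using nondegenerate_mod_represents[OF q f g(1)] by metis
    then obtain s where s: "\<And>n. s n \<in> carrier R"
      "\<And>n y. y \<in> carrier R \<Longrightarrow> [g n y = f (s n \<otimes> y)] (mod int (q ^ n))"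
      by metis
    \<comment> \<open>Representatives are unique modulo \<open>q ^ n\<close>. The value
      \<open>u\<close> of \<open>\<phi>\<close> at a constant sequence links levels \<open>n\<close>
      and \<open>Suc n\<close>, so the difference \<open>s (Suc n)\<close> minus \<open>s n\<close>
      pairs to zero modulo \<open>q ^ n\<close> with every \<open>r\<close>.\<close>
    have "coherent R q s"
      unfolding coherent_def
    proof (intro allI conjI s(1))
      fix n
      let ?d = "s (Suc n) \<oplus> \<ominus> s n"
      have d: "?d \<in> carrier R" using s by simp
      have "int (q ^ n) dvd f (?d \<otimes> r)" if r: "r \<in> carrier R" for r
      proof -
        let ?x = "padic_limit R q (\<lambda>_. r)"
        have c: "coherent R q (\<lambda>_. r)" using r by (rule coherent_const)
        have "\<phi> ?x \<in> carrier (completion \<Z> q)"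
          using \<phi> padic_limit_closed[OF c] by (auto simp: local_dual_def Let_def padic_int_def)
        then obtain u where u: "coherent \<Z> q u" "\<phi> ?x = padic_limit \<Z> q u" by (rule padic_intE)
        have "[u k = g k r] (mod int (q ^ k))" for k
          using g(2)[OF c, of k] u(2) by (simp add: padic_limit_def int_ring_residue_eq_iff)
        then have uk: "[u k = f (s k \<otimes> r)] (mod int (q ^ k))" for k
          using s(2)[OF r, of k] cong_trans by blast
        have "[u (Suc n) = u n] (mod int (q ^ n))"
          using cring.coherent_Suc[OF int_is_cring u(1)] by (simp add: int_ring_residue_eq_iff)
        moreover have "[u (Suc n) = f (s (Suc n) \<otimes> r)] (mod int (q ^ n))"
          using uk[of "Suc n"] by (rule cong_dvd_modulus) simp
        ultimately have "[f (s (Suc n) \<otimes> r) = f (s n \<otimes> r)] (mod int (q ^ n))"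
          using uk[of n] by (metis cong_sym cong_trans)
        moreover have "f (?d \<otimes> r) = f (s (Suc n) \<otimes> r) - f (s n \<otimes> r)"
          using s r by (simp add: l_distr l_minus additive_simps[OF add])
        ultimately show ?thesis by (simp add: cong_iff_dvd_diff)
      qed
      then have "int (q ^ n) dvd v ?d i" for i
        by (intro nondegenerate_mod_power[OF q f d])
      then show "nat_residue R (q ^ n) (s (Suc n)) = nat_residue R (q ^ n) (s n)"
        using s by (simp add: residue_iff_coords v_simps cong_iff_dvd_diff)
    qed
    note cs = this
    have "\<phi> z = \<Phi> (padic_limit R q s) z" for z
    proof (cases "z \<in> carrier (completion R q)")
      case True
      then obtain t where t: "coherent R q t" "z = padic_limit R q t" by (rule completionE)
      have "\<phi> z n = \<Phi> (padic_limit R q s) z n" for n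
        using g(2)[OF t(1)] s(2)[of "t n" n] t cs
        by (simp add: \<Phi>) (simp add: padic_limit_def int_ring_residue_eq_iff)
      then show ?thesis by blast
    next
      case False
      then show ?thesis
        using \<phi> by (auto simp: \<Phi>_def local_dual_def Let_def PiE_def extensional_def)
    qed
    then show ?thesis using padic_limit_closed[OF cs] by blast
  qed
  have "bij_betw \<Phi> (carrier (completion R q)) (local_dual R q)"
    unfolding bij_betw_def using inj \<Phi>_dual surj by blast
  moreover have "\<Phi> (x \<oplus>\<^bsub>completion R q\<^esub> y) z = \<Phi> x z \<oplus>\<^bsub>padic_int q\<^esub> \<Phi> y z \<and>
      \<Phi> (x \<otimes>\<^bsub>completion R q\<^esub> y) z = \<Phi> y (x \<otimes>\<^bsub>completion R q\<^esub> z)"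
    if "x \<in> carrier (completion R q)" "y \<in> carrier (completion R q)" "z \<in> carrier (completion R q)"
    for x y z
  proof -
    have "completed_map q f \<in> local_dual R q" using add by (rule completed_map_dual)
    moreover have "x \<otimes>\<^bsub>completion R q\<^esub> y \<otimes>\<^bsub>completion R q\<^esub> z =
        y \<otimes>\<^bsub>completion R q\<^esub> (x \<otimes>\<^bsub>completion R q\<^esub> z)"
      using that C.m_assoc C.m_comm by metis
    ultimately show ?thesis
      using that by (simp add: \<Phi>_def local_dual_def Let_def C.l_distr)
  qed
  ultimately show ?thesis
    unfolding gorenstein_at_def Let_def by blast
qed

text \<open>Surjectivity of the isomorphism already forces nondegeneracy: if \<open>\<lambda>(x y)\<close> vanishes
  modulo \<open>q\<close> for all \<open>y\<close>, then so does every functional at \<open>x\<close>, being of the form \<open>\<lambda>(r \<cdot>)\<close>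
  modulo \<open>q\<close>, in particular the coordinates of \<open>x\<close>.\<close>

lemma gorenstein_imp_nondegenerate:
  assumes q: "q > 0" and "gorenstein_at R q"
  shows "\<exists>f. nondegenerate_mod R q f"
proof -
  interpret C: cring "completion R q" by (rule completion_cring)
  obtain \<Phi> where bij: "bij_betw \<Phi> (carrier (completion R q)) (local_dual R q)"
    and \<Phi>: "\<And>x y z. x \<in> carrier (completion R q) \<Longrightarrow> y \<in> carrier (completion R q) \<Longrightarrow>
      z \<in> carrier (completion R q) \<Longrightarrow>
      \<Phi> (x \<otimes>\<^bsub>completion R q\<^esub> y) z = \<Phi> y (x \<otimes>\<^bsub>completion R q\<^esub> z)"
    using assms(2) unfolding gorenstein_at_def Let_def by blast
  have one: "\<Phi> \<one>\<^bsub>completion R q\<^esub> \<in> local_dual R q"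
    using bij C.one_closed by (auto simp: bij_betw_def)
  \<comment> \<open>Level 1 suffices, since nondegeneracy is tested modulo
    \<open>q ^ 1\<close>.\<close>
  obtain f where f: "additive_mod R 0 f"
    "\<And>s. coherent R q s \<Longrightarrow> \<Phi> \<one>\<^bsub>completion R q\<^esub> (padic_limit R q s) 1 = nat_residue \<Z> (q ^ 1) (f (s 1))"
    using dual_level[OF q one] by metis
  have "x \<in> nat_ideal R q"
    if x: "x \<in> carrier R" and dvd: "\<And>y. y \<in> carrier R \<Longrightarrow> int q dvd f (x \<otimes> y)" for x
  proof -
    have "int q dvd v x i" for i
    proof -
      have cx: "coherent R q (\<lambda>_. x)" using x by (rule coherent_const)
      have "completed_map q (\<lambda>x. v x i) \<in> \<Phi> ` carrier (completion R q)"
        using completed_map_dual[OF v_additive] bij by (auto simp: bij_betw_def)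
      then obtain t where t: "coherent R q t" "completed_map q (\<lambda>x. v x i) = \<Phi> (padic_limit R q t)"
        by (auto simp: completion_carrier)
      let ?w = "padic_limit R q t" and ?x = "padic_limit R q (\<lambda>_. x)"
      have "\<Phi> ?w ?x = \<Phi> \<one>\<^bsub>completion R q\<^esub> (?w \<otimes>\<^bsub>completion R q\<^esub> ?x)"
        using \<Phi>[of ?w "\<one>\<^bsub>completion R q\<^esub>" ?x] padic_limit_closed[OF t(1)] padic_limit_closed[OF cx]
        by simp
      also have "\<dots> = \<Phi> \<one>\<^bsub>completion R q\<^esub> (padic_limit R q (\<lambda>n. t n \<otimes> x))"
        using t(1) cx by (simp add: completion_mult)
      finally have "\<Phi> ?w ?x 1 = nat_residue \<Z> q (f (t 1 \<otimes> x))"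
        using f(2)[OF coherent_mult[OF t(1) cx]] by simp
      moreover have "\<Phi> ?w ?x 1 = nat_residue \<Z> q (v x i)"
        using completed_map_limit[OF v_additive cx, of i] t(2) by (simp add: padic_limit_def)
      ultimately have "[v x i = f (t 1 \<otimes> x)] (mod int q)"
        by (metis int_ring_residue_eq_iff)
      then show ?thesis
        using dvd[of "t 1"] t(1) x by (simp add: m_comm cong_dvd_iff)
    qed
    then show ?thesis using x nat_ideal_iff_coords by blast
  qed
  then show ?thesis using f(1) unfolding nondegenerate_mod_def by blast
qed

theorem gorenstein_at_iff:
  "q > 0 \<Longrightarrow> gorenstein_at R q \<longleftrightarrow> (\<exists>f. nondegenerate_mod R q f)"
  using gorenstein_imp_nondegenerate nondegenerate_imp_gorenstein by blast

end

section \<open>Maximal ideals of the completion\<close>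

text \<open>Meant for counting cosets: \<open>F\<close> and \<open>G\<close> are the coset maps of
  two quotients, and \<open>h\<close> only has to induce a bijection between the cosets.\<close>

lemma card_image_eq_card_image:
  assumes "\<And>x. x \<in> X \<Longrightarrow> h x \<in> Y" "\<And>y. y \<in> Y \<Longrightarrow> \<exists>x\<in>X. G y = G (h x)"
    and "\<And>x x'. x \<in> X \<Longrightarrow> x' \<in> X \<Longrightarrow> F x = F x' \<longleftrightarrow> G (h x) = G (h x')"
  shows "card (F ` X) = card (G ` Y)"
proof -
  define k where "k u = G (h (inv_into X F u))" for u
  have k: "k (F x) = G (h x)" if "x \<in> X" for x
    unfolding k_def using assms(3)[of "inv_into X F (F x)" x] that
    by (simp add: inv_into_into f_inv_into_f)
  have "bij_betw k (F ` X) (G ` Y)"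
    unfolding bij_betw_def inj_on_def
  proof (intro conjI ballI impI)
    show "k ` F ` X = G ` Y" using k assms(1,2) by (force simp: image_image)
  qed (use k assms(3) in auto)
  then show ?thesis by (rule bij_betw_same_card)
qed

lemma quotient_carrier: "carrier (R Quot I) = (+>\<^bsub>R\<^esub>) I ` carrier R"
  by (auto simp: FactRing_def A_RCOSETS_def')

lemma dirichlet_prod_reindex:
  assumes h: "bij_betw h I J" and F: "\<And>i. i \<in> I \<Longrightarrow> F i = G (h i)"
  shows "dirichlet_prod I F n = dirichlet_prod J G n"
proof -
  let ?k = "inv_into I h"
  have hk: "\<And>j. j \<in> J \<Longrightarrow> h (?k j) = j" "\<And>j. j \<in> J \<Longrightarrow> ?k j \<in> I"
    and kh: "\<And>i. i \<in> I \<Longrightarrow> ?k (h i) = i" "\<And>i. i \<in> I \<Longrightarrow> h i \<in> J"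
    using h by (auto simp: bij_betw_def f_inv_into_f inv_into_into)
  have prod: "(\<Prod>j\<in>J. u j) = (\<Prod>i\<in>I. u (h i))" for u :: "_ \<Rightarrow> 'x::comm_monoid_mult"
    by (rule prod.reindex_bij_betw[OF h, symmetric])
  show ?thesis
    unfolding dirichlet_prod_def
  proof (rule sum.reindex_bij_witness[where i = "\<lambda>g. \<lambda>i\<in>I. g (h i)" and j = "\<lambda>g. \<lambda>j\<in>J. g (?k j)"])
    fix g assume g: "g \<in> {g \<in> I \<rightarrow>\<^sub>E {m. m dvd n}. prod g I = n}"
    show "(\<lambda>i\<in>I. (\<lambda>j\<in>J. g (?k j)) (h i)) = g"
      using g by (auto simp: fun_eq_iff kh PiE_def extensional_def)
    show "(\<lambda>j\<in>J. g (?k j)) \<in> {g \<in> J \<rightarrow>\<^sub>E {m. m dvd n}. prod g J = n}"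
      using g hk by (auto simp: prod kh)
    show "(\<Prod>j\<in>J. G j ((\<lambda>j\<in>J. g (?k j)) j)) = (\<Prod>i\<in>I. F i (g i))"
      by (simp add: prod kh F)
  next
    fix g assume g: "g \<in> {g \<in> J \<rightarrow>\<^sub>E {m. m dvd n}. prod g J = n}"
    show "(\<lambda>j\<in>J. (\<lambda>i\<in>I. g (h i)) (?k j)) = g"
      using g by (auto simp: fun_eq_iff hk PiE_def extensional_def)
    show "(\<lambda>i\<in>I. g (h i)) \<in> {g \<in> I \<rightarrow>\<^sub>E {m. m dvd n}. prod g I = n}"
      using g kh by (auto simp: prod)
  qed
qed

text \<open>An order isomorphism between the ideals of \<open>B\<close> above \<open>K\<close> and
  those of \<open>A\<close> above \<open>L\<close>. It is abstracted because it occurs twice: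
  between a ring and its completion, and between two rings congruent modulo \<open>N\<close>. Being
  maximal is a property of the order alone, so it transfers.\<close>

locale ideal_correspondence =
  fixes A :: "('a, 'm) ring_scheme" and B :: "('b, 'n) ring_scheme" and L K f g
  assumes rings: "ring A" "ring B"
    and f: "ideal J B \<Longrightarrow> K \<subseteq> J \<Longrightarrow> ideal (f J) A \<and> L \<subseteq> f J \<and> g (f J) = J"
    and g: "ideal H A \<Longrightarrow> L \<subseteq> H \<Longrightarrow> ideal (g H) B \<and> K \<subseteq> g H \<and> f (g H) = H"
    and f_mono: "J \<subseteq> J' \<Longrightarrow> f J \<subseteq> f J'"
    and g_mono: "H \<subseteq> H' \<Longrightarrow> g H \<subseteq> g H'"
    and kernels: "K \<subseteq> carrier B" "L \<subseteq> carrier A"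
begin

lemma sym: "ideal_correspondence B A K L g f"
  using rings f g f_mono g_mono kernels by (intro ideal_correspondence.intro) auto

lemma carriers: "f (carrier B) = carrier A"
proof -
  have "ideal (f (carrier B)) A"
    using f[OF ring.oneideal[OF rings(2)] kernels(1)] by simp
  moreover have "ideal (g (carrier A)) B" "f (g (carrier A)) = carrier A"
    using g[OF ring.oneideal[OF rings(1)] kernels(2)] by simp_all
  ultimately have "f (carrier B) \<subseteq> carrier A" "carrier A \<subseteq> f (carrier B)"
    using f_mono[of "g (carrier A)" "carrier B"]
    by (auto dest: additive_subgroup.a_subset[OF ideal.axioms(1)])
  then show ?thesis by blast
qed

lemma maximal:
  assumes "maximalideal M B" "K \<subseteq> M"
  shows "maximalideal (f M) A"
proof -
  have M: "ideal M B" using assms(1) by (simp add: maximalideal_def)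
  show ?thesis
  proof (rule maximalidealI)
    show "ideal (f M) A" using f M assms(2) by blast
    show "carrier A \<noteq> f M"
    proof
      assume "carrier A = f M"
      then have "f M = f (carrier B)" using carriers by simp
      then have "M = carrier B"
        using f[OF M assms(2)] f[OF ring.oneideal[OF rings(2)] kernels(1)] by metis
      then show False using maximalideal.I_notcarr[OF assms(1)] by simp
    qed
    fix J assume J: "ideal J A" "f M \<subseteq> J" "J \<subseteq> carrier A"
    then have LJ: "L \<subseteq> J" using f[OF M assms(2)] by blast
    have "M \<subseteq> g J" using g_mono[OF J(2)] f[OF M assms(2)] by simp
    moreover have "ideal (g J) B" using g[OF J(1) LJ] by blast
    ultimately have "g J = M \<or> g J = carrier B"
      using maximalideal.I_maximal[OF assms(1)] additive_subgroup.a_subset[OF ideal.axioms(1)] by blast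
    then show "J = f M \<or> J = carrier A" using g[OF J(1) LJ] carriers by metis
  qed
qed

lemma bij_maximal:
  "bij_betw f {M. maximalideal M B \<and> K \<subseteq> M} {P. maximalideal P A \<and> L \<subseteq> P}"
proof (rule bij_betw_byWitness[where f' = g])
  have id: "maximalideal M X \<Longrightarrow> ideal M X" for M and X :: "('x, 'y) ring_scheme"
    by (simp add: maximalideal_def)
  show "\<forall>M\<in>{M. maximalideal M B \<and> K \<subseteq> M}. g (f M) = M" using f id by blast
  show "\<forall>P\<in>{P. maximalideal P A \<and> L \<subseteq> P}. f (g P) = P" using g id by blast
  show "f ` {M. maximalideal M B \<and> K \<subseteq> M} \<subseteq> {P. maximalideal P A \<and> L \<subseteq> P}"
    using maximal f id by blast
  show "g ` {P. maximalideal P A \<and> L \<subseteq> P} \<subseteq> {M. maximalideal M B \<and> K \<subseteq> M}"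
    using ideal_correspondence.maximal[OF sym] g id by blast
qed

end

section \<open>Units and maximal ideals of the completion\<close>

context cring begin

text \<open>Successive approximation of the inverse: if u = 1 + q w and u t = 1 + q^n z, then u (t -
  q^n z) = 1 - q^(n+1) w z.\<close>

lemma nat_residue_unit_mod_power:
  assumes u: "u \<in> carrier R" "nat_residue R q u = nat_residue R q \<one>"
  shows "\<exists>t\<in>carrier R. nat_residue R (q ^ n) (u \<otimes> t) = nat_residue R (q ^ n) \<one>"
proof (induction n)
  case 0
  have "nat_residue R 1 u = nat_residue R 1 \<one>"
    using nat_residue_dvd[of 1 q u \<one>] u by simp
  then show ?case using u by (intro bexI[of _ \<one>]) simp_all
next
  case (Suc n)
  then obtain t where t: "t \<in> carrier R" "nat_residue R (q ^ n) (u \<otimes> t) = nat_residue R (q ^ n) \<one>"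
    by blast
  then obtain z where z: "z \<in> carrier R" "u \<otimes> t = \<one> \<oplus> [(q ^ n)] \<cdot> z"
    using nat_residue_eq_iff u by (metis m_closed one_closed)
  obtain w where w: "w \<in> carrier R" "u = \<one> \<oplus> [q] \<cdot> w"
    using nat_residue_eq_iff u by blast
  let ?z = "[(q ^ n)] \<cdot> z" and ?w = "[q] \<cdot> w"
  have zw: "?z \<in> carrier R" "?w \<in> carrier R" using z w by simp_all
  have "u \<otimes> (t \<oplus> \<ominus> ?z) = u \<otimes> t \<oplus> \<ominus> (u \<otimes> ?z)"
    using u t zw by algebra
  also have "\<dots> = \<one> \<oplus> ?z \<oplus> \<ominus> ((\<one> \<oplus> ?w) \<otimes> ?z)"
    by (simp only: z(2) w(2)[symmetric])
  also have "\<dots> = \<one> \<oplus> ?w \<otimes> (\<ominus> ?z)" using zw by algebra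
  also have "?w \<otimes> (\<ominus> ?z) = [(q ^ Suc n)] \<cdot> (w \<otimes> \<ominus> z)"
  proof -
    have "\<ominus> ?z = [(q ^ n)] \<cdot> (\<ominus> z)" using z by (simp add: add.nat_pow_inv)
    then show ?thesis
      using z w by (simp add: add_pow_ldistr add_pow_rdistr add.nat_pow_pow)
  qed
  finally have "nat_residue R (q ^ Suc n) (u \<otimes> (t \<oplus> \<ominus> ?z)) = nat_residue R (q ^ Suc n) \<one>"
    using u t zw z w by (subst nat_residue_eq_iff) auto
  then show ?case using t zw by blast
qed

text \<open>Inverses exist at every level, and they form a coherent sequence because an inverse
  modulo \<open>q ^ n\<close> is unique modulo \<open>q ^ n\<close>.\<close>

lemma completion_unit:
  assumes s: "coherent R q s" and one: "nat_residue R q (s 1) = nat_residue R q \<one>"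
  shows "padic_limit R q s \<in> Units (completion R q)"
proof -
  have "\<exists>t\<in>carrier R. nat_residue R (q ^ n) (s n \<otimes> t) = nat_residue R (q ^ n) \<one>" for n
  proof (cases n)
    \<comment> \<open>Modulo \<open>q ^ 0 = 1\<close> all elements agree. From level 1 on,
      \<open>s n\<close> is congruent to \<open>s 1\<close> modulo \<open>q\<close>, so the
      hypothesis on \<open>s 1\<close> is available.\<close>
    case 0
    have "nat_residue R 1 x = nat_residue R 1 \<one>" if "x \<in> carrier R" for x
    proof (subst nat_residue_eq_iff)
      have "x = \<one> \<oplus> [(1::nat)] \<cdot> (x \<ominus> \<one>)"
        using that by (simp add: a_minus_def a_lcomm r_neg)
      then show "\<exists>z\<in>carrier R. x = \<one> \<oplus> [(1::nat)] \<cdot> z"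
        using that by (metis minus_closed one_closed)
    qed (use that in auto)
    from this[of "s n"] show ?thesis using 0 s by (intro bexI[of _ \<one>]) simp_all
  next
    case (Suc k)
    then have "nat_residue R q (s n) = nat_residue R q \<one>"
      using coherent_le[OF s, of 1 n] one by simp
    then show ?thesis using nat_residue_unit_mod_power s by simp
  qed
  then obtain t where t: "\<And>n. t n \<in> carrier R"
    "\<And>n. nat_residue R (q ^ n) (s n \<otimes> t n) = nat_residue R (q ^ n) \<one>" by metis
  have ct: "coherent R q t"
    unfolding coherent_def
  proof (intro allI conjI t(1))
    fix n
    let ?r = "nat_residue R (q ^ n)"
    have S: "s k \<in> carrier R" for k using s by simp
    have 1: "?r (s (Suc n) \<otimes> t (Suc n)) = ?r \<one>"
      using t(2)[of "Suc n"] t(1) S by (intro nat_residue_dvd[of "q ^ n" "q ^ Suc n"]) simp_all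
    have "?r (t (Suc n)) = ?r (t (Suc n) \<otimes> (s n \<otimes> t n))"
      using nat_residue_mult_cong[OF refl t(2)[symmetric], of "t (Suc n)"] t(1) S by simp
    also have "t (Suc n) \<otimes> (s n \<otimes> t n) = (s n \<otimes> t (Suc n)) \<otimes> t n"
      using t(1) S by algebra
    also have "?r \<dots> = ?r ((s (Suc n) \<otimes> t (Suc n)) \<otimes> t n)"
      using t(1) S coherent_Suc[OF s] by (intro nat_residue_mult_cong) auto
    also have "\<dots> = ?r (\<one> \<otimes> t n)"
      using t(1) S 1 by (intro nat_residue_mult_cong) auto
    finally show "?r (t (Suc n)) = ?r (t n)" using t(1) by simp
  qed
  interpret C: cring "completion R q" by (rule completion_cring)
  have "padic_limit R q s \<otimes>\<^bsub>completion R q\<^esub> padic_limit R q t = \<one>\<^bsub>completion R q\<^esub>"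
    using t by (simp add: completion_mult s ct completion_one padic_limit_eq_iff)
  then show ?thesis
    using C.Units_closed padic_limit_closed[OF s] padic_limit_closed[OF ct] C.m_comm
    unfolding Units_def by (metis (mono_tags, lifting) mem_Collect_eq)
qed

text \<open>The kernel of the projection from the completion to R/qR.\<close>

definition level_kernel :: "nat \<Rightarrow> (nat \<Rightarrow> 'a set) set" where
  "level_kernel q = {x \<in> carrier (completion R q). x 1 = nat_ideal R q}"

lemma level_kernel_limit:
  assumes "coherent R q s"
  shows "padic_limit R q s \<in> level_kernel q \<longleftrightarrow> s 1 \<in> nat_ideal R q"
proof -
  have "s 1 \<in> nat_ideal R q \<longleftrightarrow> nat_residue R q (s 1) = nat_ideal R q"
    using nat_residue_mem_iff[of \<zero> "s 1" q] nat_residue_zero assms by simp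
  moreover have "padic_limit R q s 1 = nat_residue R q (s 1)" by (simp add: padic_limit_def)
  ultimately show ?thesis using padic_limit_closed[OF assms] by (simp add: level_kernel_def)
qed

text \<open>If \<open>x\<close> lay outside \<open>M\<close>, then 1 = y + c x with \<open>y\<close>
  in \<open>M\<close>. As \<open>x\<close> vanishes modulo \<open>q\<close>, this \<open>y\<close>
  is congruent to 1 modulo \<open>q\<close>, hence a unit by \<open>completion_unit\<close>, which
  is impossible in \<open>M\<close>.\<close>

lemma level_kernel_subset_maximal:
  assumes M: "maximalideal M (completion R q)"
  shows "level_kernel q \<subseteq> M"
proof
  interpret C: cring "completion R q" by (rule completion_cring)
  interpret M: maximalideal M "completion R q" by fact
  fix x assume x: "x \<in> level_kernel q"
  then have xC: "x \<in> carrier (completion R q)" by (simp add: level_kernel_def)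
  show "x \<in> M"
  proof (rule ccontr)
    assume "x \<notin> M"
    let ?J = "M <+>\<^bsub>completion R q\<^esub> PIdl\<^bsub>completion R q\<^esub> x"
    have J: "ideal ?J (completion R q)"
      using C.add_ideals[OF M.is_ideal C.cgenideal_ideal[OF xC]] .
    have in_J: "y \<oplus>\<^bsub>completion R q\<^esub> c \<otimes>\<^bsub>completion R q\<^esub> x \<in> ?J"
      if "y \<in> M" "c \<in> carrier (completion R q)" for y c
      using that by (auto simp: set_add_def' cgenideal_def)
    have "M \<subseteq> ?J"
      using in_J[OF _ C.zero_closed] xC M.a_Hcarr by auto
    moreover have "x \<in> ?J"
      using in_J[OF M.zero_closed C.one_closed] xC by simp
    ultimately have "?J = carrier (completion R q)"
      using M.I_maximal[OF J] \<open>x \<notin> M\<close> additive_subgroup.a_subset[OF ideal.axioms(1)[OF J]] by blast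
    then have "\<one>\<^bsub>completion R q\<^esub> \<in> ?J" using C.one_closed by metis
    then obtain y c where yc: "y \<in> M" "c \<in> carrier (completion R q)"
      "\<one>\<^bsub>completion R q\<^esub> = y \<oplus>\<^bsub>completion R q\<^esub> c \<otimes>\<^bsub>completion R q\<^esub> x"
      by (auto simp: set_add_def' cgenideal_def)
    obtain s t where st: "coherent R q s" "c = padic_limit R q s" "coherent R q t" "x = padic_limit R q t"
      using yc(2) xC by (metis completionE)
    have yC: "y \<in> carrier (completion R q)" using yc(1) by (rule M.a_Hcarr)
    then obtain u where u: "coherent R q u" "y = padic_limit R q u" by (rule completionE)
    have t1: "t 1 \<in> nat_ideal R q" using x st level_kernel_limit by simp
    have "padic_limit R q (\<lambda>_. \<one>) = padic_limit R q (\<lambda>n. u n \<oplus> s n \<otimes> t n)"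
      using yc(3) st u by (simp add: completion_one completion_mult completion_add coherent_mult)
    then have "nat_residue R (q ^ 1) \<one> = nat_residue R (q ^ 1) (u 1 \<oplus> s 1 \<otimes> t 1)"
      unfolding padic_limit_eq_iff by blast
    moreover have "nat_residue R q (u 1 \<oplus> s 1 \<otimes> t 1) = nat_residue R q (u 1)"
    proof -
      have "s 1 \<otimes> t 1 \<in> nat_ideal R q"
        using t1 st by (intro ideal.I_l_closed[OF nat_ideal_ideal]) auto
      then show ?thesis
        using u st by (subst nat_residue_eq_iff) (auto simp: nat_ideal_eq)
    qed
    ultimately have "y \<in> Units (completion R q)"
      unfolding u(2) by (intro completion_unit u(1)) simp
    then obtain w where "w \<in> carrier (completion R q)" "w \<otimes>\<^bsub>completion R q\<^esub> y = \<one>\<^bsub>completion R q\<^esub>"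
      unfolding Units_def by blast
    then have "\<one>\<^bsub>completion R q\<^esub> \<in> M" using M.I_l_closed[OF yc(1)] by metis
    then show False using M.one_imp_carrier M.I_notcarr by blast
  qed
qed

definition to_completion :: "nat \<Rightarrow> 'a \<Rightarrow> nat \<Rightarrow> 'a set" where
  "to_completion q r = padic_limit R q (\<lambda>_. r)"

lemma to_completion_hom: "ring_hom_ring R (completion R q) (to_completion q)"
proof (rule ring_hom_ringI[OF ring_axioms cring.axioms(1)[OF completion_cring]])
  fix x y assume "x \<in> carrier R" "y \<in> carrier R"
  then show "to_completion q x \<in> carrier (completion R q)"
    "to_completion q (x \<otimes> y) = to_completion q x \<otimes>\<^bsub>completion R q\<^esub> to_completion q y"
    "to_completion q (x \<oplus> y) = to_completion q x \<oplus>\<^bsub>completion R q\<^esub> to_completion q y"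
    by (simp_all add: to_completion_def padic_limit_closed completion_mult completion_add coherent_const)
qed (simp add: to_completion_def completion_one)

text \<open>The limit and the constant sequence \<open>r\<close> differ by an element of
  \<open>level_kernel q\<close>, so an ideal containing this kernel sees only level 1.\<close>

lemma mem_ideal_iff_approx:
  assumes J: "ideal J (completion R q)" "level_kernel q \<subseteq> J"
    and s: "coherent R q s" and r: "r \<in> carrier R" "nat_residue R q r = nat_residue R q (s 1)"
  shows "padic_limit R q s \<in> J \<longleftrightarrow> to_completion q r \<in> J"
proof -
  interpret C: cring "completion R q" by (rule completion_cring)
  interpret J: ideal J "completion R q" by fact
  let ?d = "padic_limit R q (\<lambda>n. s n \<oplus> \<ominus> r)"
  have cd: "coherent R q (\<lambda>n. s n \<oplus> \<ominus> r)"
    using coherent_add[OF s coherent_inv[OF coherent_const[OF r(1)]]] .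
  have "s 1 \<oplus> \<ominus> r \<in> nat_ideal R q"
    using quotient_eq_iff_same_a_r_cos[OF nat_ideal_ideal, of "s 1" r q] r s
    by (simp add: nat_residue_def a_minus_def)
  then have d: "?d \<in> J" using cd J(2) level_kernel_limit by blast
  have rC: "to_completion q r \<in> carrier (completion R q)"
    using r by (simp add: to_completion_def padic_limit_closed coherent_const)
  have "s n = (s n \<oplus> \<ominus> r) \<oplus> r" for n
    using r(1) coherent_closed[OF s, of n] by (simp add: a_assoc l_neg)
  then have eq: "padic_limit R q s = ?d \<oplus>\<^bsub>completion R q\<^esub> to_completion q r"
    unfolding to_completion_def by (simp add: completion_add cd coherent_const r)
  have dC: "?d \<in> carrier (completion R q)" using cd by (rule padic_limit_closed)
  have "to_completion q r = padic_limit R q s \<oplus>\<^bsub>completion R q\<^esub> \<ominus>\<^bsub>completion R q\<^esub> ?d"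
    unfolding eq using dC rC by (simp add: C.a_comm[of ?d] C.a_assoc C.r_neg)
  then show ?thesis using eq d by (metis J.a_closed J.a_inv_closed)
qed

text \<open>Both sides are the ideals of R/qR. The condition \<open>x 1 \<subseteq> H\<close> means
  that one, equivalently every, representative of \<open>x\<close> at level 1 lies in
  \<open>H\<close>, since \<open>H\<close> contains \<open>nat_ideal R q\<close>.\<close>

lemma ideal_correspondence_completion:
  "ideal_correspondence R (completion R q) (nat_ideal R q) (level_kernel q)
     (\<lambda>J. {r \<in> carrier R. to_completion q r \<in> J})
     (\<lambda>H. {x \<in> carrier (completion R q). x 1 \<subseteq> H})"
proof -
  interpret C: cring "completion R q" by (rule completion_cring)
  interpret h: ring_hom_ring R "completion R q" "to_completion q" by (rule to_completion_hom)
  have sub: "nat_residue R q x \<subseteq> H \<longleftrightarrow> x \<in> H"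
    if H: "ideal H R" "nat_ideal R q \<subseteq> H" and x: "x \<in> carrier R" for x H
  proof
    interpret H: ideal H R by fact
    assume "x \<in> H"
    then show "nat_residue R q x \<subseteq> H"
      using H(2) by (auto simp: nat_residue_def a_r_coset_def')
  qed (use nat_residue_self x in blast)
  have g_mem: "padic_limit R q s 1 \<subseteq> H \<longleftrightarrow> s 1 \<in> H"
    if "ideal H R" "nat_ideal R q \<subseteq> H" "coherent R q s" for s H
    using sub[OF that(1,2)] that(3) by (simp add: padic_limit_def)
  show ?thesis
  proof (rule ideal_correspondence.intro)
    fix J assume J: "ideal J (completion R q)" "level_kernel q \<subseteq> J"
    let ?f = "{r \<in> carrier R. to_completion q r \<in> J}"
    have f: "ideal ?f R" using h.ideal_vimage[OF J(1)] .
    have k: "nat_ideal R q \<subseteq> ?f"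
    proof
      fix r assume "r \<in> nat_ideal R q"
      moreover from this have "r \<in> carrier R"
        using additive_subgroup.a_subset[OF ideal.axioms(1)[OF nat_ideal_ideal]] by blast
      ultimately show "r \<in> ?f"
        using J(2) level_kernel_limit[OF coherent_const, of r q] by (auto simp: to_completion_def)
    qed
    have "x \<in> J \<longleftrightarrow> x 1 \<subseteq> ?f" if x: "x \<in> carrier (completion R q)" for x
    proof -
      obtain s where s: "coherent R q s" "x = padic_limit R q s" using x by (rule completionE)
      then show ?thesis
        using mem_ideal_iff_approx[OF J s(1), of "s 1"] g_mem[OF f k s(1)] by simp
    qed
    moreover have "J \<subseteq> carrier (completion R q)"
      using additive_subgroup.a_subset[OF ideal.axioms(1)[OF J(1)]] .
    ultimately have "{x \<in> carrier (completion R q). x 1 \<subseteq> ?f} = J" by blast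
    with f k show "ideal ?f R \<and> nat_ideal R q \<subseteq> ?f \<and>
        {x \<in> carrier (completion R q). x 1 \<subseteq> ?f} = J" by blast
  next
    fix H assume H: "ideal H R" "nat_ideal R q \<subseteq> H"
    interpret H: ideal H R by fact
    let ?g = "{x \<in> carrier (completion R q). x 1 \<subseteq> H}"
    have "ideal ?g (completion R q)"
    proof (rule idealI[OF C.ring_axioms])
      show "subgroup ?g (add_monoid (completion R q))"
      proof (rule C.add.subgroupI)
        have "\<zero>\<^bsub>completion R q\<^esub> \<in> ?g"
          using g_mem[OF H coherent_const[OF zero_closed]] C.zero_closed by (simp add: completion_zero)
        then show "?g \<noteq> {}" by blast
      next
        fix x assume x: "x \<in> ?g"
        then obtain s where s: "coherent R q s" "x = padic_limit R q s" by (auto elim: completionE)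
        have "padic_limit R q (\<lambda>n. \<ominus> s n) \<oplus>\<^bsub>completion R q\<^esub> x = \<zero>\<^bsub>completion R q\<^esub>"
          using s by (simp add: completion_add coherent_inv completion_zero l_neg)
        then have "\<ominus>\<^bsub>completion R q\<^esub> x = padic_limit R q (\<lambda>n. \<ominus> s n)"
          by (rule C.minus_equality) (use x s in \<open>simp_all add: coherent_inv padic_limit_closed\<close>)
        then show "\<ominus>\<^bsub>completion R q\<^esub> x \<in> ?g"
          using x s g_mem[OF H] coherent_inv padic_limit_closed by auto
      next
        fix x y assume xy: "x \<in> ?g" "y \<in> ?g"
        then obtain s t where "coherent R q s" "x = padic_limit R q s" "coherent R q t" "y = padic_limit R q t"
          by (auto elim!: completionE)
        then show "x \<oplus>\<^bsub>completion R q\<^esub> y \<in> ?g"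
          using xy g_mem[OF H] by (simp add: completion_add coherent_add padic_limit_closed)
      qed auto
    next
      fix x y assume xy: "x \<in> ?g" "y \<in> carrier (completion R q)"
      then obtain s t where "coherent R q s" "x = padic_limit R q s" "coherent R q t" "y = padic_limit R q t"
        by (auto elim!: completionE)
      then show "y \<otimes>\<^bsub>completion R q\<^esub> x \<in> ?g" "x \<otimes>\<^bsub>completion R q\<^esub> y \<in> ?g"
        using xy g_mem[OF H]
        by (simp_all add: completion_mult coherent_mult padic_limit_closed H.I_l_closed H.I_r_closed)
    qed
    moreover have "level_kernel q \<subseteq> ?g" using H by (auto simp: level_kernel_def)
    moreover have "{r \<in> carrier R. to_completion q r \<in> ?g} = H"
      using g_mem[OF H coherent_const] H.a_subset
      by (auto simp: to_completion_def padic_limit_closed coherent_const)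
    ultimately show "ideal ?g (completion R q) \<and> level_kernel q \<subseteq> ?g \<and>
        {r \<in> carrier R. to_completion q r \<in> ?g} = H" by blast
  next
    show "nat_ideal R q \<subseteq> carrier R"
      using additive_subgroup.a_subset[OF ideal.axioms(1)[OF nat_ideal_ideal]] .
  qed (auto simp: level_kernel_def ring_axioms C.ring_axioms)
qed

text \<open>The map from \<open>R\<close> to the quotient of the completion by \<open>J\<close> is
  onto, because \<open>x\<close> and its representative \<open>s 1\<close> agree modulo the kernel;
  what it kills is the preimage of \<open>J\<close>.\<close>

lemma card_quot_completion:
  assumes J: "ideal J (completion R q)" "level_kernel q \<subseteq> J"
  shows "card (carrier (completion R q Quot J)) =
    card (carrier (R Quot {r \<in> carrier R. to_completion q r \<in> J}))"
proof -
  interpret C: cring "completion R q" by (rule completion_cring)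
  interpret J: ideal J "completion R q" by fact
  interpret h: ring_hom_ring R "completion R q" "to_completion q" by (rule to_completion_hom)
  let ?f = "{r \<in> carrier R. to_completion q r \<in> J}"
  have f: "ideal ?f R" using h.ideal_vimage[OF J(1)] .
  show ?thesis
    unfolding quotient_carrier
  proof (rule card_image_eq_card_image[where h = "to_completion q", symmetric])
    fix x y assume xy: "x \<in> carrier R" "y \<in> carrier R"
    then have "to_completion q (x \<ominus> y) = to_completion q x \<ominus>\<^bsub>completion R q\<^esub> to_completion q y"
      by (simp add: a_minus_def)
    then show "?f +> x = ?f +> y \<longleftrightarrow>
        J +>\<^bsub>completion R q\<^esub> to_completion q x = J +>\<^bsub>completion R q\<^esub> to_completion q y"
      using quotient_eq_iff_same_a_r_cos[OF f xy]
        C.quotient_eq_iff_same_a_r_cos[OF J(1) h.hom_closed[OF xy(1)] h.hom_closed[OF xy(2)]] xy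
      by simp
  next
    fix x assume "x \<in> carrier (completion R q)"
    then obtain s where s: "coherent R q s" "x = padic_limit R q s" by (rule completionE)
    let ?r = "s 1"
    have "coherent R q (\<lambda>n. s n \<oplus> \<ominus> ?r)"
      using s by (intro coherent_add coherent_inv coherent_const) auto
    moreover have "?r \<oplus> \<ominus> ?r \<in> nat_ideal R q"
      using s additive_subgroup.zero_closed[OF ideal.axioms(1)[OF nat_ideal_ideal]] by (simp add: r_neg)
    ultimately have d: "padic_limit R q (\<lambda>n. s n \<oplus> \<ominus> ?r) \<in> J"
      using J(2) level_kernel_limit by blast
    have r: "?r \<in> carrier R" using s by simp
    have "padic_limit R q (\<lambda>n. s n \<oplus> \<ominus> ?r) = x \<ominus>\<^bsub>completion R q\<^esub> to_completion q ?r"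
    proof -
      have "to_completion q (\<ominus> ?r) = \<ominus>\<^bsub>completion R q\<^esub> to_completion q ?r"
        using r by simp
      then have "x \<ominus>\<^bsub>completion R q\<^esub> to_completion q ?r = x \<oplus>\<^bsub>completion R q\<^esub> to_completion q (\<ominus> ?r)"
        by (simp add: a_minus_def)
      then show ?thesis using s r
        by (simp add: to_completion_def completion_add coherent_const)
    qed
    then show "\<exists>r\<in>carrier R. J +>\<^bsub>completion R q\<^esub> x = J +>\<^bsub>completion R q\<^esub> to_completion q r"
      using d r s C.quotient_eq_iff_same_a_r_cos[OF J(1), of x "to_completion q ?r"]
      by (intro bexI[of _ ?r]) (auto simp: padic_limit_closed)
  qed simp
qed

lemma local_zeta_eq:
  "local_zeta R q n = dirichlet_prod {P. maximalideal P R \<and> nat_ideal R q \<subseteq> P}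
     (\<lambda>P. euler_factor (card (carrier (R Quot P)))) n"
proof -
  interpret ideal_correspondence R "completion R q" "nat_ideal R q" "level_kernel q"
    "\<lambda>J. {r \<in> carrier R. to_completion q r \<in> J}" "\<lambda>H. {x \<in> carrier (completion R q). x 1 \<subseteq> H}"
    by (rule ideal_correspondence_completion)
  have "{M. maximalideal M (completion R q)} =
      {M. maximalideal M (completion R q) \<and> level_kernel q \<subseteq> M}"
    using level_kernel_subset_maximal by blast
  moreover have "dirichlet_prod {M. maximalideal M (completion R q) \<and> level_kernel q \<subseteq> M}
      (\<lambda>M. euler_factor (card (carrier (completion R q Quot M)))) n =
    dirichlet_prod {P. maximalideal P R \<and> nat_ideal R q \<subseteq> P}
      (\<lambda>P. euler_factor (card (carrier (R Quot P)))) n"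
    by (rule dirichlet_prod_reindex[OF bij_maximal]) (simp add: card_quot_completion maximalideal_def)
  ultimately show ?thesis unfolding local_zeta_def by simp
qed

end

section \<open>Rings that are isomorphic modulo an integer\<close>

lemma dirichlet_prod_unit:
  assumes "finite I" "m > 0"
    and one: "\<And>i. i \<in> I \<Longrightarrow> F i 1 = 1"
    and supp: "\<And>i k. i \<in> I \<Longrightarrow> k dvd m \<Longrightarrow> F i k \<noteq> 0 \<Longrightarrow> k = 1"
  shows "dirichlet_prod I F m = (if m = 1 then 1 else 0)"
proof (cases "m = 1")
  case True
  have "{g \<in> I \<rightarrow>\<^sub>E {k. k dvd m}. (\<Prod>i\<in>I. g i) = m} = {\<lambda>i\<in>I. 1}"
    using True by (auto simp: PiE_eq_singleton fun_eq_iff PiE_def Pi_def extensional_def)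
  then show ?thesis using True one unfolding dirichlet_prod_def by simp
next
  case False
  have "(\<Prod>i\<in>I. F i (g i)) = 0" if g: "g \<in> I \<rightarrow>\<^sub>E {k. k dvd m}" "(\<Prod>i\<in>I. g i) = m" for g
  proof (rule ccontr)
    assume "(\<Prod>i\<in>I. F i (g i)) \<noteq> 0"
    then have "g i = 1" if "i \<in> I" for i
      using supp[of i "g i"] g(1) that assms(1) by (auto simp: prod_zero_iff PiE_def Pi_def)
    then show False using g(2) False by simp
  qed
  then show ?thesis using False unfolding dirichlet_prod_def by simp
qed

lemma dirichlet_prod_cong:
  assumes "\<And>i k. i \<in> I \<Longrightarrow> k dvd n \<Longrightarrow> F i k = G i k"
  shows "dirichlet_prod I F n = dirichlet_prod I G n"
  unfolding dirichlet_prod_def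
  by (intro sum.cong prod.cong refl) (use assms in \<open>auto simp: PiE_def Pi_def\<close>)

lemma quotient_zero: "\<zero>\<^bsub>R Quot I\<^esub> = I"
  by (simp add: FactRing_def)

text \<open>The additive order of 1 in the quotient divides the prime \<open>q\<close> and is not 1,
  so it is \<open>q\<close>, and Lagrange's theorem applies. If the quotient is infinite, its
  \<open>card\<close> is 0, which \<open>q\<close> divides as well.\<close>

lemma (in cring) dvd_card_quot:
  assumes P: "maximalideal P R" "nat_ideal R q \<subseteq> P" and q: "Factorial_Ring.prime q"
  shows "q dvd card (carrier (R Quot P))"
proof (cases "finite (carrier (R Quot P))")
  case True
  interpret P: maximalideal P R by fact
  interpret Q: ring "R Quot P" by (rule P.quotient_is_ring)
  interpret h: ring_hom_ring R "R Quot P" "(+>) P" by (rule P.rcos_ring_hom_ring)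
  let ?G = "add_monoid (R Quot P)" and ?u = "P +> \<one>"
  have u: "?u \<in> carrier ?G" using h.hom_closed[OF one_closed] by simp
  have pow: "?u [^]\<^bsub>?G\<^esub> k = P +> ([k] \<cdot> \<one>)" for k :: nat
  proof (induction k)
    case 0
    then show ?case using h.hom_zero by (simp add: add_pow_def)
  next
    case (Suc k)
    then show ?case using h.hom_add[of "[k] \<cdot> \<one>" \<one>] by simp
  qed
  have G_one: "\<one>\<^bsub>?G\<^esub> = P" using quotient_zero[of R P] by simp
  have "[q] \<cdot> \<one> \<in> P" using P(2) nat_ideal_eq[of q] one_closed by blast
  then have "?u [^]\<^bsub>?G\<^esub> q = \<one>\<^bsub>?G\<^esub>"
    unfolding pow G_one by (rule a_rcos_zero[OF P.is_ideal])
  then have "group.ord ?G ?u dvd q"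
    using group.pow_eq_id[OF Q.add.is_group u] by simp
  moreover have "group.ord ?G ?u \<noteq> 1"
  proof
    assume "group.ord ?G ?u = 1"
    then have "?u = \<one>\<^bsub>?G\<^esub>" using group.ord_eq_1[OF Q.add.is_group u] by simp
    then have "?u = P" unfolding G_one .
    then have "\<one> \<in> P" using P.a_rcos_self[OF one_closed] by simp
    then show False using P.one_imp_carrier P.I_notcarr by blast
  qed
  ultimately have "group.ord ?G ?u = q" using q by (metis prime_nat_iff)
  then show ?thesis
    using group.ord_dvd_group_order[OF Q.add.is_group u] by (simp add: Coset.order_def)
qed simp

section \<open>Ideals above a prime, and the local factor away from it\<close>

context cring_coords begin

text \<open>\<open>T\<close> is the finite set of elements with coordinates in
  \<open>{0..<q}\<close>, one for each class modulo \<open>q\<close>. An ideal containing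
  \<open>nat_ideal R q\<close> is a union of classes, so it is determined by its intersection with
  \<open>T\<close>.\<close>

lemma finite_ideals_above_nat_ideal:
  assumes "q > 0"
  shows "finite {P. ideal P R \<and> nat_ideal R q \<subseteq> P}"
proof -
  define T where "T = {x \<in> carrier R. v x \<in> {c. \<forall>i. (i < m \<longrightarrow> 0 \<le> c i \<and> c i < int q) \<and> (i \<ge> m \<longrightarrow> c i = 0)}}"
  have "finite T"
  proof (rule inj_on_finite[where f = "\<lambda>x. restrict (v x) {..<m}"])
    show "inj_on (\<lambda>x. restrict (v x) {..<m}) T"
    proof (rule inj_onI)
      fix x y assume xy: "x \<in> T" "y \<in> T" "restrict (v x) {..<m} = restrict (v y) {..<m}"
      have "v x i = v y i" for i
        using fun_cong[OF xy(3), of i] xy(1,2) by (cases "i < m") (auto simp: T_def)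
      then show "x = y" using xy by (intro v_eqI) (auto simp: T_def)
    qed
    show "(\<lambda>x. restrict (v x) {..<m}) ` T \<subseteq> {..<m} \<rightarrow>\<^sub>E {0..<int q}"
      by (intro image_subsetI restrict_PiE_iff[THEN iffD2]) (auto simp: T_def)
    show "finite ({..<m} \<rightarrow>\<^sub>E {0..<int q})" by (intro finite_PiE) auto
  qed
  moreover have "inj_on (\<lambda>P. P \<inter> T) {P. ideal P R \<and> nat_ideal R q \<subseteq> P}"
  proof -
    have sub: "P \<subseteq> P'" if P: "ideal P R" "nat_ideal R q \<subseteq> P" and P': "ideal P' R" "nat_ideal R q \<subseteq> P'"
      and eq: "P \<inter> T = P' \<inter> T" for P P'
    proof
      interpret P: ideal P R by fact
      interpret P': ideal P' R by fact
      fix x assume x: "x \<in> P"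
      then have xR: "x \<in> carrier R" by (rule P.a_Hcarr)
      obtain y where y: "y \<in> carrier R" "v y = (\<lambda>i. if i < m then v x i mod int q else 0)"
        by (rule v_surj[of "\<lambda>i. if i < m then v x i mod int q else 0"]) auto
      have d: "x \<oplus> \<ominus> y \<in> nat_ideal R q"
        using xR y v_outside
        by (auto simp: nat_ideal_iff_coords v_simps minus_mod_eq_mult_div)
      have "y = x \<oplus> \<ominus> (x \<oplus> \<ominus> y)" using xR y(1) by algebra
      moreover have "x \<oplus> \<ominus> (x \<oplus> \<ominus> y) \<in> P"
        by (rule P.a_closed[OF x P.a_inv_closed[OF subsetD[OF P(2) d]]])
      ultimately have "y \<in> P" by (rule ssubst)
      moreover have "y \<in> T" using y assms by (auto simp: T_def)
      ultimately have "y \<in> P'" using eq by blast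
      have "x = y \<oplus> (x \<oplus> \<ominus> y)" using xR y(1) by algebra
      moreover have "y \<oplus> (x \<oplus> \<ominus> y) \<in> P'"
        by (rule P'.a_closed[OF \<open>y \<in> P'\<close> subsetD[OF P'(2) d]])
      ultimately show "x \<in> P'" by (rule ssubst)
    qed
    then show ?thesis by (intro inj_onI) (use sub in blast)
  qed
  moreover have "(\<lambda>P. P \<inter> T) ` {P. ideal P R \<and> nat_ideal R q \<subseteq> P} \<subseteq> Pow T" by blast
  ultimately show ?thesis by (meson finite_Pow_iff inj_on_finite)
qed

text \<open>By \<open>dvd_card_quot\<close> every power of a residue cardinality other than 1 itself
  is a multiple of \<open>q\<close>, so a \<open>k\<close> prime to \<open>q\<close> meets only the
  constant terms of the local zeta factor.\<close>

lemma local_L_coprime: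
  assumes q: "Factorial_Ring.prime q" and k: "k > 0" "\<not> q dvd k"
  shows "local_L R q k = (if k = 1 then 1 else 0)"
proof -
  have zeta: "local_zeta R q k = (if k = 1 then 1 else 0)"
    unfolding local_zeta_eq
  proof (rule dirichlet_prod_unit)
    show "finite {P. maximalideal P R \<and> nat_ideal R q \<subseteq> P}"
      by (rule finite_subset[OF _ finite_ideals_above_nat_ideal[of q]])
        (use q in \<open>auto simp: maximalideal_def prime_gt_0_nat\<close>)
    show "euler_factor (card (carrier (R Quot P))) 1 = 1" for P
      unfolding euler_factor_def by (metis power_0)
  next
    fix P l assume P: "P \<in> {P. maximalideal P R \<and> nat_ideal R q \<subseteq> P}" and l: "l dvd k"
      and "euler_factor (card (carrier (R Quot P))) l \<noteq> 0"
    then obtain j where j: "l = card (carrier (R Quot P)) ^ j"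
      by (auto simp: euler_factor_def split: if_splits)
    have "q dvd card (carrier (R Quot P))" using dvd_card_quot P q by blast
    then have "j = 0" using j l k(2) by (metis dvd_power_iff_le dvd_trans dvd_power gr0I)
    then show "l = 1" using j by simp
  qed (use k in auto)
  have "local_L R q k = (\<Sum>l | l dvd k. euler_poly q l * local_zeta R q (k div l))"
    by (simp add: local_L_def dirichlet_mult_def)
  \<comment> \<open>The numerator \<open>euler_poly q\<close> lives on 1 and \<open>q\<close>, and
    \<open>q\<close> does not divide \<open>k\<close>.\<close>
  also have "\<dots> = (\<Sum>l\<in>{1}. euler_poly q l * local_zeta R q (k div l))"
    using k by (intro sum.mono_neutral_right) (auto simp: euler_poly_def)
  also have "\<dots> = local_zeta R q k" by (simp add: euler_poly_def)
  finally show ?thesis using zeta by simp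
qed

end

text \<open>Such a \<open>\<phi>\<close> induces ring isomorphisms \<open>R/qR \<cong> S/qS\<close> for all \<open>q dvd N\<close>.\<close>

locale congruent_rings = R?: cring R + S: cring S for R (structure) and S (structure) +
  fixes N :: nat and \<phi>
  assumes bij: "bij_betw \<phi> (carrier R) (carrier S)"
    and add: "x \<in> carrier R \<Longrightarrow> y \<in> carrier R \<Longrightarrow> \<phi> (x \<oplus>\<^bsub>R\<^esub> y) = \<phi> x \<oplus>\<^bsub>S\<^esub> \<phi> y"
    and mult: "x \<in> carrier R \<Longrightarrow> y \<in> carrier R \<Longrightarrow>
      \<exists>z\<in>carrier S. \<phi> (x \<otimes>\<^bsub>R\<^esub> y) = \<phi> x \<otimes>\<^bsub>S\<^esub> \<phi> y \<oplus>\<^bsub>S\<^esub> [N] \<cdot>\<^bsub>S\<^esub> z"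
begin

lemma closed [simp]: "x \<in> carrier R \<Longrightarrow> \<phi> x \<in> carrier S"
  using bij by (auto simp: bij_betw_def)

lemma surj: "y \<in> carrier S \<Longrightarrow> \<exists>x\<in>carrier R. y = \<phi> x"
  using bij by (auto simp: bij_betw_def)

lemma eq_iff: "x \<in> carrier R \<Longrightarrow> y \<in> carrier R \<Longrightarrow> \<phi> x = \<phi> y \<longleftrightarrow> x = y"
  using bij by (auto simp: bij_betw_def inj_on_def)

lemma zero: "\<phi> \<zero>\<^bsub>R\<^esub> = \<zero>\<^bsub>S\<^esub>"
proof -
  have "\<phi> \<zero>\<^bsub>R\<^esub> \<oplus>\<^bsub>S\<^esub> \<phi> \<zero>\<^bsub>R\<^esub> = \<phi> \<zero>\<^bsub>R\<^esub>" using add[of "\<zero>\<^bsub>R\<^esub>" "\<zero>\<^bsub>R\<^esub>"] by simp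
  then show ?thesis using S.add.r_cancel_one' by (metis closed R.zero_closed)
qed

lemma inv:
  assumes "x \<in> carrier R"
  shows "\<phi> (\<ominus>\<^bsub>R\<^esub> x) = \<ominus>\<^bsub>S\<^esub> \<phi> x"
proof -
  have "\<phi> (\<ominus>\<^bsub>R\<^esub> x) \<oplus>\<^bsub>S\<^esub> \<phi> x = \<zero>\<^bsub>S\<^esub>"
    using add[of "\<ominus>\<^bsub>R\<^esub> x" x] assms zero by (simp add: R.l_neg)
  then show ?thesis using S.minus_equality assms by simp
qed

lemma nat_mult: "x \<in> carrier R \<Longrightarrow> \<phi> ([k] \<cdot>\<^bsub>R\<^esub> x) = [k] \<cdot>\<^bsub>S\<^esub> \<phi> x" for k :: nat
  by (induction k) (simp_all add: zero add)

lemma inv_into_simps: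
  "x \<in> carrier R \<Longrightarrow> inv_into (carrier R) \<phi> (\<phi> x) = x"
  "y \<in> carrier S \<Longrightarrow> \<phi> (inv_into (carrier R) \<phi> y) = y"
  "y \<in> carrier S \<Longrightarrow> inv_into (carrier R) \<phi> y \<in> carrier R"
  using bij by (auto simp: bij_betw_def f_inv_into_f inv_into_into)

lemma nat_ideal_image: "\<phi> ` nat_ideal R k = nat_ideal S k"
proof (intro equalityI subsetI)
  fix y assume "y \<in> nat_ideal S k"
  then obtain z where z: "z \<in> carrier S" "y = [k] \<cdot>\<^bsub>S\<^esub> z" by (auto simp: S.nat_ideal_eq)
  then obtain x where "x \<in> carrier R" "z = \<phi> x" using surj by blast
  then show "y \<in> \<phi> ` nat_ideal R k" using z nat_mult[of x k] R.nat_ideal_eq[of k] by (auto intro!: image_eqI)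
qed (auto simp: R.nat_ideal_eq S.nat_ideal_eq nat_mult)

text \<open>By this symmetry, transfer of ideals and of functionals has to be proved in one
  direction only. The error term of the inverse map is the preimage of the negated error
  term.\<close>

lemma congruent_inverse: "congruent_rings S R N (inv_into (carrier R) \<phi>)"
proof
  let ?\<psi> = "inv_into (carrier R) \<phi>"
  show "bij_betw ?\<psi> (carrier S) (carrier R)" using bij by (rule bij_betw_inv_into)
  show psi_add: "?\<psi> (x \<oplus>\<^bsub>S\<^esub> y) = ?\<psi> x \<oplus>\<^bsub>R\<^esub> ?\<psi> y" if "x \<in> carrier S" "y \<in> carrier S" for x y
    using that add[of "?\<psi> x" "?\<psi> y"] inv_into_simps by (metis R.a_closed)
  fix x y assume xy: "x \<in> carrier S" "y \<in> carrier S"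
  then obtain z where z: "z \<in> carrier S"
    "\<phi> (?\<psi> x \<otimes>\<^bsub>R\<^esub> ?\<psi> y) = x \<otimes>\<^bsub>S\<^esub> y \<oplus>\<^bsub>S\<^esub> [N] \<cdot>\<^bsub>S\<^esub> z"
    using mult[of "?\<psi> x" "?\<psi> y"] inv_into_simps by metis
  let ?w = "?\<psi> (\<ominus>\<^bsub>S\<^esub> z)"
  have w: "?w \<in> carrier R" "\<phi> ?w = \<ominus>\<^bsub>S\<^esub> z" using z inv_into_simps by simp_all
  have "\<phi> (?\<psi> x \<otimes>\<^bsub>R\<^esub> ?\<psi> y \<oplus>\<^bsub>R\<^esub> [N] \<cdot>\<^bsub>R\<^esub> ?w) =
      x \<otimes>\<^bsub>S\<^esub> y \<oplus>\<^bsub>S\<^esub> [N] \<cdot>\<^bsub>S\<^esub> z \<oplus>\<^bsub>S\<^esub> [N] \<cdot>\<^bsub>S\<^esub> (\<ominus>\<^bsub>S\<^esub> z)"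
    using xy w z inv_into_simps by (subst add) (simp_all add: nat_mult)
  also have "\<dots> = x \<otimes>\<^bsub>S\<^esub> y"
    using xy z by (simp add: S.a_assoc S.add.nat_pow_inv S.r_neg)
  finally have "?\<psi> (x \<otimes>\<^bsub>S\<^esub> y) = ?\<psi> x \<otimes>\<^bsub>R\<^esub> ?\<psi> y \<oplus>\<^bsub>R\<^esub> [N] \<cdot>\<^bsub>R\<^esub> ?w"
    using xy w inv_into_simps by (metis R.a_closed R.add.nat_pow_closed R.m_closed)
  then show "\<exists>z\<in>carrier R. ?\<psi> (x \<otimes>\<^bsub>S\<^esub> y) = ?\<psi> x \<otimes>\<^bsub>R\<^esub> ?\<psi> y \<oplus>\<^bsub>R\<^esub> [N] \<cdot>\<^bsub>R\<^esub> z"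
    using w by blast
qed

lemma nat_ideal_dvd: "k dvd l \<Longrightarrow> nat_ideal S l \<subseteq> nat_ideal S k"
proof
  fix x assume "k dvd l" "x \<in> nat_ideal S l"
  then obtain j z where "l = k * j" "z \<in> carrier S" "x = [l] \<cdot>\<^bsub>S\<^esub> z"
    unfolding S.nat_ideal_eq by blast
  then have "x = [k] \<cdot>\<^bsub>S\<^esub> ([j] \<cdot>\<^bsub>S\<^esub> z)" "[j] \<cdot>\<^bsub>S\<^esub> z \<in> carrier S"
    by (simp_all add: S.add.nat_pow_pow mult.commute)
  then show "x \<in> nat_ideal S k" unfolding S.nat_ideal_eq by blast
qed

text \<open>The map respects products only up to multiples of \<open>N\<close>. As
  \<open>q dvd N\<close>, these errors lie in \<open>nat_ideal S q\<close>, hence in the image of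
  \<open>P\<close>, so the image still absorbs multiplication.\<close>

lemma ideal_image:
  assumes q: "q dvd N" and P: "ideal P R" "nat_ideal R q \<subseteq> P"
  shows "ideal (\<phi> ` P) S" "nat_ideal S q \<subseteq> \<phi> ` P"
proof -
  interpret P: ideal P R by fact
  show sub: "nat_ideal S q \<subseteq> \<phi> ` P" using nat_ideal_image P(2) by blast
  have add_closed: "x \<oplus>\<^bsub>S\<^esub> y \<in> \<phi> ` P" if xy: "x \<in> \<phi> ` P" "y \<in> \<phi> ` P" for x y
  proof -
    obtain u w where "u \<in> P" "w \<in> P" "x = \<phi> u" "y = \<phi> w" using xy by blast
    then have "x \<oplus>\<^bsub>S\<^esub> y = \<phi> (u \<oplus>\<^bsub>R\<^esub> w)" "u \<oplus>\<^bsub>R\<^esub> w \<in> P" using add P.a_Hcarr by auto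
    then show ?thesis by blast
  qed
  have inv_closed: "\<ominus>\<^bsub>S\<^esub> x \<in> \<phi> ` P" if x: "x \<in> \<phi> ` P" for x
  proof -
    obtain u where "u \<in> P" "x = \<phi> u" using x by blast
    then have "\<ominus>\<^bsub>S\<^esub> x = \<phi> (\<ominus>\<^bsub>R\<^esub> u)" "\<ominus>\<^bsub>R\<^esub> u \<in> P" using inv P.a_Hcarr by auto
    then show ?thesis by blast
  qed
  have mult_closed: "y \<otimes>\<^bsub>S\<^esub> x \<in> \<phi> ` P" if x: "x \<in> \<phi> ` P" and y: "y \<in> carrier S" for x y
  proof -
    obtain u where u: "u \<in> P" "x = \<phi> u" using x by blast
    obtain w where w: "w \<in> carrier R" "y = \<phi> w" using y surj by blast
    have uR: "u \<in> carrier R" using u P.a_Hcarr by blast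
    obtain z where z: "z \<in> carrier S" "\<phi> (w \<otimes>\<^bsub>R\<^esub> u) = y \<otimes>\<^bsub>S\<^esub> x \<oplus>\<^bsub>S\<^esub> [N] \<cdot>\<^bsub>S\<^esub> z"
      using mult[OF w(1) uR] u w by blast
    have yx: "y \<otimes>\<^bsub>S\<^esub> x \<in> carrier S" using u(2) uR y by simp
    have "y \<otimes>\<^bsub>S\<^esub> x = \<phi> (w \<otimes>\<^bsub>R\<^esub> u) \<oplus>\<^bsub>S\<^esub> \<ominus>\<^bsub>S\<^esub> ([N] \<cdot>\<^bsub>S\<^esub> z)"
      unfolding z(2) using yx z(1) by (simp add: S.a_assoc S.r_neg)
    moreover have "[N] \<cdot>\<^bsub>S\<^esub> z \<in> \<phi> ` P"
      using sub nat_ideal_dvd[OF q] z(1) S.nat_ideal_eq[of N] by blast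
    ultimately show ?thesis
      using add_closed inv_closed P.I_l_closed[OF u(1) w(1)] by simp
  qed
  show "ideal (\<phi> ` P) S"
  proof (rule idealI[OF S.ring_axioms])
    show "subgroup (\<phi> ` P) (add_monoid S)"
    proof (rule S.add.subgroupI)
      show "\<phi> ` P \<subseteq> carrier S" using P.a_Hcarr by auto
      show "\<phi> ` P \<noteq> {}" using P.zero_closed by blast
    qed (use add_closed inv_closed in auto)
    fix x y assume xy: "x \<in> \<phi> ` P" "y \<in> carrier S"
    then have "x \<in> carrier S" using P.a_Hcarr by auto
    then show "y \<otimes>\<^bsub>S\<^esub> x \<in> \<phi> ` P" "x \<otimes>\<^bsub>S\<^esub> y \<in> \<phi> ` P"
      using mult_closed[OF xy] S.m_comm[of x y] xy(2) by simp_all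
  qed
qed

lemma ideal_correspondence_image:
  assumes q: "q dvd N"
  shows "ideal_correspondence S R (nat_ideal S q) (nat_ideal R q) ((`) \<phi>)
    ((`) (inv_into (carrier R) \<phi>))"
proof (rule ideal_correspondence.intro)
  fix J assume J: "ideal J R" "nat_ideal R q \<subseteq> J"
  then have "J \<subseteq> carrier R" using additive_subgroup.a_subset[OF ideal.axioms(1)] by blast
  then have "inv_into (carrier R) \<phi> ` \<phi> ` J = J"
    using inv_into_image_cancel[of \<phi> "carrier R" J] bij by (simp add: bij_betw_def)
  then show "ideal (\<phi> ` J) S \<and> nat_ideal S q \<subseteq> \<phi> ` J \<and> inv_into (carrier R) \<phi> ` \<phi> ` J = J"
    using ideal_image[OF q J] by blast
next
  interpret inv: congruent_rings S R N "inv_into (carrier R) \<phi>" by (rule congruent_inverse)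
  fix H assume H: "ideal H S" "nat_ideal S q \<subseteq> H"
  then have "H \<subseteq> carrier S" using additive_subgroup.a_subset[OF ideal.axioms(1)] by blast
  then have "\<phi> ` inv_into (carrier R) \<phi> ` H = H"
    using image_inv_into_cancel[of \<phi> "carrier R" "carrier S" H] bij by (simp add: bij_betw_def)
  then show "ideal (inv_into (carrier R) \<phi> ` H) R \<and> nat_ideal R q \<subseteq> inv_into (carrier R) \<phi> ` H
      \<and> \<phi> ` inv_into (carrier R) \<phi> ` H = H"
    using inv.ideal_image[OF q H] by blast
next
  show "nat_ideal R q \<subseteq> carrier R" "nat_ideal S q \<subseteq> carrier S"
    by (auto simp: R.nat_ideal_eq S.nat_ideal_eq)
qed (auto simp: R.ring_axioms S.ring_axioms)

section \<open>Transfer of the local invariants and of the two coefficients\<close>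

lemma local_zeta_cong:
  assumes q: "q dvd N"
  shows "local_zeta R q n = local_zeta S q n"
  unfolding R.local_zeta_eq S.local_zeta_eq
proof (rule dirichlet_prod_reindex[OF ideal_correspondence.bij_maximal[OF ideal_correspondence_image[OF q]]])
  fix P assume P: "P \<in> {P. maximalideal P R \<and> nat_ideal R q \<subseteq> P}"
  then have I: "ideal P R" by (simp add: maximalideal_def)
  then have I': "ideal (\<phi> ` P) S" using ideal_image[OF q] P by blast
  have sub: "P \<subseteq> carrier R" using additive_subgroup.a_subset[OF ideal.axioms(1)[OF I]] .
  have "card (carrier (R Quot P)) = card (carrier (S Quot (\<phi> ` P)))"
    unfolding quotient_carrier
  proof (rule card_image_eq_card_image[where h = \<phi>])
    fix x y assume xy: "x \<in> carrier R" "y \<in> carrier R"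
    have "\<phi> (x \<ominus>\<^bsub>R\<^esub> y) = \<phi> x \<ominus>\<^bsub>S\<^esub> \<phi> y"
      using xy by (simp add: a_minus_def add inv)
    moreover have "\<phi> (x \<ominus>\<^bsub>R\<^esub> y) \<in> \<phi> ` P \<longleftrightarrow> x \<ominus>\<^bsub>R\<^esub> y \<in> P"
    proof
      assume "\<phi> (x \<ominus>\<^bsub>R\<^esub> y) \<in> \<phi> ` P"
      then obtain u where "u \<in> P" "\<phi> (x \<ominus>\<^bsub>R\<^esub> y) = \<phi> u" by blast
      then show "x \<ominus>\<^bsub>R\<^esub> y \<in> P" using eq_iff[of "x \<ominus>\<^bsub>R\<^esub> y" u] xy sub by auto
    qed simp
    ultimately show "P +>\<^bsub>R\<^esub> x = P +>\<^bsub>R\<^esub> y \<longleftrightarrow> \<phi> ` P +>\<^bsub>S\<^esub> \<phi> x = \<phi> ` P +>\<^bsub>S\<^esub> \<phi> y"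
      using R.quotient_eq_iff_same_a_r_cos[OF I xy]
        S.quotient_eq_iff_same_a_r_cos[OF I' closed[OF xy(1)] closed[OF xy(2)]] by simp
  qed (use surj in auto)
  then show "euler_factor (card (carrier (R Quot P))) = euler_factor (card (carrier (S Quot (\<phi> ` P))))"
    by simp
qed

text \<open>Replacing a product in \<open>R\<close> by the product of the images changes the value
  of \<open>f\<close> by a multiple of \<open>N\<close>, which is invisible modulo
  \<open>q\<close>.\<close>

lemma nondegenerate_mod_transfer:
  assumes q: "q dvd N" and f: "nondegenerate_mod S q f"
  shows "nondegenerate_mod R q (\<lambda>x. f (\<phi> x))"
proof -
  have add_f: "additive_mod S 0 f" using f by (simp add: nondegenerate_mod_def)
  show ?thesis
    unfolding nondegenerate_mod_def
  proof (intro conjI ballI impI)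
    show "additive_mod R 0 (\<lambda>x. f (\<phi> x))"
      using add_f by (simp add: additive_mod_def add)
    fix x assume x: "x \<in> carrier R" "\<forall>y\<in>carrier R. int q dvd f (\<phi> (x \<otimes>\<^bsub>R\<^esub> y))"
    have "int q dvd f (\<phi> x \<otimes>\<^bsub>S\<^esub> y)" if y: "y \<in> carrier S" for y
    proof -
      obtain w where w: "w \<in> carrier R" "y = \<phi> w" using y surj by blast
      obtain z where z: "z \<in> carrier S" "\<phi> (x \<otimes>\<^bsub>R\<^esub> w) = \<phi> x \<otimes>\<^bsub>S\<^esub> y \<oplus>\<^bsub>S\<^esub> [N] \<cdot>\<^bsub>S\<^esub> z"
        using mult[OF x(1) w(1)] w by blast
      have "f (\<phi> (x \<otimes>\<^bsub>R\<^esub> w)) = f (\<phi> x \<otimes>\<^bsub>S\<^esub> y) + int N * f z"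
        unfolding z(2) using x y z by (simp add: S.additive_simps[OF add_f])
      moreover have "int q dvd int N * f z" using q by simp
      moreover have "int q dvd f (\<phi> (x \<otimes>\<^bsub>R\<^esub> w))" using x w by blast
      ultimately show ?thesis by (simp add: dvd_add_left_iff)
    qed
    then have "\<phi> x \<in> nat_ideal S q" using f x by (simp add: nondegenerate_mod_def)
    then obtain u where "u \<in> nat_ideal R q" "\<phi> x = \<phi> u" using nat_ideal_image by blast
    moreover from this have "u \<in> carrier R" by (auto simp: R.nat_ideal_eq)
    ultimately show "x \<in> nat_ideal R q" using eq_iff x(1) by metis
  qed
qed

text \<open>The two completions need not be isomorphic; the criterion
  \<open>gorenstein_at_iff\<close> replaces them by conditions modulo \<open>q\<close>.\<close>

lemma gorenstein_at_cong:
  assumes q: "q dvd N" "q > 0" and "cring_coords R v m" "cring_coords S v' m'"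
  shows "gorenstein_at R q \<longleftrightarrow> gorenstein_at S q"
proof -
  interpret inv: congruent_rings S R N "inv_into (carrier R) \<phi>" by (rule congruent_inverse)
  show ?thesis
    using cring_coords.gorenstein_at_iff[OF assms(3) q(2)]
      cring_coords.gorenstein_at_iff[OF assms(4) q(2)]
      nondegenerate_mod_transfer[OF q(1)] inv.nondegenerate_mod_transfer[OF q(1)] by blast
qed

lemma a_coeff_cong:
  assumes "d dvd N" "cring_coords R v m" "cring_coords S v' m'"
  shows "a_coeff R d = a_coeff S d"
proof -
  have "gorenstein_at R q \<longleftrightarrow> gorenstein_at S q" if "Factorial_Ring.prime q" "q dvd d" for q
    using gorenstein_at_cong[of q v m v' m'] assms that dvd_trans prime_gt_0_nat by blast
  then show ?thesis unfolding a_coeff_def by auto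
qed

text \<open>The product in \<open>W_coeff\<close> also involves primes not dividing
  \<open>N\<close>, where the rings are unrelated. A coefficient at \<open>k dvd n\<close> is either
  at a multiple of \<open>q\<close>, which forces \<open>q dvd N\<close>, or is given for both rings
  by \<open>local_L_coprime\<close>.\<close>

lemma W_coeff_cong:
  assumes n: "n dvd N" "n > 0" and coords: "cring_coords R v m" "cring_coords S v' m'"
  shows "W_coeff R n = W_coeff S n"
  unfolding W_coeff_def
proof (rule dirichlet_prod_cong)
  fix q k assume "q \<in> {q. Factorial_Ring.prime q \<and> q \<le> n}" and k: "k dvd n"
  then have q: "Factorial_Ring.prime q" by simp
  show "local_L R q k = local_L S q k"
  proof (cases "q dvd k")
    case True
    then have "q dvd N" using dvd_trans[OF k n(1)] by (rule dvd_trans)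
    then show ?thesis by (simp add: local_L_def dirichlet_mult_def local_zeta_cong)
  next
    case False
    moreover have "k > 0" using k n by (metis dvd_pos_nat)
    ultimately show ?thesis using q coords by (simp add: cring_coords.local_L_coprime)
  qed
qed

end

section \<open>Coordinates of lattices\<close>

definition additive_subset :: "'a::ring_1 set \<Rightarrow> bool" where
  "additive_subset L \<longleftrightarrow> 0 \<in> L \<and> (\<forall>x\<in>L. \<forall>y\<in>L. x + y \<in> L) \<and> (\<forall>x\<in>L. - x \<in> L)"

lemma additive_subset_of_int_mult:
  assumes L: "additive_subset L" and x: "x \<in> L"
  shows "of_int k * x \<in> L"
proof -
  have nat: "of_nat n * x \<in> L" for n
    by (induction n) (use L x in \<open>auto simp: additive_subset_def distrib_right\<close>)
  show ?thesis
  proof (cases "k \<ge> 0")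
    case True
    then show ?thesis using nat[of "nat k"] by (simp add: of_nat_nat)
  next
    case False
    then have "of_int k * x = - (of_nat (nat (- k)) * x)" by (simp add: of_nat_nat)
    then show ?thesis using nat L by (simp add: additive_subset_def)
  qed
qed

lemma additive_subset_diff:
  assumes "additive_subset L" "x \<in> L" "y \<in> L"
  shows "x - y \<in> L"
proof -
  have "x + - y \<in> L" using assms unfolding additive_subset_def by blast
  then show ?thesis by simp
qed

definition lattice_coords :: "'a::ring_1 set \<Rightarrow> ('a \<Rightarrow> nat \<Rightarrow> int) \<Rightarrow> nat \<Rightarrow> bool" where
  "lattice_coords L v m \<longleftrightarrow> bij_betw v L {c. \<forall>i\<ge>m. c i = 0} \<and>
     (\<forall>x\<in>L. \<forall>y\<in>L. \<forall>i. v (x + y) i = v x i + v y i)"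

text \<open>The values of \<open>\<rho>\<close> on \<open>L\<close> are the multiples of the least
  positive one, attained at \<open>h\<close>. So \<open>L\<close> is the direct sum of the kernel of
  \<open>\<rho>\<close> and the multiples of \<open>h\<close>, which supply the new
  coordinate.\<close>

lemma lattice_coords_extend:
  fixes \<rho> :: "'a::ring_1 \<Rightarrow> int"
  assumes L: "additive_subset L"
    and \<rho>: "\<And>x y. x \<in> L \<Longrightarrow> y \<in> L \<Longrightarrow> \<rho> (x + y) = \<rho> x + \<rho> y"
    and nonzero: "z \<in> L" "\<rho> z \<noteq> 0"
    and coords: "lattice_coords {x \<in> L. \<rho> x = 0} v m"
  shows "\<exists>v. lattice_coords L v (Suc m)"
proof -
  have \<rho>_diff: "\<rho> (x - y) = \<rho> x - \<rho> y" if "x \<in> L" "y \<in> L" for x y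
    using \<rho>[of "x - y" y] additive_subset_diff[OF L that] that by simp
  have \<rho>_neg: "\<rho> (- x) = - \<rho> x" if "x \<in> L" for x
    using \<rho>_diff[of x x] \<rho>_diff[of "x - x" x] additive_subset_diff[OF L that that] that by simp
  have \<rho>_nat: "\<rho> (of_nat n * x) = int n * \<rho> x" if "x \<in> L" for n x
  proof (induction n)
    case 0
    then show ?case using \<rho>_diff[of x x] that by simp
  next
    case (Suc n)
    then show ?case
      using \<rho>[of x "of_nat n * x"] that additive_subset_of_int_mult[OF L that, of "int n"]
      by (simp add: distrib_right)
  qed
  have \<rho>_mult: "\<rho> (of_int k * x) = k * \<rho> x" if x: "x \<in> L" for k x
  proof (cases "k \<ge> 0")
    case True
    then show ?thesis using \<rho>_nat[OF x, of "nat k"] by (simp add: of_nat_nat)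
  next
    case False
    then show ?thesis
      using \<rho>_nat[OF x, of "nat (- k)"] \<rho>_neg[of "of_nat (nat (- k)) * x"]
        additive_subset_of_int_mult[OF L x, of "- k"]
      by (simp add: of_nat_nat)
  qed
  define P where "P x \<longleftrightarrow> x \<in> L \<and> \<rho> x > 0" for x
  have "P z \<or> P (- z)"
    using nonzero L \<rho>_neg[of z] by (auto simp: P_def additive_subset_def)
  then obtain h where h: "P h" "\<And>y. P y \<Longrightarrow> nat (\<rho> h) \<le> nat (\<rho> y)"
    using ex_has_least_nat[of P _ "\<lambda>x. nat (\<rho> x)"] by metis
  define g where "g = \<rho> h"
  have g: "g > 0" "h \<in> L" using h(1) by (auto simp: P_def g_def)
  define red where "red x = x - of_int (\<rho> x div g) * h" for x
  have red_L: "red x \<in> L" if "x \<in> L" for x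
    unfolding red_def using additive_subset_diff[OF L that] additive_subset_of_int_mult[OF L g(2)] by blast
  have \<rho>_red_mod: "\<rho> (red x) = \<rho> x mod g" if "x \<in> L" for x
    unfolding red_def using that additive_subset_of_int_mult[OF L g(2)] \<rho>_mult[OF g(2)]
    by (simp add: \<rho>_diff g_def minus_div_mult_eq_mod)
  \<comment> \<open>Otherwise the remainder of \<open>\<rho> x\<close> modulo \<open>g\<close> would
    be a positive value of \<open>\<rho>\<close> below the least one.\<close>
  have \<rho>_red: "\<rho> (red x) = 0" if "x \<in> L" for x
  proof (rule ccontr)
    assume "\<rho> (red x) \<noteq> 0"
    then have "P (red x)" "\<rho> (red x) < g"
      using g red_L[OF that] \<rho>_red_mod[OF that] pos_mod_sign[of g "\<rho> x"] pos_mod_bound[of g "\<rho> x"]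
      by (auto simp: P_def)
    then show False using h(2)[of "red x"] by (auto simp: P_def g_def)
  qed
  then have dvd: "\<rho> x = g * (\<rho> x div g)" if "x \<in> L" for x
    using \<rho>_red_mod[OF that] that by (metis dvd_mult_div_cancel mod_0_imp_dvd)
  let ?L0 = "{x \<in> L. \<rho> x = 0}"
  have v: "bij_betw v ?L0 {c. \<forall>i\<ge>m. c i = 0}"
    and v_add: "\<And>x y i. x \<in> ?L0 \<Longrightarrow> y \<in> ?L0 \<Longrightarrow> v (x + y) i = v x i + v y i"
    using coords by (auto simp: lattice_coords_def)
  define w where "w x = (\<lambda>i. if i = m then \<rho> x div g else v (red x) i)" for x
  have v_out: "v x i = 0" if "x \<in> ?L0" "i \<ge> m" for x i
    using v that by (auto simp: bij_betw_def)
  have "lattice_coords L w (Suc m)"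
    unfolding lattice_coords_def bij_betw_def
  proof (intro conjI ballI allI)
    show "inj_on w L"
    proof (rule inj_onI)
      fix x y assume xy: "x \<in> L" "y \<in> L" "w x = w y"
      have q: "\<rho> x div g = \<rho> y div g" using fun_cong[OF xy(3), of m] by (simp add: w_def)
      have red: "red x \<in> ?L0" "red y \<in> ?L0" using xy red_L \<rho>_red by auto
      have "v (red x) i = v (red y) i" for i
        using fun_cong[OF xy(3), of i] v_out[OF red(1), of i] v_out[OF red(2), of i]
        by (cases "i = m") (auto simp: w_def)
      then have "v (red x) = v (red y)" by blast
      then have "red x = red y" using red v unfolding bij_betw_def by (blast dest: inj_onD)
      then show "x = y" using q by (simp add: red_def)
    qed
    show "w ` L = {c. \<forall>i\<ge>Suc m. c i = 0}"
    proof (intro equalityI subsetI)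
      fix c assume "c \<in> w ` L"
      then obtain x where x: "x \<in> L" "c = w x" by blast
      have "red x \<in> ?L0" using x red_L \<rho>_red by auto
      then show "c \<in> {c. \<forall>i\<ge>Suc m. c i = 0}" using x v_out by (auto simp: w_def)
    next
      fix c :: "nat \<Rightarrow> int" assume c: "c \<in> {c. \<forall>i\<ge>Suc m. c i = 0}"
      have "(\<lambda>i. if i < m then c i else 0) \<in> v ` ?L0" using v by (auto simp: bij_betw_def)
      then obtain x0 where x0: "x0 \<in> L" "\<rho> x0 = 0" "v x0 = (\<lambda>i. if i < m then c i else 0)" by auto
      let ?x = "x0 + of_int (c m) * h"
      have kh: "of_int (c m) * h \<in> L" using additive_subset_of_int_mult[OF L g(2)] .
      then have x: "?x \<in> L" using L x0 by (simp add: additive_subset_def)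
      have rx: "\<rho> ?x div g = c m" using \<rho>[OF x0(1) kh] \<rho>_mult[OF g(2)] x0 g by (simp add: g_def)
      then have "red ?x = x0" by (simp add: red_def)
      then have "w ?x = c" using rx x0 c by (auto simp: w_def fun_eq_iff)
      then show "c \<in> w ` L" using imageI[OF x, of w] by simp
    qed
    fix x y i assume xy: "x \<in> L" "y \<in> L"
    have "\<rho> (x + y) = g * (\<rho> x div g + \<rho> y div g)"
      using \<rho>[OF xy] dvd[OF xy(1)] dvd[OF xy(2)] unfolding distrib_left by linarith
    then have q: "\<rho> (x + y) div g = \<rho> x div g + \<rho> y div g" using g(1) by simp
    then have "red (x + y) = red x + red y" by (simp add: red_def algebra_simps)
    then show "w (x + y) i = w x i + w y i"
      using q v_add[of "red x" "red y" i] xy red_L \<rho>_red by (auto simp: w_def)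
  qed
  then show ?thesis by blast
qed

text \<open>Induction on the number of coefficients, with the top coefficient as the functional to
  split off. The common denominator \<open>f\<close> keeps its values discrete, and the monomials in
  \<open>L\<close> make it nonzero, so that the rank is exactly \<open>n\<close>.\<close>

lemma lattice_coords_poly:
  fixes L :: "rat poly set"
  assumes "f > 0"
    and "additive_subset L" "\<And>p i. p \<in> L \<Longrightarrow> of_nat f * coeff p i \<in> \<int>"
    and "\<And>p i. p \<in> L \<Longrightarrow> i \<ge> n \<Longrightarrow> coeff p i = 0" "\<And>i. i < n \<Longrightarrow> monom 1 i \<in> L"
  shows "\<exists>v. lattice_coords L v n"
  using assms(2-)
proof (induction n arbitrary: L)
  case 0
  have "L = {0}" using 0 by (auto simp: additive_subset_def intro!: poly_eqI)
  moreover have "{c :: nat \<Rightarrow> int. \<forall>i\<ge>0. c i = 0} = {\<lambda>_. 0}" by auto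
  ultimately have "lattice_coords L (\<lambda>_ _. 0) 0" by (simp add: lattice_coords_def bij_betw_def)
  then show ?case by blast
next
  case (Suc n)
  \<comment> \<open>On \<open>L\<close> the argument of the floor is already an integer; the floor
    only converts its type.\<close>
  define \<rho> where "\<rho> p = \<lfloor>of_nat f * coeff p n\<rfloor>" for p :: "rat poly"
  have \<rho>: "of_int (\<rho> p) = of_nat f * coeff p n" if "p \<in> L" for p
    unfolding \<rho>_def using Suc.prems(2)[OF that] by (metis floor_of_int Ints_cases)
  have \<rho>_zero: "\<rho> p = 0 \<longleftrightarrow> coeff p n = 0" if "p \<in> L" for p
    using \<rho>[OF that] assms(1) by (metis mult_eq_0_iff of_int_eq_0_iff of_nat_0_eq_iff less_irrefl)
  have add: "\<rho> (p + p') = \<rho> p + \<rho> p'" if "p \<in> L" "p' \<in> L" for p p'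
  proof -
    have "p + p' \<in> L" using that Suc.prems(1) by (simp add: additive_subset_def)
    then have "of_int (\<rho> (p + p')) = (of_int (\<rho> p + \<rho> p') :: rat)"
      using \<rho> that by (simp add: distrib_left)
    then show ?thesis using of_int_eq_iff by blast
  qed
  have ker: "{p \<in> L. \<rho> p = 0} = {p \<in> L. coeff p n = 0}" using \<rho>_zero by blast
  have "\<exists>v. lattice_coords {p \<in> L. \<rho> p = 0} v n"
    unfolding ker
  proof (rule Suc.IH)
    show "additive_subset {p \<in> L. coeff p n = 0}"
      using Suc.prems(1) by (auto simp: additive_subset_def)
    show "coeff p i = 0" if "p \<in> {p \<in> L. coeff p n = 0}" "i \<ge> n" for p i
      using that Suc.prems(3)[of p i] by (cases "i = n") auto
    show "monom 1 i \<in> {p \<in> L. coeff p n = 0}" if "i < n" for i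
      using that Suc.prems(4)[of i] by auto
  qed (use Suc.prems in auto)
  then obtain v where "lattice_coords {p \<in> L. \<rho> p = 0} v n" by blast
  moreover have "monom 1 n \<in> L" "\<rho> (monom 1 n) \<noteq> 0"
    using Suc.prems(4)[of n] \<rho>_zero[of "monom 1 n"] by auto
  ultimately show ?case using lattice_coords_extend[OF Suc.prems(1) add] by blast
qed

section \<open>Reduction modulo congruent cubics\<close>

abbreviation rpoly :: "int poly \<Rightarrow> rat poly" where
  "rpoly \<equiv> map_poly of_int"

lemma rpoly_simps:
  "coeff (rpoly g) i = of_int (coeff g i)"
  "rpoly (g + h) = rpoly g + rpoly h" "rpoly (g * h) = rpoly g * rpoly h"
  "degree (rpoly g) = degree g"
proof -
  show c: "coeff (rpoly g) i = of_int (coeff g i)" for g i by (simp add: coeff_map_poly)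
  show "rpoly (g + h) = rpoly g + rpoly h" by (rule poly_eqI) (simp add: c)
  show "rpoly (g * h) = rpoly g * rpoly h" by (rule poly_eqI) (simp add: c coeff_mult)
  show "degree (rpoly g) = degree g" by (rule degree_map_poly) simp
qed

text \<open>Pseudo-division multiplies the dividend by a power of the leading coefficient, here 1,
  so it is true division and the rational remainder is integral.\<close>

lemma rpoly_mod_monic:
  assumes "lead_coeff F = 1" "degree F > 0"
  obtains q r where "w = F * q + r" "degree r < degree F" "rpoly w mod rpoly F = rpoly r"
proof -
  obtain q r where qr: "pseudo_divmod w F = (q, r)" by fastforce
  have F: "F \<noteq> 0" using assms by auto
  have w: "w = F * q + r" using pseudo_divmod(1)[OF F qr] assms(1) by simp
  have r: "degree r < degree F" using pseudo_divmod(2)[OF F qr] assms(2) by auto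
  have "rpoly w mod rpoly F = rpoly r mod rpoly F" by (simp add: w rpoly_simps)
  also have "\<dots> = rpoly r" using r by (intro mod_poly_less) (simp add: rpoly_simps)
  finally show thesis using that w r by blast
qed

text \<open>The lattice Z + Z X + Z X^2 of normal forms of the cubic order, the same for all
  (a,b).\<close>

definition int_quadratics :: "rat poly set" where
  "int_quadratics = {p. degree p < 3 \<and> (\<forall>i. coeff p i \<in> \<int>)}"

lemma int_polyE:
  assumes "\<forall>i. coeff p i \<in> (\<int> :: rat set)"
  obtains g where "p = rpoly g" "degree g = degree p"
proof -
  have "p = rpoly (map_poly floor p)"
    by (rule poly_eqI) (use assms in \<open>auto simp: coeff_map_poly elim: Ints_cases\<close>)
  then show thesis using that rpoly_simps(4) by metis
qed

lemma int_quadratics_iff: "p \<in> int_quadratics \<longleftrightarrow> (\<exists>g. p = rpoly g \<and> degree g < 3)"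
proof
  assume "p \<in> int_quadratics"
  then have "degree p < 3" "\<forall>i. coeff p i \<in> \<int>" by (simp_all add: int_quadratics_def)
  then show "\<exists>g. p = rpoly g \<and> degree g < 3" by (metis int_polyE)
qed (auto simp: int_quadratics_def rpoly_simps)

lemma additive_int_quadratics: "additive_subset int_quadratics"
  by (simp add: additive_subset_def int_quadratics_def degree_add_less)

text \<open>With the integral polynomials u = f p and u' = f p', division by \<open>F\<close> gives
  u u' = F q + r = F' q + r + N f^2 D q. Here \<open>r\<close> is already reduced, so modulo
  \<open>F'\<close> only D q changes, to an integral remainder \<open>r'\<close>. Dividing by f^2
  removes the denominators and leaves the difference N r'.\<close>

lemma reduction_congruence:
  fixes N f :: nat
  assumes F: "lead_coeff F = 1" "degree F = 3" and F': "lead_coeff F' = 1" "degree F' = 3"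
    and D: "F = F' + smult (int (N * f\<^sup>2)) D" and f: "f > 0"
    and p: "\<forall>i. of_nat f * coeff p i \<in> \<int>" and p': "\<forall>i. of_nat f * coeff p' i \<in> \<int>"
  shows "\<exists>w\<in>int_quadratics. (p * p') mod rpoly F = (p * p') mod rpoly F' + smult (of_nat N) w"
proof -
  obtain u where u: "smult (of_nat f) p = rpoly u" using p by (elim int_polyE[of "smult (of_nat f) p", simplified])
  obtain u' where u': "smult (of_nat f) p' = rpoly u'" using p' by (elim int_polyE[of "smult (of_nat f) p'", simplified])
  obtain q r where qr: "u * u' = F * q + r" "degree r < 3" "rpoly (u * u') mod rpoly F = rpoly r"
    using rpoly_mod_monic[of F "u * u'"] F by auto
  obtain q' r' where qr': "D * q = F' * q' + r'" "degree r' < 3" "rpoly (D * q) mod rpoly F' = rpoly r'"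
    using rpoly_mod_monic[of F' "D * q"] F' by auto
  define n :: rat where "n = of_nat (N * f\<^sup>2)"
  have n: "rpoly (smult (int (N * f\<^sup>2)) g) = smult n (rpoly g)" for g
    by (rule poly_eqI) (simp add: coeff_map_poly n_def)
  have "u * u' = F' * q + r + smult (int (N * f\<^sup>2)) (D * q)"
    unfolding qr(1) D by (simp add: algebra_simps)
  then have "rpoly (u * u') = rpoly F' * rpoly q + rpoly r + smult n (rpoly (D * q))"
    by (simp only: rpoly_simps n)
  then have "rpoly (u * u') mod rpoly F' = rpoly r mod rpoly F' + smult n (rpoly r')"
    by (simp add: poly_mod_add_left mod_smult_left flip: qr'(3))
  also have "rpoly r mod rpoly F' = rpoly r"
    using qr(2) F' by (intro mod_poly_less) (simp add: rpoly_simps)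
  finally have eq: "rpoly (u * u') mod rpoly F' = rpoly (u * u') mod rpoly F + smult n (rpoly r')"
    using qr(3) by simp
  have f2: "(of_nat f)\<^sup>2 \<noteq> (0::rat)" using f by simp
  have uu: "rpoly (u * u') = smult ((of_nat f)\<^sup>2) (p * p')"
    by (simp add: rpoly_simps power2_eq_square flip: u u')
  have "smult ((of_nat f)\<^sup>2) ((p * p') mod rpoly F') =
      smult ((of_nat f)\<^sup>2) ((p * p') mod rpoly F + smult (of_nat N) (rpoly r'))"
    using eq unfolding uu by (simp add: mod_smult_left smult_add_right n_def mult.commute)
  then have "(p * p') mod rpoly F' = (p * p') mod rpoly F + smult (of_nat N) (rpoly r')"
    using f2 by (metis smult_cancel)
  then have "(p * p') mod rpoly F = (p * p') mod rpoly F' + smult (of_nat N) (- rpoly r')" by simp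
  moreover have "- rpoly r' \<in> int_quadratics"
    using additive_int_quadratics qr'(2) int_quadratics_iff unfolding additive_subset_def by blast
  ultimately show ?thesis by blast
qed

section \<open>Overorders as lattices\<close>

lemma rat_poly_ring_simps:
  "carrier rat_poly_ring = UNIV" "x \<otimes>\<^bsub>rat_poly_ring\<^esub> y = x * y"
  "x \<oplus>\<^bsub>rat_poly_ring\<^esub> y = x + y" "\<one>\<^bsub>rat_poly_ring\<^esub> = 1" "\<zero>\<^bsub>rat_poly_ring\<^esub> = 0"
  by (simp_all add: rat_poly_ring_def)

lemma rat_poly_cring: "cring rat_poly_ring"
proof (rule cringI)
  show "abelian_group rat_poly_ring"
    by (rule abelian_groupI) (auto simp: rat_poly_ring_simps intro: exI[of _ "- x" for x])
  show "Group.comm_monoid rat_poly_ring"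
    by (rule comm_monoidI) (auto simp: rat_poly_ring_simps)
qed (simp add: rat_poly_ring_simps distrib_right)

lemma rat_poly_ring_minus: "x \<ominus>\<^bsub>rat_poly_ring\<^esub> y = x - y"
proof -
  interpret cring rat_poly_ring by (rule rat_poly_cring)
  have "\<ominus>\<^bsub>rat_poly_ring\<^esub> y = - y"
    by (rule minus_equality) (simp_all add: rat_poly_ring_simps)
  then show ?thesis by (simp add: a_minus_def rat_poly_ring_simps)
qed

definition int_coset :: "rat poly \<Rightarrow> rat poly set" where
  "int_coset p = {p'. p' - p \<in> int_quadratics}"

lemma degree_lt_3_diff: "degree (p - p') < 3" if "degree p < 3" "degree p' < 3" for p p' :: "rat poly"
  using that by (rule degree_diff_less)

lemma int_coset_subset: "degree p < 3 \<Longrightarrow> int_coset p \<subseteq> {p. degree p < 3}"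
proof
  fix p' assume "degree p < 3" "p' \<in> int_coset p"
  then have "degree (p' - p + p) < 3"
    unfolding int_coset_def int_quadratics_def by (intro degree_add_less) auto
  then show "p' \<in> {p. degree p < 3}" by simp
qed

lemma int_coset_eq: "int_coset p = {q + p | q. q \<in> int_quadratics}"
  by (auto simp: int_coset_def) (metis diff_add_cancel)

text \<open>These lattices represent the overorders of index \<open>f\<close>; only the closure under multiplication
  involves the cubic \<open>F\<close>.\<close>

definition order_lattices :: "rat poly \<Rightarrow> nat \<Rightarrow> rat poly set set" where
  "order_lattices F f = {L. L \<subseteq> {p. degree p < 3} \<and> additive_subset L \<and> int_quadratics \<subseteq> L \<and>
     (\<forall>p\<in>L. \<forall>p'\<in>L. (p * p') mod F \<in> L) \<and> card (int_coset ` L) = f}"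

text \<open>The order of the quotient group of \<open>L\<close> by \<open>int_quadratics\<close>
  annihilates it. For infinite index \<open>card\<close> is 0 and the claim is trivial.\<close>

lemma index_mult_lattice:
  assumes L: "additive_subset L" "int_quadratics \<subseteq> L" and p: "p \<in> L"
  shows "of_nat (card (int_coset ` L)) * p \<in> int_quadratics"
proof -
  define G where "G = \<lparr>carrier = L, monoid.mult = (+), one = (0 :: rat poly)\<rparr>"
  have G: "comm_group G"
  proof (rule comm_groupI)
    fix x assume "x \<in> carrier G"
    then have "- x \<in> carrier G" using L(1) by (simp add: G_def additive_subset_def)
    then show "\<exists>y\<in>carrier G. y \<otimes>\<^bsub>G\<^esub> x = \<one>\<^bsub>G\<^esub>"
      by (intro bexI[of _ "- x"]) (simp_all add: G_def)
  qed (use L(1) in \<open>auto simp: G_def additive_subset_def\<close>)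
  interpret G: comm_group G by (rule G)
  have inv: "inv\<^bsub>G\<^esub> x = - x" if "x \<in> L" for x
    by (rule G.inv_equality) (use that L(1) in \<open>auto simp: G_def additive_subset_def\<close>)
  have "subgroup int_quadratics G"
  proof (rule G.subgroupI)
    show "int_quadratics \<noteq> {}" using additive_int_quadratics by (auto simp: additive_subset_def)
  qed (use L additive_int_quadratics inv in \<open>auto simp: G_def additive_subset_def\<close>)
  then have normal: "normal int_quadratics G" by (rule G.subgroup_imp_normal)
  interpret normal int_quadratics G by (rule normal)
  interpret Q: group "G Mod int_quadratics" by (rule factorgroup_is_group)
  have coset: "int_quadratics #>\<^bsub>G\<^esub> x = int_coset x" for x
    by (auto simp: r_coset_def int_coset_eq G_def)
  have carrier: "carrier (G Mod int_quadratics) = int_coset ` L"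
    by (auto simp: FactGroup_def RCOSETS_def coset) (auto simp: G_def)
  have mult: "of_nat n * p \<in> L" for n
    using additive_subset_of_int_mult[OF L(1) p, of "int n"] by simp
  have pow: "int_coset p [^]\<^bsub>G Mod int_quadratics\<^esub> n = int_coset (of_nat n * p)" for n :: nat
  proof (induction n)
    case 0
    have "int_coset 0 = int_quadratics" by (simp add: int_coset_def)
    then show ?case by (simp add: FactGroup_def)
  next
    case (Suc n)
    have "of_nat n * p \<in> carrier G" "p \<in> carrier G" using mult[of n] p by (simp_all add: G_def)
    then have "int_coset (of_nat n * p) <#>\<^bsub>G\<^esub> int_coset p = int_coset (of_nat n * p \<otimes>\<^bsub>G\<^esub> p)"
      using rcos_sum[of "of_nat n * p" p] unfolding coset by blast
    moreover have "of_nat n * p \<otimes>\<^bsub>G\<^esub> p = of_nat n * p + p" by (simp add: G_def)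
    ultimately have "int_coset (of_nat n * p) <#>\<^bsub>G\<^esub> int_coset p = int_coset (of_nat n * p + p)"
      by simp
    then show ?case using Suc by (simp add: distrib_right add.commute)
  qed
  have "int_coset p [^]\<^bsub>G Mod int_quadratics\<^esub> Coset.order (G Mod int_quadratics) =
      \<one>\<^bsub>G Mod int_quadratics\<^esub>"
    by (rule Q.pow_order_eq_1) (use p carrier in auto)
  then have "int_coset (of_nat (card (int_coset ` L)) * p) = int_quadratics"
    unfolding pow Coset.order_def carrier by (simp only: FactGroup_def monoid.select_convs)
  moreover have "q \<in> int_coset q" for q
    using additive_int_quadratics by (simp add: int_coset_def additive_subset_def)
  ultimately show ?thesis by blast
qed

lemma order_lattices_coeff:
  assumes "L \<in> order_lattices F f" "p \<in> L"
  shows "of_nat f * coeff p i \<in> \<int>"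
proof -
  have "of_nat f * p \<in> int_quadratics"
    using assms index_mult_lattice by (auto simp: order_lattices_def)
  then have "coeff (of_nat f * p) i \<in> \<int>" by (simp add: int_quadratics_def)
  then show ?thesis by (simp add: of_nat_poly)
qed

text \<open>Such a lattice lies between \<open>int_quadratics\<close> and 1/f times it.
  \<open>T\<close> holds the f^3 reduced representatives of the cosets in between, and the lattice
  is determined by those it contains.\<close>

lemma finite_order_lattices:
  assumes f: "f > 0"
  shows "finite (order_lattices F f)"
proof -
  define T where "T = (\<lambda>(x, y, z). smult (1 / of_nat f) (rpoly [:x, y, z:])) `
    ({0..<int f} \<times> {0..<int f} \<times> {0..<int f})"
  have T: "finite T" by (simp add: T_def)
  have cover: "\<exists>t\<in>T. p - t \<in> int_quadratics" if L: "L \<in> order_lattices F f" and p: "p \<in> L" for L p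
  proof -
    have deg: "degree p < 3" using L p by (auto simp: order_lattices_def)
    have "\<forall>i. coeff (smult (of_nat f) p) i \<in> \<int>" using order_lattices_coeff[OF L p] by simp
    then obtain u where u: "smult (of_nat f) p = rpoly u" by (elim int_polyE)
    have uc: "of_nat f * coeff p i = of_int (coeff u i)" for i
      using arg_cong[OF u, of "\<lambda>p. coeff p i"] by (simp add: rpoly_simps)
    let ?r = "\<lambda>i. coeff u i mod int f"
    define t where "t = smult (1 / of_nat f) (rpoly [:?r 0, ?r 1, ?r 2:])"
    have "t \<in> T"
      unfolding T_def t_def using f by (intro image_eqI[of _ _ "(?r 0, ?r 1, ?r 2)"]) auto
    moreover have "p - t \<in> int_quadratics"
    proof -
      have t_deg: "degree t < 3" unfolding t_def by (simp add: rpoly_simps)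
      have "coeff (p - t) i \<in> \<int>" for i
      proof (cases "i < 3")
        case True
        then have "i = 0 \<or> i = 1 \<or> i = 2" by auto
        then have "coeff t i = of_int (?r i) / of_nat f"
          unfolding t_def by (auto simp: rpoly_simps numeral_2_eq_2)
        then have "coeff (p - t) i = (of_int (coeff u i) - of_int (?r i)) / of_nat f"
          using uc[of i] f by (simp add: field_simps)
        also have "of_int (coeff u i) - of_int (?r i) = (of_nat f * of_int (coeff u i div int f) :: rat)"
          by (metis minus_mod_eq_mult_div of_int_diff of_int_mult of_int_of_nat_eq)
        also have "\<dots> / of_nat f = of_int (coeff u i div int f)" using f by simp
        finally show ?thesis by simp
      next
        case False
        then show ?thesis using deg t_deg by (simp add: coeff_eq_0)
      qed
      then show ?thesis using degree_lt_3_diff[OF deg t_deg] by (simp add: int_quadratics_def)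
    qed
    ultimately show ?thesis by blast
  qed
  have sub: "L \<subseteq> L'" if L: "L \<in> order_lattices F f" and L': "L' \<in> order_lattices F f"
    and eq: "L \<inter> T = L' \<inter> T" for L L'
  proof
    fix p assume p: "p \<in> L"
    obtain t where t: "t \<in> T" "p - t \<in> int_quadratics" using cover[OF L p] by blast
    have "t \<in> L"
      using additive_subset_diff[of L p "p - t"] L p t(2) by (auto simp: order_lattices_def)
    then have "t \<in> L'" using eq t(1) by auto
    moreover have "p - t \<in> L'" "additive_subset L'" using L' t(2) by (auto simp: order_lattices_def)
    ultimately have "(p - t) + t \<in> L'" unfolding additive_subset_def by blast
    then show "p \<in> L'" by simp
  qed
  have "inj_on (\<lambda>L. L \<inter> T) (order_lattices F f)"
  proof (rule inj_onI)
    fix L L' assume "L \<in> order_lattices F f" "L' \<in> order_lattices F f" "L \<inter> T = L' \<inter> T"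
    then show "L = L'" using sub[of L L'] sub[of L' L] by blast
  qed
  moreover have "(\<lambda>L. L \<inter> T) ` order_lattices F f \<subseteq> Pow T" by blast
  ultimately show ?thesis using T by (meson finite_Pow_iff inj_on_finite)
qed

section \<open>The overorders of one cubic and their normal forms\<close>

locale cubic =
  fixes a b c :: int
begin

abbreviation "F \<equiv> rpoly (cubic_poly a b c)"
abbreviation "A \<equiv> cubic_algebra a b c"

definition cls :: "rat poly \<Rightarrow> rat poly set" where
  "cls p = cubic_ideal a b c +>\<^bsub>rat_poly_ring\<^esub> p"

lemma cubic_poly: "lead_coeff (cubic_poly a b c) = 1" "degree (cubic_poly a b c) = 3"
  by (simp_all add: cubic_poly_def)

lemma degree_F [simp]: "degree F = 3"
  using rpoly_simps(4) cubic_poly(2) by simp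

lemma F_nonzero [simp]: "F \<noteq> 0"
  using degree_F by (metis degree_0 zero_neq_numeral)

lemma cubic_ideal: "ideal (cubic_ideal a b c) rat_poly_ring"
  unfolding cubic_ideal_def
  by (rule cring.cgenideal_ideal[OF rat_poly_cring]) (simp add: rat_poly_ring_simps)

lemma cubic_ideal_iff: "p \<in> cubic_ideal a b c \<longleftrightarrow> F dvd p"
  by (auto simp: cubic_ideal_def cgenideal_def rat_poly_ring_simps dvd_def mult.commute)

lemma cls_eq_iff: "cls p = cls p' \<longleftrightarrow> F dvd p - p'"
  using ring.quotient_eq_iff_same_a_r_cos[OF cring.axioms(1)[OF rat_poly_cring] cubic_ideal, of p p']
  by (simp add: cls_def rat_poly_ring_simps rat_poly_ring_minus cubic_ideal_iff)

lemma cls_mod: "cls (p mod F) = cls p"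
  unfolding cls_eq_iff by (simp add: mod_eq_dvd_iff flip: mod_eq_dvd_iff)

lemma degree_mod_F: "degree (p mod F) < 3"
  using degree_mod_less'[of F p] by (metis F_nonzero degree_F degree_0 zero_less_numeral)

lemma cls_inj:
  assumes "cls p = cls p'" "degree p < 3" "degree p' < 3"
  shows "p = p'"
proof -
  have "F dvd p - p'" "degree (p - p') < 3"
    using assms cls_eq_iff degree_lt_3_diff by auto
  then have "p - p' = 0" using dvd_imp_degree_le[of F "p - p'"] by auto
  then show ?thesis by simp
qed

lemma A_simps:
  "carrier A = range cls" "\<one>\<^bsub>A\<^esub> = cls 1" "\<zero>\<^bsub>A\<^esub> = cls 0"
  "cls p \<otimes>\<^bsub>A\<^esub> cls p' = cls (p * p')" "cls p \<oplus>\<^bsub>A\<^esub> cls p' = cls (p + p')"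
proof -
  interpret I: ideal "cubic_ideal a b c" rat_poly_ring by (rule cubic_ideal)
  show "carrier A = range cls"
    by (simp add: cubic_algebra_def quotient_carrier rat_poly_ring_simps cls_def)
  show "\<one>\<^bsub>A\<^esub> = cls 1"
    by (simp add: cubic_algebra_def FactRing_def cls_def rat_poly_ring_simps)
  show "\<zero>\<^bsub>A\<^esub> = cls 0"
    using I.a_rcos_zero[OF cubic_ideal additive_subgroup.zero_closed[OF ideal.axioms(1)[OF cubic_ideal]]]
    by (simp add: cubic_algebra_def FactRing_def cls_def rat_poly_ring_simps)
  show "cls p \<otimes>\<^bsub>A\<^esub> cls p' = cls (p * p')"
    using I.rcoset_mult_add[of p p']
    by (simp add: cubic_algebra_def FactRing_def cls_def rat_poly_ring_simps)
  show "cls p \<oplus>\<^bsub>A\<^esub> cls p' = cls (p + p')"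
    using I.a_rcos_sum[of p p']
    by (simp add: cubic_algebra_def FactRing_def cls_def rat_poly_ring_simps)
qed

lemma A_cring: "cring A"
  unfolding cubic_algebra_def by (rule ideal.quotient_is_cring[OF cubic_ideal rat_poly_cring])

lemma A_minus: "\<ominus>\<^bsub>A\<^esub> cls p = cls (- p)"
proof -
  interpret cring A by (rule A_cring)
  show ?thesis by (rule minus_equality) (simp_all add: A_simps)
qed

text \<open>Division by the monic integral cubic stays integral, so every class of an integer
  polynomial has an integral normal form.\<close>

lemma cubic_order_eq: "cubic_order a b c = cls ` int_quadratics"
proof -
  have order: "cubic_order a b c = range (\<lambda>g. cls (rpoly g))"
    by (simp add: cubic_order_def cls_def)
  show ?thesis
    unfolding order
  proof (intro equalityI subsetI)
    fix x assume "x \<in> range (\<lambda>g. cls (rpoly g))"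
    then obtain w where w: "x = cls (rpoly w)" by blast
    obtain q r where r: "degree r < degree (cubic_poly a b c)" "rpoly w mod F = rpoly r"
      using rpoly_mod_monic[OF cubic_poly(1), of w] cubic_poly(2) by auto
    have "x = cls (rpoly r)" using w cls_mod r(2) by metis
    moreover have "rpoly r \<in> int_quadratics"
      using r(1) cubic_poly(2) int_quadratics_iff by auto
    ultimately show "x \<in> cls ` int_quadratics" by blast
  next
    fix x assume "x \<in> cls ` int_quadratics"
    then show "x \<in> range (\<lambda>g. cls (rpoly g))" using int_quadratics_iff by auto
  qed
qed

definition lattice_ring :: "rat poly set \<Rightarrow> rat poly set ring" where
  "lattice_ring L = A\<lparr>carrier := cls ` L\<rparr>"

lemma lattice_ring_simps:
  "carrier (lattice_ring L) = cls ` L" "\<one>\<^bsub>lattice_ring L\<^esub> = cls 1" "\<zero>\<^bsub>lattice_ring L\<^esub> = cls 0"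
  "cls p \<otimes>\<^bsub>lattice_ring L\<^esub> cls p' = cls (p * p')"
  "cls p \<oplus>\<^bsub>lattice_ring L\<^esub> cls p' = cls (p + p')"
  by (simp_all add: lattice_ring_def A_simps)

text \<open>Classes are faithfully represented in degree < 3, so cosets of the order can be counted
  there. The result no longer depends on the cubic.\<close>

lemma ring_index_lattice_ring:
  assumes L: "L \<subseteq> {p. degree p < 3}"
  shows "ring_index (lattice_ring L) (cubic_order a b c) = card (int_coset ` L)"
proof -
  have coset: "cubic_order a b c +>\<^bsub>lattice_ring L\<^esub> cls p = cls ` int_coset p" for p
  proof -
    have "cubic_order a b c +>\<^bsub>lattice_ring L\<^esub> cls p = (\<lambda>q. cls (q + p)) ` int_quadratics"
      by (auto simp: a_r_coset_def' cubic_order_eq lattice_ring_simps)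
    also have "\<dots> = cls ` int_coset p" unfolding int_coset_eq by blast
    finally show ?thesis .
  qed
  have inj: "inj_on cls {p. degree p < 3}" by (intro inj_onI) (simp add: cls_inj)
  have "a_rcosets\<^bsub>lattice_ring L\<^esub> (cubic_order a b c) =
      (\<lambda>x. cubic_order a b c +>\<^bsub>lattice_ring L\<^esub> x) ` cls ` L"
    by (auto simp: A_RCOSETS_def' lattice_ring_simps)
  moreover have "card (int_coset ` L) = card ((\<lambda>x. cubic_order a b c +>\<^bsub>lattice_ring L\<^esub> x) ` cls ` L)"
  proof (rule card_image_eq_card_image[where h = cls])
    fix p p' assume "p \<in> L" "p' \<in> L"
    then have sub: "int_coset p \<subseteq> {p. degree p < 3}" "int_coset p' \<subseteq> {p. degree p < 3}"
      using L by (auto intro!: int_coset_subset)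
    show "int_coset p = int_coset p' \<longleftrightarrow>
        cubic_order a b c +>\<^bsub>lattice_ring L\<^esub> cls p = cubic_order a b c +>\<^bsub>lattice_ring L\<^esub> cls p'"
      unfolding coset using inj_on_image_eq_iff[OF inj sub] by simp
  qed auto
  ultimately show ?thesis by (simp add: ring_index_def)
qed

lemma lattice_ring_overorder:
  assumes L: "L \<in> order_lattices F f"
  shows "lattice_ring L \<in> overorders a b c f"
proof -
  interpret A: cring A by (rule A_cring)
  have deg: "L \<subseteq> {p. degree p < 3}" and add: "additive_subset L" and Z: "int_quadratics \<subseteq> L"
    and mult: "\<And>p p'. p \<in> L \<Longrightarrow> p' \<in> L \<Longrightarrow> (p * p') mod F \<in> L" and idx: "card (int_coset ` L) = f"
    using L by (auto simp: order_lattices_def)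
  have "subring (cls ` L) A"
  proof (rule A.subringI)
    have "1 \<in> int_quadratics" by (simp add: int_quadratics_def coeff_1)
    then show "\<one>\<^bsub>A\<^esub> \<in> cls ` L" using Z by (auto simp: A_simps)
    fix x y assume "x \<in> cls ` L" "y \<in> cls ` L"
    then obtain p p' where p: "p \<in> L" "x = cls p" "p' \<in> L" "y = cls p'" by blast
    show "x \<otimes>\<^bsub>A\<^esub> y \<in> cls ` L"
      using mult[OF p(1,3)] cls_mod[of "p * p'"] p by (metis A_simps(4) imageI)
    have "p + p' \<in> L" using add p by (simp add: additive_subset_def)
    then show "x \<oplus>\<^bsub>A\<^esub> y \<in> cls ` L" using p by (auto simp: A_simps)
  next
    fix x assume "x \<in> cls ` L"
    then obtain p where "p \<in> L" "x = cls p" by blast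
    moreover from this have "- p \<in> L" using add by (simp add: additive_subset_def)
    ultimately show "\<ominus>\<^bsub>A\<^esub> x \<in> cls ` L" by (auto simp: A_minus)
  qed (auto simp: A_simps)
  moreover have "cubic_order a b c \<subseteq> cls ` L" using Z by (auto simp: cubic_order_eq)
  ultimately show ?thesis
    using ring_index_lattice_ring[OF deg] idx
    unfolding overorders_def lattice_ring_def by blast
qed

text \<open>The lattice consists of the normal forms of the elements of the overorder.\<close>

lemma overorder_lattice:
  assumes "R \<in> overorders a b c f"
  shows "\<exists>L\<in>order_lattices F f. R = lattice_ring L"
proof -
  interpret A: cring A by (rule A_cring)
  obtain S where S: "R = A\<lparr>carrier := S\<rparr>" "subring S A" "cubic_order a b c \<subseteq> S"
    "ring_index R (cubic_order a b c) = f"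
    using assms by (auto simp: overorders_def)
  define L where "L = {p. degree p < 3 \<and> cls p \<in> S}"
  have "S \<subseteq> cls ` L"
  proof
    fix x assume x: "x \<in> S"
    then obtain p where "x = cls p" using subringE(1)[OF S(2)] by (auto simp: A_simps)
    then have "x = cls (p mod F)" by (simp add: cls_mod)
    then show "x \<in> cls ` L" using x degree_mod_F by (auto simp: L_def)
  qed
  then have SL: "cls ` L = S" by (auto simp: L_def)
  then have R: "R = lattice_ring L" using S(1) by (simp add: lattice_ring_def)
  have deg: "L \<subseteq> {p. degree p < 3}" by (auto simp: L_def)
  have "additive_subset L"
    unfolding additive_subset_def
  proof (intro conjI ballI)
    show "0 \<in> L" using subringE(2)[OF S(2)] by (simp add: L_def A_simps)
    show "p + p' \<in> L" if "p \<in> L" "p' \<in> L" for p p'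
      using that subringE(7)[OF S(2), of "cls p" "cls p'"] by (simp add: L_def A_simps degree_add_less)
    show "- p \<in> L" if "p \<in> L" for p
      using that subringE(5)[OF S(2), of "cls p"] by (simp add: L_def A_minus)
  qed
  moreover have "int_quadratics \<subseteq> L"
    using S(3) by (auto simp: L_def cubic_order_eq int_quadratics_def)
  moreover have "(p * p') mod F \<in> L" if "p \<in> L" "p' \<in> L" for p p'
    using that subringE(6)[OF S(2), of "cls p" "cls p'"]
    by (simp add: L_def A_simps cls_mod degree_mod_F)
  moreover have "card (int_coset ` L) = f"
    using ring_index_lattice_ring[OF deg] S(4) R by simp
  ultimately show ?thesis using deg R by (auto simp: order_lattices_def)
qed

lemma bij_overorders: "bij_betw lattice_ring (order_lattices F f) (overorders a b c f)"
  unfolding bij_betw_def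
proof
  show "inj_on lattice_ring (order_lattices F f)"
  proof (rule inj_onI)
    fix L L' assume L: "L \<in> order_lattices F f" "L' \<in> order_lattices F f" "lattice_ring L = lattice_ring L'"
    then have "cls ` L = cls ` L'" by (metis lattice_ring_simps(1))
    moreover have "L \<subseteq> {p. degree p < 3}" "L' \<subseteq> {p. degree p < 3}"
      using L by (auto simp: order_lattices_def)
    moreover have "inj_on cls {p. degree p < 3}" by (intro inj_onI) (simp add: cls_inj)
    ultimately show "L = L'" using inj_on_image_eq_iff by metis
  qed
  show "lattice_ring ` order_lattices F f = overorders a b c f"
    using lattice_ring_overorder overorder_lattice by blast
qed

definition rep :: "rat poly set \<Rightarrow> rat poly" where
  "rep x = (THE p. degree p < 3 \<and> cls p = x)"

lemma rep_cls: "degree p < 3 \<Longrightarrow> rep (cls p) = p"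
  unfolding rep_def by (rule the_equality) (auto intro: cls_inj)

lemma lattice_ring_cring:
  assumes "L \<in> order_lattices F f"
  shows "cring (lattice_ring L)"
proof -
  interpret A: cring A by (rule A_cring)
  have "lattice_ring L \<in> overorders a b c f" using assms by (rule lattice_ring_overorder)
  then have "subring (cls ` L) A"
    by (auto simp: overorders_def lattice_ring_def)
      (metis partial_object.select_convs(1) partial_object.update_convs(1) partial_object.surjective)
  then show ?thesis
    unfolding lattice_ring_def using A.subcring_iff A.subcringI' subringE(1) by metis
qed

lemma lattice_ring_coords:
  assumes L: "L \<in> order_lattices F f" and f: "f > 0"
  shows "\<exists>v. cring_coords (lattice_ring L) v 3"
proof -
  have deg: "L \<subseteq> {p. degree p < 3}" and add: "additive_subset L" and Z: "int_quadratics \<subseteq> L"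
    using L by (auto simp: order_lattices_def)
  have "\<exists>v. lattice_coords L v 3"
  proof (rule lattice_coords_poly[OF f add order_lattices_coeff[OF L]])
    show "coeff p i = 0" if "p \<in> L" "3 \<le> i" for p i
      using that deg by (intro coeff_eq_0) auto
    show "monom 1 i \<in> L" if "i < 3" for i
      using that Z by (auto simp: int_quadratics_def degree_monom_eq)
  qed
  then obtain v where "lattice_coords L v 3" by blast
  then have v: "bij_betw v L {c. \<forall>i\<ge>3. c i = 0}"
    "\<And>x y i. x \<in> L \<Longrightarrow> y \<in> L \<Longrightarrow> v (x + y) i = v x i + v y i"
    by (auto simp: lattice_coords_def)
  have rep: "rep (cls p) = p" if "p \<in> L" for p using that deg by (intro rep_cls) auto
  have "bij_betw rep (cls ` L) L"
    by (rule bij_betw_byWitness[where f' = cls]) (auto simp: rep)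
  then have "bij_betw (\<lambda>x. v (rep x)) (cls ` L) {c. \<forall>i\<ge>3. c i = 0}"
    using bij_betw_trans[OF _ v(1)] by (simp add: comp_def)
  moreover have "v (rep (x \<oplus>\<^bsub>lattice_ring L\<^esub> y)) i = v (rep x) i + v (rep y) i"
    if "x \<in> cls ` L" "y \<in> cls ` L" for x y i
  proof -
    obtain p p' where "p \<in> L" "x = cls p" "p' \<in> L" "y = cls p'" using \<open>x \<in> _\<close> \<open>y \<in> _\<close> by blast
    moreover from this have "p + p' \<in> L" using add by (simp add: additive_subset_def)
    ultimately show ?thesis using v(2) by (simp add: lattice_ring_simps rep)
  qed
  ultimately have "cring_coords (lattice_ring L) (\<lambda>x. v (rep x)) 3"
    using lattice_ring_cring[OF L]
    by (simp add: cring_coords_def cring_coords_axioms_def lattice_ring_simps)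
  then show ?thesis by blast
qed

lemma lattice_ring_nat_mult:
  "[k] \<cdot>\<^bsub>lattice_ring L\<^esub> cls p = cls (of_nat k * p)" for k :: nat
  by (induction k) (simp_all add: add_pow_def lattice_ring_simps distrib_right add.commute)

end

section \<open>Comparison of two congruent cubics\<close>

locale congruent_cubics = C: cubic a b c + C': cubic a' b' c for a b a' b' c :: int +
  fixes N f :: nat
  assumes f: "f > 0"
    and cong: "[a = a'] (mod int (N * f\<^sup>2))" "[b = b'] (mod int (N * f\<^sup>2))"
begin

lemma sym: "congruent_cubics a' b' a b N f"
  using f cong by unfold_locales (simp_all add: cong_sym)

lemma mod_congruence:
  assumes p: "\<forall>i. of_nat f * coeff p i \<in> \<int>" "\<forall>i. of_nat f * coeff p' i \<in> \<int>"
  shows "\<exists>w\<in>int_quadratics. (p * p') mod C.F = (p * p') mod C'.F + smult (of_nat N) w"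
proof -
  \<comment> \<open>The coefficient of X^2 is \<open>- a\<close>, hence the opposite directions of
    the two equations. The constant terms agree, so the difference polynomial has constant
    coefficient 0.\<close>
  obtain s t where "a' = a + int (N * f\<^sup>2) * s" "b = b' + int (N * f\<^sup>2) * t"
    using cong by (metis cong_iff_lin cong_sym)
  then have "cubic_poly a b c = cubic_poly a' b' c + smult (int (N * f\<^sup>2)) [:0, t, s:]"
    by (simp add: cubic_poly_def)
  then show ?thesis
    by (rule reduction_congruence[OF C.cubic_poly C'.cubic_poly _ f p])
qed

text \<open>The two reductions of a product differ by an integral normal form, which lies in
  \<open>L\<close> because \<open>L\<close> contains \<open>int_quadratics\<close>.\<close>

lemma order_lattices_subset: "order_lattices C.F f \<subseteq> order_lattices C'.F f"
proof
  fix L assume L: "L \<in> order_lattices C.F f"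
  have add: "additive_subset L" and Z: "int_quadratics \<subseteq> L"
    using L by (auto simp: order_lattices_def)
  have "(p * p') mod C'.F \<in> L" if p: "p \<in> L" "p' \<in> L" for p p'
  proof -
    obtain w where w: "w \<in> int_quadratics" "(p * p') mod C.F = (p * p') mod C'.F + smult (of_nat N) w"
      using mod_congruence order_lattices_coeff[OF L] p by blast
    have "(p * p') mod C.F \<in> L" using L p by (auto simp: order_lattices_def)
    moreover have "smult (of_nat N) w \<in> L"
      using additive_subset_of_int_mult[OF add, of w "int N"] w(1) Z by (auto simp: of_nat_poly)
    ultimately have "(p * p') mod C.F - smult (of_nat N) w \<in> L" by (rule additive_subset_diff[OF add])
    then show ?thesis using w(2) by simp
  qed
  then show "L \<in> order_lattices C'.F f" using L by (auto simp: order_lattices_def)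
qed

lemma order_lattices_eq: "order_lattices C.F f = order_lattices C'.F f"
  using order_lattices_subset congruent_cubics.order_lattices_subset[OF sym] by blast

text \<open>The map is the identity on normal forms. The error of a product is \<open>N\<close>
  times an integral polynomial, whose class again belongs to the overorder, as
  \<open>congruent_rings\<close> demands.\<close>

lemma congruent_lattice_rings:
  assumes L: "L \<in> order_lattices C.F f"
  shows "congruent_rings (C.lattice_ring L) (C'.lattice_ring L) N (\<lambda>x. C'.cls (C.rep x))"
proof -
  have L': "L \<in> order_lattices C'.F f" using L order_lattices_eq by blast
  have deg: "L \<subseteq> {p. degree p < 3}" and add: "additive_subset L" and Z: "int_quadratics \<subseteq> L"
    and mult: "\<And>p p'. p \<in> L \<Longrightarrow> p' \<in> L \<Longrightarrow> (p * p') mod C.F \<in> L"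
    using L by (auto simp: order_lattices_def)
  have rep: "C.rep (C.cls p) = p" "C'.rep (C'.cls p) = p" if "p \<in> L" for p
    using that deg by (auto intro: C.rep_cls C'.rep_cls)
  interpret R: cring "C.lattice_ring L" by (rule C.lattice_ring_cring[OF L])
  interpret R': cring "C'.lattice_ring L" by (rule C'.lattice_ring_cring[OF L'])
  show ?thesis
  proof (intro congruent_rings.intro congruent_rings_axioms.intro R.is_cring R'.is_cring)
    show "bij_betw (\<lambda>x. C'.cls (C.rep x)) (carrier (C.lattice_ring L)) (carrier (C'.lattice_ring L))"
      by (rule bij_betw_byWitness[where f' = "\<lambda>x. C.cls (C'.rep x)"])
        (auto simp: C.lattice_ring_simps C'.lattice_ring_simps rep)
    fix x y assume "x \<in> carrier (C.lattice_ring L)" "y \<in> carrier (C.lattice_ring L)"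
    then obtain p p' where p: "p \<in> L" "x = C.cls p" "p' \<in> L" "y = C.cls p'"
      by (auto simp: C.lattice_ring_simps)
    have "p + p' \<in> L" using add p by (simp add: additive_subset_def)
    then show "C'.cls (C.rep (x \<oplus>\<^bsub>C.lattice_ring L\<^esub> y)) =
        C'.cls (C.rep x) \<oplus>\<^bsub>C'.lattice_ring L\<^esub> C'.cls (C.rep y)"
      using p by (simp add: C.lattice_ring_simps C'.lattice_ring_simps rep)
    obtain w where w: "w \<in> int_quadratics" "(p * p') mod C.F = (p * p') mod C'.F + smult (of_nat N) w"
      using mod_congruence order_lattices_coeff[OF L] p by blast
    have "C.rep (C.cls (p * p')) = (p * p') mod C.F"
      using C.cls_mod[of "p * p'"] rep(1)[OF mult[OF p(1,3)]] by simp
    then have "C'.cls (C.rep (x \<otimes>\<^bsub>C.lattice_ring L\<^esub> y)) =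
        C'.cls ((p * p') mod C'.F + smult (of_nat N) w)"
      using p w(2) by (simp add: C.lattice_ring_simps)
    also have "\<dots> = C'.cls (C.rep x) \<otimes>\<^bsub>C'.lattice_ring L\<^esub> C'.cls (C.rep y)
        \<oplus>\<^bsub>C'.lattice_ring L\<^esub> [N] \<cdot>\<^bsub>C'.lattice_ring L\<^esub> C'.cls w"
      using p C'.cls_mod[of "p * p'"] C'.lattice_ring_simps(5)[of L "(p * p') mod C'.F"]
      by (simp add: C'.lattice_ring_simps(4) C'.lattice_ring_nat_mult rep of_nat_poly)
    finally show "\<exists>z\<in>carrier (C'.lattice_ring L). C'.cls (C.rep (x \<otimes>\<^bsub>C.lattice_ring L\<^esub> y)) =
        C'.cls (C.rep x) \<otimes>\<^bsub>C'.lattice_ring L\<^esub> C'.cls (C.rep y)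
        \<oplus>\<^bsub>C'.lattice_ring L\<^esub> [N] \<cdot>\<^bsub>C'.lattice_ring L\<^esub> z"
      using w(1) Z C'.lattice_ring_simps(1) by blast
  qed
qed

text \<open>Through \<open>bij_overorders\<close> both sums run over the same set of lattices, so
  they can be compared term by term.\<close>

lemma overorder_sum_cong:
  assumes N: "N > 0" and d: "d dvd N"
  shows "overorder_sum a b c f N d = overorder_sum a' b' c f N d"
proof -
  have eq: "a_coeff (C.lattice_ring L) d * W_coeff (C.lattice_ring L) (N div d) =
      a_coeff (C'.lattice_ring L) d * W_coeff (C'.lattice_ring L) (N div d)"
    if L: "L \<in> order_lattices C.F f" for L
  proof -
    have L': "L \<in> order_lattices C'.F f" using L order_lattices_eq by blast
    obtain v v' where coords: "cring_coords (C.lattice_ring L) v 3" "cring_coords (C'.lattice_ring L) v' 3"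
      using C.lattice_ring_coords[OF L f] C'.lattice_ring_coords[OF L' f] by blast
    obtain e where "N = d * e" using d by blast
    then have "N div d dvd N" "N div d > 0" using N by auto
    then show ?thesis
      using congruent_rings.a_coeff_cong[OF congruent_lattice_rings[OF L] d coords]
        congruent_rings.W_coeff_cong[OF congruent_lattice_rings[OF L] _ _ coords] by simp
  qed
  have "overorder_sum a b c f N d = (\<Sum>L\<in>order_lattices C.F f.
      a_coeff (C.lattice_ring L) d * W_coeff (C.lattice_ring L) (N div d))"
    unfolding overorder_sum_def by (rule sum.reindex_bij_betw[OF C.bij_overorders, symmetric])
  also have "\<dots> = (\<Sum>L\<in>order_lattices C'.F f.
      a_coeff (C'.lattice_ring L) d * W_coeff (C'.lattice_ring L) (N div d))"
    using eq order_lattices_eq by (intro sum.cong) auto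
  also have "\<dots> = overorder_sum a' b' c f N d"
    unfolding overorder_sum_def by (rule sum.reindex_bij_betw[OF C'.bij_overorders])
  finally show ?thesis .
qed

end

text \<open>A sum over an infinite set is 0 by convention; finiteness ensures that
  \<open>overorder_sum\<close> is the intended sum.\<close>

lemma finite_overorders:
  assumes "f > 0"
  shows "finite (overorders a b c f)"
  using bij_betw_finite[OF cubic.bij_overorders] finite_order_lattices[OF assms] by blast

theorem theoremB:
  fixes p k f N d :: nat and \<epsilon> a b a' b' :: int
  assumes "Factorial_Ring.prime p"
    and "\<epsilon> = 1 \<or> \<epsilon> = -1"
    and "f > 0" and "N > 0" and "d dvd N"
    and "[a = a'] (mod int (N * f\<^sup>2))"
    and "[b = b'] (mod int (N * f\<^sup>2))"
  shows "finite (overorders a b (\<epsilon> * int p ^ k) f) \<and>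
    overorder_sum a b (\<epsilon> * int p ^ k) f N d = overorder_sum a' b' (\<epsilon> * int p ^ k) f N d"
proof
  show "finite (overorders a b (\<epsilon> * int p ^ k) f)"
    using assms(3) by (rule finite_overorders)
  have "congruent_cubics a b a' b' N f"
    using assms by unfold_locales
  then show "overorder_sum a b (\<epsilon> * int p ^ k) f N d = overorder_sum a' b' (\<epsilon> * int p ^ k) f N d"
    using assms(4,5) by (rule congruent_cubics.overorder_sum_cong)
qed

end
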